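(* Let $m\ge 6$, let $a\in\mathbb{N}$ and fix the eigenvalue $\alpha=\frac m2-1+a$. The contributions to $\ker_{1,\alpha}(L)$ in terms of $\mathfrak{so}(m)$-irreducible representations are the following. (i) From the polynomials which have degree $1$ in $\underline x$, i.e. from $(1)_x\otimes(a)_z$, one gets $$\mathcal{H}_{a,1}(\mathbb{R}^{2m},\mathbb{C})\oplus S_{xz}\mathcal{H}_{a+1}(\mathbb{R}^m,\mathbb{C})\oplus C_{xz}\mathcal{H}_{a-1}(\mathbb{R}^m,\mathbb{C}).$$ (ii) From the polynomials which have degree $1$ in $\underline y$, i.e. from $\Pi_L\big((1)_y\otimes(a-2)_z\big)$, one gets $$\Pi_L\Big(\mathcal{H}_{a-2,1}(\mathbb{R}^{2m},\mathbb{C})\oplus S_{yz}\mathcal{H}_{a-1}(\mathbb{R}^m,\mathbb{C})\oplus C_{yz}\mathcal{H}_{a-3}(\mathbb{R}^m,\mathbb{C})\Big).$$ Here any summand whose label is not a dominant weight (or has a negative entry) is to be ignored.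
   Context: Let $\underline x,\underline y,\underline z\in\mathbb{R}^m$ be three vector variables, $\langle\cdot,\cdot\rangle$ the standard bilinear pairing, $\underline\partial_x=(\partial_{x_1},\dots,\partial_{x_m})$ etc., $\mathbb{E}_x=\sum_jx_j\partial_{x_j}$ etc., $\Delta_z=\sum_j\partial_{z_j}^2$ etc. $\mathbb{N}$ includes $0$. The algebra $\mathfrak{so}(m)$ acts by simultaneous infinitesimal rotations of $\underline x,\underline y,\underline z$. Operators: $L=\langle\underline x,\underline\partial_y\rangle-\frac12\Delta_z$, $R=\langle\underline y,\underline\partial_x\rangle+\frac12|\underline z|^2$, $\mathcal{E}=\mathbb{E}_y-\mathbb{E}_x+\mathbb{E}_z+\frac m2$. $\ker_{1,\alpha}(L)$ is the space of complex polynomials $P(\underline x,\underline y,\underline z)$, homogeneous of total degree $1$ in $(\underline x,\underline y)$, with $LP=0$ and $\mathcal{E}P=\alpha P$. $(a)_z=\mathcal{H}_a(\mathbb{R}^m,\mathbb{C})$ is the space of harmonic polynomials in $\underline z$ homogeneous of degree $a$ (zero if $a<0$); $(1)_x=\mathrm{span}\{x_j\}$, $(1)_y=\mathrm{span}\{y_j\}$; tensor products are realised as spans of products of polynomials. For $k\ge\ell$, $\mathcal{H}_{k,\ell}(\mathbb{R}^{2m},\mathbb{C})$ is the space of simplicial harmonics: in (i), polynomials in $(\underline z,\underline x)$ homogeneous of degree $k$ in $\underline z$ and $\ell$ in $\underline x$ annihilated by $\Delta_z,\Delta_x,\langle\underline\partial_z,\underline\partial_x\rangle,\langle\underline z,\underline\partial_x\rangle$;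 in (ii), the same with $\underline x$ replaced by $\underline y$. It is a model for the $\mathfrak{so}(m)$-irreducible module with highest weight $(k,\ell,0,\dots,0)$. Transvector generators (a fraction $A/B$ means $B^{-1}A$): $$S_{xz}=\langle\underline x,\underline\partial_z\rangle-\frac{|\underline x|^2\langle\underline\partial_x,\underline\partial_z\rangle}{2\mathbb{E}_x+m-4},$$ $$C_{xz}=\langle\underline x,\underline z\rangle-\frac{|\underline x|^2\langle\underline z,\underline\partial_x\rangle}{2\mathbb{E}_x+m-4}-\frac{|\underline z|^2\langle\underline x,\underline\partial_z\rangle}{2\mathbb{E}_z+m-4}+\frac{|\underline x|^2|\underline z|^2\langle\underline\partial_x,\underline\partial_z\rangle}{(2\mathbb{E}_x+m-4)(2\mathbb{E}_z+m-4)},$$ and $S_{yz},C_{yz}$ are obtained by replacing $\underline x$ by $\underline y$. $\Pi_L=1+\frac1{\mathcal{E}-2}RL$ is the truncated projection operator onto $\ker L$ (apply $RL$, then $(\mathcal{E}-2)^{-1}$). *)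

theory Defs
  imports "HOL-Analysis.Analysis" "HOL-Library.Poly_Mapping"
begin

section \<open>Polynomials in three vector variables\<close>

text \<open>The dimension \<open>m\<close> is \<open>CARD('n)\<close>; the vector variables are the constructors \<open>X\<close>, \<open>Y\<close>, \<open>Z\<close>,
  so an argument \<open>u :: 'n \<Rightarrow> 'n var\<close> below stands for one of the vectors x, y, z.
  Polynomials are formal: finitely supported families of coefficients indexed by exponent vectors.\<close>

datatype 'n var = X 'n | Y 'n | Z 'n

type_synonym 'n cpoly = "('n var \<Rightarrow>\<^sub>0 nat) \<Rightarrow>\<^sub>0 complex"

definition cscale :: "complex \<Rightarrow> 'n cpoly \<Rightarrow> 'n cpoly" where
  "cscale c p = Poly_Mapping.single 0 c * p"

interpretation cpoly: vector_space "cscale :: complex \<Rightarrow> 'n cpoly \<Rightarrow> 'n cpoly"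
  by unfold_locales
    (simp_all add: cscale_def algebra_simps single_add mult_single flip: mult.assoc)

definition mvar :: "'n var \<Rightarrow> 'n cpoly" where
  "mvar v = Poly_Mapping.single (Poly_Mapping.single v 1) 1"

text \<open>Partial derivative. The truncated subtraction of exponents is harmless: if \<open>v\<close> does not occur
  in a monomial, then its coefficient is multiplied by 0.\<close>

definition pd :: "'n var \<Rightarrow> 'n cpoly \<Rightarrow> 'n cpoly" where
  "pd v p = (\<Sum>\<mu>\<in>Poly_Mapping.keys p. Poly_Mapping.single (\<mu> - Poly_Mapping.single v 1)
      (of_nat (Poly_Mapping.lookup \<mu> v) * Poly_Mapping.lookup p \<mu>))"

definition polynomials_in :: "'n var set \<Rightarrow> 'n cpoly set" where
  "polynomials_in V = {p. \<forall>\<mu>\<in>Poly_Mapping.keys p. Poly_Mapping.keys \<mu> \<subseteq> V}"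

text \<open>Degrees are integers, so that for negative \<open>d\<close> only the zero polynomial qualifies.\<close>

definition homogeneous_in :: "'n::finite var set \<Rightarrow> int \<Rightarrow> 'n cpoly set" where
  "homogeneous_in V d =
     {p. \<forall>\<mu>\<in>Poly_Mapping.keys p. int (\<Sum>v\<in>V. Poly_Mapping.lookup \<mu> v) = d}"


section \<open>Differential operators\<close>

definition vdot :: "('n::finite \<Rightarrow> 'n var) \<Rightarrow> ('n \<Rightarrow> 'n var) \<Rightarrow> 'n cpoly" where
  "vdot u v = (\<Sum>j\<in>UNIV. mvar (u j) * mvar (v j))"

definition vdotD :: "('n::finite \<Rightarrow> 'n var) \<Rightarrow> ('n \<Rightarrow> 'n var) \<Rightarrow> 'n cpoly \<Rightarrow> 'n cpoly" where
  "vdotD u v p = (\<Sum>j\<in>UNIV. mvar (u j) * pd (v j) p)"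

definition DdotD :: "('n::finite \<Rightarrow> 'n var) \<Rightarrow> ('n \<Rightarrow> 'n var) \<Rightarrow> 'n cpoly \<Rightarrow> 'n cpoly" where
  "DdotD u v p = (\<Sum>j\<in>UNIV. pd (u j) (pd (v j) p))"

abbreviation Euler :: "('n::finite \<Rightarrow> 'n var) \<Rightarrow> 'n cpoly \<Rightarrow> 'n cpoly" where
  "Euler u \<equiv> vdotD u u"

abbreviation Laplace :: "('n::finite \<Rightarrow> 'n var) \<Rightarrow> 'n cpoly \<Rightarrow> 'n cpoly" where
  "Laplace u \<equiv> DdotD u u"

definition opL :: "'n::finite cpoly \<Rightarrow> 'n cpoly" where
  "opL p = vdotD X Y p - cscale (1/2) (Laplace Z p)"

definition opR :: "'n::finite cpoly \<Rightarrow> 'n cpoly" where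
  "opR p = vdotD Y X p + cscale (1/2) (vdot Z Z * p)"

definition opE :: "'n::finite cpoly \<Rightarrow> 'n cpoly" where
  "opE p = Euler Y p - Euler X p + Euler Z p + cscale (of_nat CARD('n) / 2) p"

definition ker_L :: "int \<Rightarrow> complex \<Rightarrow> 'n::finite cpoly set" where
  "ker_L k \<alpha> = {p \<in> homogeneous_in (range X \<union> range Y) k. opL p = 0 \<and> opE p = cscale \<alpha> p}"

text \<open>All operators that get inverted are of Euler type, i.e. act diagonally on monomials. Such an
  operator \<open>B\<close> is a bijection of its range (the sum of the eigenspaces for nonzero eigenvalues) onto
  itself, and \<open>op_inverse B\<close> is the inverse there. If \<open>B\<close> is bijective, this is \<open>inv B\<close>;
  this is so for \<open>2 E\<^sub>u + m - 4\<close> when \<open>m > 4\<close>, but not in general for \<open>\<E> - 2\<close>.\<close>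

definition op_inverse :: "('n cpoly \<Rightarrow> 'n cpoly) \<Rightarrow> 'n cpoly \<Rightarrow> 'n cpoly" where
  "op_inverse B = inv_into (range B) B"

definition euler_denom :: "('n::finite \<Rightarrow> 'n var) \<Rightarrow> 'n cpoly \<Rightarrow> 'n cpoly" where
  "euler_denom u p = cscale 2 (Euler u p) + cscale (of_nat CARD('n) - 4) p"

definition opS :: "('n::finite \<Rightarrow> 'n var) \<Rightarrow> 'n cpoly \<Rightarrow> 'n cpoly" where
  "opS u p = vdotD u Z p - op_inverse (euler_denom u) (vdot u u * DdotD u Z p)"

definition opC :: "('n::finite \<Rightarrow> 'n var) \<Rightarrow> 'n cpoly \<Rightarrow> 'n cpoly" where
  "opC u p = vdot u Z * p
     - op_inverse (euler_denom u) (vdot u u * vdotD Z u p)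
     - op_inverse (euler_denom Z) (vdot Z Z * vdotD u Z p)
     + op_inverse (euler_denom u \<circ> euler_denom Z) (vdot u u * vdot Z Z * DdotD u Z p)"

definition proj_L :: "'n::finite cpoly \<Rightarrow> 'n cpoly" where
  "proj_L p = p + op_inverse (\<lambda>q. opE q - cscale 2 q) (opR (opL p))"


section \<open>Harmonic polynomials\<close>

definition harmonics :: "int \<Rightarrow> 'n::finite cpoly set" where
  "harmonics a = {p \<in> polynomials_in (range Z) \<inter> homogeneous_in (range Z) a. Laplace Z p = 0}"

text \<open>Labels that are not dominant weights are to be ignored, hence the zero space for them.\<close>

definition simplicial_harmonics :: "('n::finite \<Rightarrow> 'n var) \<Rightarrow> int \<Rightarrow> int \<Rightarrow> 'n cpoly set" where
  "simplicial_harmonics u k l = (if 0 \<le> l \<and> l \<le> k then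
     {p \<in> polynomials_in (range Z \<union> range u) \<inter> homogeneous_in (range Z) k \<inter> homogeneous_in (range u) l.
        Laplace Z p = 0 \<and> Laplace u p = 0 \<and> DdotD Z u p = 0 \<and> vdotD Z u p = 0}
     else {0})"

definition linear_forms :: "('n \<Rightarrow> 'n var) \<Rightarrow> 'n cpoly set" where
  "linear_forms u = cpoly.span (range (\<lambda>j. mvar (u j)))"

definition poly_tensor :: "'n cpoly set \<Rightarrow> 'n cpoly set \<Rightarrow> 'n cpoly set" where
  "poly_tensor U V = cpoly.span {p * q | p q. p \<in> U \<and> q \<in> V}"

text \<open>\<open>W\<close> is the internal direct sum of the subspaces in the list: every element of \<open>W\<close> is a sum of
  elements of the summands in exactly one way.\<close>

definition is_direct_sum :: "'n cpoly set \<Rightarrow> 'n cpoly set list \<Rightarrow> bool" where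
  "is_direct_sum W Us \<longleftrightarrow> (\<forall>U\<in>set Us. cpoly.subspace U) \<and> bij_betw sum_list (listset Us) W"


section \<open>The action of so(m)\<close>

text \<open>For skew-symmetric \<open>A\<close> this is the derivative at \<open>t = 0\<close> of
  \<open>p (exp (-t A) x, exp (-t A) y, exp (-t A) z)\<close>.\<close>

definition so_act :: "real^'n^'n \<Rightarrow> 'n::finite cpoly \<Rightarrow> 'n cpoly" where
  "so_act A p = (\<Sum>i\<in>UNIV. \<Sum>j\<in>UNIV. cscale (of_real (A $ i $ j))
     (mvar (X i) * pd (X j) p + mvar (Y i) * pd (Y j) p + mvar (Z i) * pd (Z j) p))"

definition so_submodule :: "'n::finite cpoly set \<Rightarrow> bool" where
  "so_submodule U \<longleftrightarrow> cpoly.subspace U \<and> (\<forall>A. transpose A = - A \<longrightarrow> so_act A ` U \<subseteq> U)"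

definition so_irreducible :: "'n::finite cpoly set \<Rightarrow> bool" where
  "so_irreducible V \<longleftrightarrow> so_submodule V \<and> V \<noteq> {0} \<and>
     (\<forall>U. so_submodule U \<and> U \<subseteq> V \<longrightarrow> U = {0} \<or> U = V)"

definition so_isomorphism ::
  "('n::finite cpoly \<Rightarrow> 'n cpoly) \<Rightarrow> 'n cpoly set \<Rightarrow> 'n cpoly set \<Rightarrow> bool" where
  "so_isomorphism T U V \<longleftrightarrow> so_submodule U \<and> so_submodule V \<and> bij_betw T U V \<and>
     (\<forall>p\<in>U. \<forall>q\<in>U. T (p + q) = T p + T q) \<and> (\<forall>c. \<forall>p\<in>U. T (cscale c p) = cscale c (T p)) \<and>
     (\<forall>A. transpose A = - A \<longrightarrow> (\<forall>p\<in>U. T (so_act A p) = so_act A (T p)))"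

end

theory Submission
  imports Defs
begin

text \<open>
  An element of the kernel of L splits into a part linear in x and a part linear in y. Comparing degrees
  in \<open>L P = 0\<close>, the y-part is an arbitrary y-linear polynomial harmonic in z, and it is completed to a
  kernel element by the projection, which multiplies the y-part by a nonzero constant. The linear
  harmonics decompose by contraction: \<open>DdotD Z u\<close> detects the image of \<open>opC u\<close>, \<open>vdotD Z u\<close> detects
  that of \<open>opS u\<close>, and the common kernel is the space of simplicial harmonics.

  For irreducibility, fix two coordinates e, f and the isotropic vector they span. Its stabiliser in
  so(m) has a commuting family of raising operators, which are nilpotent, so that every nonzero
  submodule contains a nonzero vector annihilated by all of them. In the harmonics of degree k these
  vectors are the multiples of the k-th power of the isotropic coordinate; in the simplicial harmonics
  they form one copy of the vector representation of so(m-2). As the complement of a submodule with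
  respect to the Fischer form is again a submodule, a proper nonzero submodule would lead to such a
  vector lying in two submodules that meet only in 0.
\<close>

section \<open>Polynomial calculus\<close>

text \<open>The hard point is to find the vectors killed by all raising operators. For harmonics in
  z, \<open>raise j p = 0\<close> reads
  \<open>iso_coord Z * pd (Z j) p = mvar (Z j) * d_iso Z p\<close>; once
  \<open>d_iso Z p = 0\<close> is known, cancelling \<open>iso_coord Z\<close> leaves only powers of
  that coordinate. To get there, these first-order equations are differentiated by z_j and summed,
  and the Laplace and Euler equations are inserted: what remains is a positive integer times
  \<open>d_iso Z p\<close>. For linear harmonics the same trace argument couples
  \<open>d_iso Z\<close> with \<open>d_iso u\<close>, and the equation
  \<open>vdotD Z u p = 0\<close> decouples them. At least three coordinates must remain besides e
  and f: the vector representation of so(2) over the complex numbers splits into two isotropic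
  lines, and for m = 4 the simplicial harmonics themselves split. The denominators are inverted only
  on eigenvectors, so the operators become explicit formulas with scalar coefficients. Labels such
  as a - 3 may be negative, where a denominator can be 0; the corresponding space is then zero, and
  the formulas carry this case along.\<close>

definition cst :: "complex \<Rightarrow> 'n cpoly" where
  "cst c = Poly_Mapping.single 0 c"

text \<open>With scalars embedded as ring elements, scalar multiples are products, and the ring laws
  and the Leibniz rule apply to them.\<close>

lemma cscale_eq_cst: "cscale c p = cst c * p"
  by (simp add: cscale_def cst_def)

lemma cst_0 [simp]: "cst 0 = 0" and cst_1 [simp]: "cst 1 = 1"
  by (simp_all add: cst_def)

lemma cst_add: "cst (a + b) = cst a + cst b"
  and cst_diff: "cst (a - b) = cst a - cst b"
  and cst_minus: "cst (- a) = - cst a"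
  and cst_mult: "cst (a * b) = cst a * cst b"
  by (simp_all add: cst_def single_add single_diff single_uminus mult_single)

lemma cst_of_nat [simp]: "cst (of_nat k) = of_nat k"
  and cst_of_int [simp]: "cst (of_int i) = of_int i"
  and cst_numeral [simp]: "cst (numeral w) = numeral w"
  by (simp_all add: cst_def)

lemma cst_mult_eq_0_iff [simp]: "cst c * p = 0 \<longleftrightarrow> c = 0 \<or> p = 0"
  using cpoly.scale_eq_0_iff[of c p] by (simp add: cscale_eq_cst)

lemma lookup_cst_mult: "Poly_Mapping.lookup (cst c * p) \<mu> = c * Poly_Mapping.lookup p \<mu>"
  by (simp add: cst_def map.rep_eq when_def flip: mult_map_scale_conv_mult)

lemma cpoly_induct [case_names single add]:
  fixes p :: "'n cpoly"
  assumes "\<And>\<mu> c. P (Poly_Mapping.single \<mu> c)" and "\<And>p q. P p \<Longrightarrow> P q \<Longrightarrow> P (p + q)"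
  shows "P p"
proof (induction p rule: update_induct)
  case const
  show ?case using assms(1)[of 0 0] by simp
next
  case (update f a b)
  have "Poly_Mapping.update a b f = f + Poly_Mapping.single a b"
    using update by (intro poly_mapping_eqI)
      (auto simp: lookup_update lookup_add lookup_single when_def in_keys_iff)
  then show ?case using update assms by simp
qed

text \<open>Only exponents with a positive entry at \<open>v\<close> contribute, and on those the
  truncated subtraction of the unit exponent is injective; hence at most one key of \<open>p\<close>
  survives in the sum.\<close>

lemma lookup_pd:
  "Poly_Mapping.lookup (pd v p) \<mu> =
     of_nat (Poly_Mapping.lookup \<mu> v + 1) * Poly_Mapping.lookup p (\<mu> + Poly_Mapping.single v 1)"
proof -
  let ?e = "Poly_Mapping.single v (1::nat)"
  have eq: "\<kappa> - ?e = \<mu> \<longleftrightarrow> \<kappa> = \<mu> + ?e" if "Poly_Mapping.lookup \<kappa> v \<noteq> 0" for \<kappa>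
  proof
    assume "\<kappa> - ?e = \<mu>"
    then show "\<kappa> = \<mu> + ?e"
      using that by (auto intro!: poly_mapping_eqI simp: lookup_add lookup_minus lookup_single when_def)
  qed simp
  have "Poly_Mapping.lookup (pd v p) \<mu> = (\<Sum>\<kappa>\<in>Poly_Mapping.keys p.
      if \<mu> + ?e = \<kappa> then of_nat (Poly_Mapping.lookup \<mu> v + 1) * Poly_Mapping.lookup p \<kappa> else 0)"
    unfolding pd_def lookup_sum
  proof (rule sum.cong[OF refl])
    fix \<kappa>
    show "Poly_Mapping.lookup (Poly_Mapping.single (\<kappa> - ?e)
        (of_nat (Poly_Mapping.lookup \<kappa> v) * Poly_Mapping.lookup p \<kappa>)) \<mu>
      = (if \<mu> + ?e = \<kappa> then of_nat (Poly_Mapping.lookup \<mu> v + 1) * Poly_Mapping.lookup p \<kappa> else 0)"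
      using eq[of \<kappa>] by (cases "Poly_Mapping.lookup \<kappa> v = 0")
        (auto simp: lookup_single when_def lookup_add)
  qed
  then show ?thesis by (simp add: sum.delta in_keys_iff)
qed

lemma lookup_mvar_mult:
  "Poly_Mapping.lookup (mvar v * p) \<mu> =
     (if Poly_Mapping.lookup \<mu> v = 0 then 0 else Poly_Mapping.lookup p (\<mu> - Poly_Mapping.single v 1))"
proof (induction p rule: cpoly_induct)
  case (single \<kappa> c)
  have "Poly_Mapping.single v 1 + \<kappa> = \<mu> \<longleftrightarrow>
      Poly_Mapping.lookup \<mu> v \<noteq> 0 \<and> \<kappa> = \<mu> - Poly_Mapping.single v 1"
    by (auto intro!: poly_mapping_eqI simp: lookup_add lookup_minus lookup_single when_def)
  then show ?case by (simp add: mvar_def mult_single lookup_single when_def)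
qed (simp add: ring_distribs lookup_add)

lemma pd_single:
  "pd v (Poly_Mapping.single \<mu> c) =
     Poly_Mapping.single (\<mu> - Poly_Mapping.single v 1) (of_nat (Poly_Mapping.lookup \<mu> v) * c)"
  by (cases "c = 0") (simp_all add: pd_def)

lemma pd_add: "pd v (p + q) = pd v p + pd v q"
  by (intro poly_mapping_eqI) (simp add: lookup_pd lookup_add algebra_simps)

lemma pd_0 [simp]: "pd v 0 = 0"
  by (simp add: pd_def)

lemma pd_mult: "pd v (p * q) = pd v p * q + p * pd v q"
proof (induction p rule: cpoly_induct)
  case (single \<mu> c)
  show ?case
  proof (induction q rule: cpoly_induct)
    case (single \<nu> d)
    let ?e = "Poly_Mapping.single v (1::nat)"
    have 1: "\<mu> + \<nu> - ?e = \<mu> - ?e + \<nu>" if "Poly_Mapping.lookup \<mu> v \<noteq> 0"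
      using that by (auto intro!: poly_mapping_eqI simp: lookup_add lookup_minus lookup_single when_def)
    have 2: "\<mu> + \<nu> - ?e = \<mu> + (\<nu> - ?e)" if "Poly_Mapping.lookup \<nu> v \<noteq> 0"
      using that by (auto intro!: poly_mapping_eqI simp: lookup_add lookup_minus lookup_single when_def)
    show ?case
      using 1 2 by (cases "Poly_Mapping.lookup \<mu> v = 0"; cases "Poly_Mapping.lookup \<nu> v = 0")
        (simp_all add: pd_single mult_single lookup_add algebra_simps flip: single_add)
  qed (simp add: pd_add algebra_simps)
qed (simp add: pd_add algebra_simps)

lemma pd_cst [simp]: "pd v (cst c) = 0"
  by (simp add: cst_def pd_single)

lemma pd_1 [simp]: "pd v 1 = 0"
  using pd_cst[of v 1] by simp

lemma pd_of_nat [simp]: "pd v (of_nat k) = 0"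
  using pd_cst[of v "of_nat k"] by simp

lemma pd_of_int [simp]: "pd v (of_int k) = 0"
  using pd_cst[of v "of_int k"] by simp

lemma pd_numeral [simp]: "pd v (numeral k) = 0"
  using pd_cst[of v "numeral k"] by simp

lemma pd_minus: "pd v (- p) = - pd v p"
  using pd_add[of v p "- p"] by (simp add: add_eq_0_iff)

lemma pd_diff: "pd v (p - q) = pd v p - pd v q"
  using pd_add[of v p "- q"] by (simp add: pd_minus)

lemma pd_sum: "pd v (sum f A) = (\<Sum>i\<in>A. pd v (f i))"
  by (induction A rule: infinite_finite_induct) (simp_all add: pd_add)

lemma pd_mvar: "pd v (mvar w) = (if v = w then 1 else 0)"
  by (auto simp: mvar_def pd_single lookup_single when_def)

lemma pd_commute: "pd v (pd w p) = pd w (pd v p)"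
  by (intro poly_mapping_eqI) (auto simp: lookup_pd lookup_add lookup_single when_def ac_simps)

lemma pd_scale: "pd v (cst c * p) = cst c * pd v p"
  by (simp add: pd_mult)

lemma cpoly_char_0: "of_nat k * (p :: 'n cpoly) = 0 \<longleftrightarrow> k = 0 \<or> p = 0"
  using cst_mult_eq_0_iff[of "of_nat k" p] by simp

text \<open>The type \<open>'n \<Rightarrow> 'n var\<close> also contains functions that mix or
  repeat variables. Restricting to the three constructors gives the Kronecker rule
  \<open>vec_var_eq_iff\<close>, on which the commutators rest.\<close>

definition vecs :: "('n \<Rightarrow> 'n var) set" where
  "vecs = {X, Y, Z}"

lemma vecs_simps [simp]: "X \<in> vecs" "Y \<in> vecs" "Z \<in> vecs"
  by (simp_all add: vecs_def)

lemma vec_neq [simp]: "X \<noteq> Y" "Y \<noteq> X" "X \<noteq> Z" "Z \<noteq> X" "Y \<noteq> Z" "Z \<noteq> Y"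
  by (auto dest: fun_cong)

lemma vec_var_eq_iff: "u \<in> vecs \<Longrightarrow> v \<in> vecs \<Longrightarrow> u i = v j \<longleftrightarrow> u = v \<and> i = j"
  by (auto simp: vecs_def)

lemma inj_vec: "u \<in> vecs \<Longrightarrow> inj u"
  by (simp add: inj_def vec_var_eq_iff)

lemma mult_of_if:
  fixes x :: "'b::semiring_1"
  shows "(if P then 1 else 0) * x = (if P then x else 0)" and "x * (if P then 1 else 0) = (if P then x else 0)"
  by simp_all

lemma pd_mvar_vec: "u \<in> vecs \<Longrightarrow> v \<in> vecs \<Longrightarrow> pd (u i) (mvar (v j)) = (if u = v \<and> i = j then 1 else 0)"
  by (simp add: pd_mvar vec_var_eq_iff)

section \<open>Commutators of the invariant operators\<close>

lemma vdotD_add: "vdotD u v (p + q) = vdotD u v p + vdotD u v q"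
  by (simp add: vdotD_def pd_add algebra_simps sum.distrib)

lemma vdotD_0 [simp]: "vdotD u v 0 = 0"
  by (simp add: vdotD_def)

lemma vdotD_diff: "vdotD u v (p - q) = vdotD u v p - vdotD u v q"
  by (simp add: vdotD_def pd_diff algebra_simps sum_subtractf)

lemma vdotD_mult: "vdotD u v (p * q) = vdotD u v p * q + p * vdotD u v q"
  by (simp add: vdotD_def pd_mult algebra_simps sum.distrib sum_distrib_left)

lemma vdotD_sum: "vdotD u v (sum f A) = (\<Sum>i\<in>A. vdotD u v (f i))"
  by (induction A rule: infinite_finite_induct) (simp_all add: vdotD_add)

lemma vdotD_cst [simp]: "vdotD u v (cst c) = 0" and vdotD_of_nat [simp]: "vdotD u v (of_nat k) = 0"
  and vdotD_of_int [simp]: "vdotD u v (of_int i) = 0" and vdotD_numeral [simp]: "vdotD u v (numeral w) = 0"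
  and vdotD_1 [simp]: "vdotD u v 1 = 0"
  by (simp_all add: vdotD_def)

lemma vdotD_mvar:
  "w \<in> vecs \<Longrightarrow> v \<in> vecs \<Longrightarrow> vdotD u v (mvar (w j)) = (if v = w then mvar (u j) else 0)"
  by (auto simp: vdotD_def pd_mvar_vec if_distrib sum.delta cong: if_cong)

lemma DdotD_add: "DdotD u v (p + q) = DdotD u v p + DdotD u v q"
  by (simp add: DdotD_def pd_add sum.distrib)

lemma DdotD_0 [simp]: "DdotD u v 0 = 0"
  by (simp add: DdotD_def)

lemma DdotD_diff: "DdotD u v (p - q) = DdotD u v p - DdotD u v q"
  by (simp add: DdotD_def pd_diff sum_subtractf)

lemma DdotD_sum: "DdotD u v (sum f A) = (\<Sum>i\<in>A. DdotD u v (f i))"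
  by (induction A rule: infinite_finite_induct) (simp_all add: DdotD_add)

lemma DdotD_scale: "DdotD u v (cst c * p) = cst c * DdotD u v p"
  by (simp add: DdotD_def pd_mult sum_distrib_left)

lemma DdotD_of_int_mult: "DdotD u v (of_int i * p) = of_int i * DdotD u v p"
  using DdotD_scale[of u v "of_int i" p] by simp

lemma DdotD_commute: "DdotD u v p = DdotD v u p"
  by (simp add: DdotD_def pd_commute)

lemma vdot_commute: "vdot u v = vdot v u"
  by (simp add: vdot_def mult.commute)

lemma DdotD_mult:
  "DdotD u v (p * q) = DdotD u v p * q + p * DdotD u v q +
     (\<Sum>i\<in>UNIV. pd (u i) p * pd (v i) q + pd (v i) p * pd (u i) q)"
  by (simp add: DdotD_def pd_mult pd_add algebra_simps sum.distrib sum_distrib_left)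

lemma pd_vdotD:
  assumes "a \<in> vecs" "c \<in> vecs"
  shows "pd (a i) (vdotD c d p) = vdotD c d (pd (a i) p) + (if a = c then pd (d i) p else 0)"
  using assms
  by (auto simp: vdotD_def pd_sum pd_mult pd_mvar_vec sum.distrib pd_commute[of "a i"]
      if_distrib[of "\<lambda>x. x * _"] sum.delta cong: if_cong)

lemma pd_DdotD: "pd w (DdotD c d p) = DdotD c d (pd w p)"
  by (simp add: DdotD_def pd_sum pd_commute[of w])

lemma pd_vdot:
  assumes "a \<in> vecs" "c \<in> vecs" "d \<in> vecs"
  shows "pd (a i) (vdot c d) = (if a = c then mvar (d i) else 0) + (if a = d then mvar (c i) else 0)"
proof -
  have "pd (a i) (vdot c d) = (\<Sum>j\<in>UNIV. if i = j then (if a = c then mvar (d i) else 0) + (if a = d then mvar (c i) else 0) else 0)"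
    using assms by (cases "a = c"; cases "a = d")
      (simp_all add: vdot_def pd_sum pd_mult pd_mvar_vec mult_of_if sum.distrib flip: sum_distrib_left)
  then show ?thesis by simp
qed

text \<open>The relations of gl(3), with \<open>vdotD u v\<close> in the role of matrix units
  indexed by the vectors. Together with the relations for \<open>DdotD\<close> and
  \<open>vdot\<close> in the next three lemmas they belong to the algebra sp(6) of so(m)-invariant
  operators, in which the later operator identities are computed.\<close>

lemma vdotD_commutator:
  assumes "a \<in> vecs" "b \<in> vecs" "c \<in> vecs" "d \<in> vecs"
  shows "vdotD a b (vdotD c d p) =
    vdotD c d (vdotD a b p) + (if b = c then vdotD a d p else 0) - (if a = d then vdotD c b p else 0)"
proof -
  have "vdotD a b (vdotD c d p) = (\<Sum>i\<in>UNIV. mvar (a i) * vdotD c d (pd (b i) p)) + (if b = c then vdotD a d p else 0)"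
    using assms by (simp add: vdotD_def[of a] pd_vdotD algebra_simps sum.distrib)
  moreover have "vdotD c d (vdotD a b p) = (\<Sum>i\<in>UNIV. mvar (a i) * vdotD c d (pd (b i) p)) + (if a = d then vdotD c b p else 0)"
    using assms by (auto simp: vdotD_def[of a b] vdotD_sum vdotD_mult vdotD_mvar sum.distrib) (simp_all add: vdotD_def)
  ultimately show ?thesis by simp
qed

lemma DdotD_vdotD:
  assumes "a \<in> vecs" "b \<in> vecs" "c \<in> vecs"
  shows "DdotD a b (vdotD c d p) =
    vdotD c d (DdotD a b p) + (if b = c then DdotD a d p else 0) + (if a = c then DdotD d b p else 0)"
  using assms by (auto simp: DdotD_def pd_vdotD pd_add vdotD_sum sum.distrib)

lemma vdotD_vdot_mult:
  assumes "b \<in> vecs" "c \<in> vecs" "d \<in> vecs"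
  shows "vdotD a b (vdot c d * p) =
    vdot c d * vdotD a b p + (if b = c then vdot a d * p else 0) + (if b = d then vdot a c * p else 0)"
proof -
  have "vdotD a b (vdot c d) = (if b = c then vdot a d else 0) + (if b = d then vdot a c else 0)"
    using assms by (cases "b = c"; cases "b = d")
      (simp_all add: vdotD_def pd_vdot distrib_left sum.distrib, simp_all add: vdot_def sum_distrib_left mult_ac)
  then show ?thesis by (simp add: vdotD_mult algebra_simps)
qed

text \<open>The dimension enters here: the second derivatives of the pairing contract a Kronecker
  delta with itself.\<close>

lemma DdotD_vdot_mult:
  assumes "a \<in> vecs" "b \<in> vecs" "c \<in> vecs" "d \<in> vecs"
  shows "DdotD a b (vdot c d * (p :: 'n::finite cpoly)) = vdot c d * DdotD a b p +
    (if a = c then vdotD d b p else 0) + (if a = d then vdotD c b p else 0) +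
    (if b = c then vdotD d a p else 0) + (if b = d then vdotD c a p else 0) +
    (if a = c \<and> b = d then of_nat CARD('n) * p else 0) + (if a = d \<and> b = c then of_nat CARD('n) * p else 0)"
proof -
  have 1: "DdotD a b (vdot c d) * p =
      (if a = c \<and> b = d then of_nat CARD('n) * p else 0) + (if a = d \<and> b = c then of_nat CARD('n) * p else 0)"
    using assms by (cases "a = c"; cases "a = d"; cases "b = c"; cases "b = d")
      (simp_all add: DdotD_def pd_vdot pd_mvar_vec pd_add pd_mult)
  have 2: "(\<Sum>i\<in>UNIV. pd (a i) (vdot c d) * pd (b i) p + pd (b i) (vdot c d) * pd (a i) p) =
     (if a = c then vdotD d b p else 0) + (if a = d then vdotD c b p else 0) +
    (if b = c then vdotD d a p else 0) + (if b = d then vdotD c a p else 0)"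
    using assms by (cases "a = c"; cases "a = d"; cases "b = c"; cases "b = d")
      (simp_all add: pd_vdot vdotD_def distrib_right sum.distrib sum_distrib_left add_ac mult_ac)
  show ?thesis by (simp only: DdotD_mult 1 2 add_ac)
qed

section \<open>Degrees as eigenvalues of Euler operators\<close>

lemma lookup_Euler:
  "Poly_Mapping.lookup (Euler u p) \<mu> = of_nat (\<Sum>j\<in>UNIV. Poly_Mapping.lookup \<mu> (u j)) * Poly_Mapping.lookup p \<mu>"
proof -
  have "Poly_Mapping.lookup (mvar v * pd v p) \<mu> = of_nat (Poly_Mapping.lookup \<mu> v) * Poly_Mapping.lookup p \<mu>" for v
  proof (cases "Poly_Mapping.lookup \<mu> v = 0")
    case False
    then have "\<mu> - Poly_Mapping.single v 1 + Poly_Mapping.single v 1 = \<mu>"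
      by (auto intro!: poly_mapping_eqI simp: lookup_add lookup_minus lookup_single when_def)
    with False show ?thesis by (auto simp: lookup_mvar_mult lookup_pd lookup_minus of_nat_diff)
  qed (simp add: lookup_mvar_mult)
  then show ?thesis by (simp add: vdotD_def lookup_sum sum_distrib_right)
qed

lemma lookup_of_int_mult: "Poly_Mapping.lookup (of_int k * (p :: 'n cpoly)) \<mu> = of_int k * Poly_Mapping.lookup p \<mu>"
  using lookup_cst_mult[of "of_int k" p \<mu>] by simp

text \<open>Turns a condition on exponents into an eigenvalue equation, so that degrees can be
  followed through the commutators.\<close>

lemma homogeneous_in_range_iff:
  assumes "u \<in> vecs"
  shows "p \<in> homogeneous_in (range u) d \<longleftrightarrow> Euler u p = of_int d * p"
proof -
  have "(\<Sum>v\<in>range u. Poly_Mapping.lookup \<mu> v) = (\<Sum>j\<in>UNIV. Poly_Mapping.lookup \<mu> (u j))" for \<mu> :: "'a var \<Rightarrow>\<^sub>0 nat"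
    using inj_vec[OF assms] by (simp add: sum.reindex)
  moreover have "complex_of_nat k = of_int d \<longleftrightarrow> int k = d" for k
    by (metis of_int_eq_iff of_int_of_nat_eq)
  ultimately show ?thesis
    by (auto simp: homogeneous_in_def poly_mapping_eq_iff fun_eq_iff lookup_Euler lookup_of_int_mult in_keys_iff simp del: of_nat_sum)
qed

lemma homogeneous_in_XY_iff:
  "p \<in> homogeneous_in (range X \<union> range Y) d \<longleftrightarrow> Euler X p + Euler Y p = of_int d * p"
proof -
  have "(\<Sum>v\<in>range X \<union> range Y. Poly_Mapping.lookup \<mu> v) =
     (\<Sum>j\<in>UNIV. Poly_Mapping.lookup \<mu> (X j)) + (\<Sum>j\<in>UNIV. Poly_Mapping.lookup \<mu> (Y j))" for \<mu> :: "'a var \<Rightarrow>\<^sub>0 nat"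
    by (subst sum.union_disjoint) (auto simp: sum.reindex inj_vec)
  moreover have "complex_of_nat k = of_int d \<longleftrightarrow> int k = d" for k
    by (metis of_int_eq_iff of_int_of_nat_eq)
  ultimately show ?thesis
    by (auto simp: homogeneous_in_def poly_mapping_eq_iff fun_eq_iff lookup_Euler lookup_of_int_mult in_keys_iff
      lookup_add simp flip: distrib_right of_nat_add simp del: of_nat_sum)
qed

lemma Euler_eq_0_iff:
  assumes "u \<in> vecs"
  shows "Euler u p = 0 \<longleftrightarrow> (\<forall>\<mu>\<in>Poly_Mapping.keys p. \<forall>j. u j \<notin> Poly_Mapping.keys \<mu>)"
  by (auto simp: poly_mapping_eq_iff fun_eq_iff lookup_Euler in_keys_iff simp flip: of_nat_sum)

lemma polynomials_in_Z_iff: "p \<in> polynomials_in (range Z) \<longleftrightarrow> Euler X p = 0 \<and> Euler Y p = 0"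
proof -
  have "Poly_Mapping.keys \<mu> \<subseteq> range Z \<longleftrightarrow> (\<forall>j. X j \<notin> Poly_Mapping.keys \<mu>) \<and> (\<forall>j. Y j \<notin> Poly_Mapping.keys \<mu>)"
    for \<mu> :: "'a var \<Rightarrow>\<^sub>0 nat"
    by (auto simp: subset_iff) (metis var.exhaust rangeI)
  then show ?thesis by (auto simp: polynomials_in_def Euler_eq_0_iff)
qed

lemma polynomials_in_ZX_iff: "p \<in> polynomials_in (range Z \<union> range X) \<longleftrightarrow> Euler Y p = 0"
proof -
  have "Poly_Mapping.keys \<mu> \<subseteq> range Z \<union> range X \<longleftrightarrow> (\<forall>j. Y j \<notin> Poly_Mapping.keys \<mu>)"
    for \<mu> :: "'a var \<Rightarrow>\<^sub>0 nat"
    by (auto simp: subset_iff) (metis var.exhaust rangeI)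
  then show ?thesis by (auto simp: polynomials_in_def Euler_eq_0_iff)
qed

lemma polynomials_in_ZY_iff: "p \<in> polynomials_in (range Z \<union> range Y) \<longleftrightarrow> Euler X p = 0"
proof -
  have "Poly_Mapping.keys \<mu> \<subseteq> range Z \<union> range Y \<longleftrightarrow> (\<forall>j. X j \<notin> Poly_Mapping.keys \<mu>)"
    for \<mu> :: "'a var \<Rightarrow>\<^sub>0 nat"
    by (auto simp: subset_iff) (metis var.exhaust rangeI)
  then show ?thesis by (auto simp: polynomials_in_def Euler_eq_0_iff)
qed

lemma pd_eq_0_if_Euler_eq_0:
  assumes "u \<in> vecs" "Euler u p = 0"
  shows "pd (u j) p = 0"
proof -
  have "\<mu> + Poly_Mapping.single (u j) 1 \<notin> Poly_Mapping.keys p" for \<mu>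
  proof -
    have "u j \<in> Poly_Mapping.keys (\<mu> + Poly_Mapping.single (u j) (1::nat))"
      by (simp add: in_keys_iff lookup_add)
    then show ?thesis using assms Euler_eq_0_iff by blast
  qed
  then show ?thesis by (intro poly_mapping_eqI) (simp add: lookup_pd in_keys_iff)
qed

text \<open>The eigenvalues of an Euler operator are degrees, hence natural numbers. This makes the
  spaces with negative labels zero.\<close>

lemma Euler_eigenvalue_nonneg:
  assumes "Euler u p = of_int k * p" "k < 0"
  shows "p = 0"
proof (rule poly_mapping_eqI)
  fix \<mu>
  have "of_nat n \<noteq> (of_int k :: complex)" for n
    using assms(2) by (metis of_int_of_nat_eq of_int_eq_iff of_nat_0_le_iff not_le)
  then show "Poly_Mapping.lookup p \<mu> = Poly_Mapping.lookup 0 \<mu>"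
    using arg_cong[OF assms(1), of "\<lambda>p. Poly_Mapping.lookup p \<mu>"]
    by (simp add: lookup_Euler lookup_of_int_mult del: of_nat_sum)
qed

section \<open>Diagonal operators and their inverses\<close>

definition diagonal :: "('n cpoly \<Rightarrow> 'n cpoly) \<Rightarrow> bool" where
  "diagonal B \<longleftrightarrow> (\<exists>b. \<forall>p \<mu>. Poly_Mapping.lookup (B p) \<mu> = b \<mu> * Poly_Mapping.lookup p \<mu>)"

lemma diagonal_euler_denom: "diagonal (euler_denom u)"
  unfolding diagonal_def
  by (intro exI[of _ "\<lambda>\<mu>. 2 * of_nat (\<Sum>j\<in>UNIV. Poly_Mapping.lookup \<mu> (u j)) + (of_nat CARD('a) - 4)"])
    (simp add: euler_denom_def cscale_def cst_def[symmetric] lookup_add lookup_cst_mult lookup_Euler distrib_right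
      del: cst_numeral)

lemma diagonal_comp: "diagonal A \<Longrightarrow> diagonal B \<Longrightarrow> diagonal (A \<circ> B)"
  unfolding diagonal_def
proof (elim exE)
  fix a b
  assume "\<forall>p \<mu>. Poly_Mapping.lookup (A p) \<mu> = a \<mu> * Poly_Mapping.lookup p \<mu>"
    and "\<forall>p \<mu>. Poly_Mapping.lookup (B p) \<mu> = b \<mu> * Poly_Mapping.lookup p \<mu>"
  then show "\<exists>c. \<forall>p \<mu>. Poly_Mapping.lookup ((A \<circ> B) p) \<mu> = c \<mu> * Poly_Mapping.lookup p \<mu>"
    by (intro exI[of _ "\<lambda>\<mu>. a \<mu> * b \<mu>"]) simp
qed

lemma diagonal_opE: "diagonal (\<lambda>q. opE q - cscale c q)"
  unfolding diagonal_def
  by (intro exI[of _ "\<lambda>\<mu>. of_nat (\<Sum>j\<in>UNIV. Poly_Mapping.lookup \<mu> (Y j)) - of_nat (\<Sum>j\<in>UNIV. Poly_Mapping.lookup \<mu> (X j))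
      + of_nat (\<Sum>j\<in>UNIV. Poly_Mapping.lookup \<mu> (Z j)) + of_nat CARD('a) / 2 - c"])
    (simp add: opE_def cscale_def cst_def[symmetric] lookup_add lookup_minus lookup_cst_mult lookup_Euler
      distrib_right left_diff_distrib del: cst_numeral)

text \<open>A diagonal operator is injective on its range, and the quotient of an eigenvector by its
  eigenvalue lies there, so \<open>inv_into\<close> has no other choice. The alternative
  \<open>q = 0\<close> serves the negative labels, for which the eigenvalue may vanish.\<close>

lemma op_inverse_eigenvector:
  assumes "diagonal B" "B q = cst c * q" "c \<noteq> 0 \<or> q = 0"
  shows "op_inverse B q = cst (1 / c) * q"
proof -
  obtain b where b: "\<And>p \<mu>. Poly_Mapping.lookup (B p) \<mu> = b \<mu> * Poly_Mapping.lookup p \<mu>"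
    using assms(1) by (auto simp: diagonal_def)
  have scale: "B (cst k * p) = cst k * B p" for k p
    by (intro poly_mapping_eqI) (simp add: b lookup_cst_mult)
  have "inj_on B (range B)"
    by (auto simp: inj_on_def poly_mapping_eq_iff fun_eq_iff b)
  \<comment> \<open>A preimage of the quotient is the quotient divided by \<open>c\<close> once
    more.\<close>
  moreover have "cst (1 / c) * q = B (cst (1 / c) * (cst (1 / c) * q))"
    using assms(2,3) by (auto simp: scale simp flip: cst_mult mult.assoc)
  then have "cst (1 / c) * q \<in> range B" by blast
  moreover have "B (cst (1 / c) * q) = q"
    using assms(2,3) by (auto simp: scale simp flip: cst_mult mult.assoc)
  ultimately show ?thesis
    unfolding op_inverse_def by (rule inv_into_f_eq)
qed

section \<open>Linear harmonics and the transvector operators\<close>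

lemma harmonics_iff:
  "p \<in> harmonics a \<longleftrightarrow> Euler X p = 0 \<and> Euler Y p = 0 \<and> Euler Z p = of_int a * p \<and> Laplace Z p = 0"
  by (auto simp: harmonics_def polynomials_in_Z_iff homogeneous_in_range_iff)

text \<open>An equational description of the tensor product of (1)_u and (a)_z, see
  \<open>poly_tensor_linear_forms\<close>; membership can then be checked with commutators.\<close>

definition linear_harmonics :: "('n::finite \<Rightarrow> 'n var) \<Rightarrow> int \<Rightarrow> 'n cpoly set" where
  "linear_harmonics u a = {p. Euler u p = p \<and> (\<forall>v\<in>{X, Y} - {u}. Euler v p = 0) \<and>
     Euler Z p = of_int a * p \<and> Laplace Z p = 0}"

lemma linear_harmonics_X: "p \<in> linear_harmonics X a \<longleftrightarrow>
    Euler X p = p \<and> Euler Y p = 0 \<and> Euler Z p = of_int a * p \<and> Laplace Z p = 0"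
  and linear_harmonics_Y: "p \<in> linear_harmonics Y a \<longleftrightarrow>
    Euler Y p = p \<and> Euler X p = 0 \<and> Euler Z p = of_int a * p \<and> Laplace Z p = 0"
  by (auto simp: linear_harmonics_def)

lemma vdotD_scale: "vdotD u v (cst c * p) = cst c * vdotD u v p"
  by (simp add: vdotD_mult)

lemma subspace_iff:
  "cpoly.subspace U \<longleftrightarrow> 0 \<in> U \<and> (\<forall>p\<in>U. \<forall>q\<in>U. p + q \<in> U) \<and> (\<forall>c. \<forall>p\<in>U. cst c * p \<in> U)"
  by (simp add: cpoly.subspace_def cscale_eq_cst)

lemma subspace_harmonics: "cpoly.subspace (harmonics a)"
  by (auto simp: subspace_iff harmonics_iff vdotD_add DdotD_add vdotD_scale DdotD_scale distrib_left
      mult.left_commute)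

lemma subspace_linear_harmonics: "cpoly.subspace (linear_harmonics u a)"
  by (auto simp: subspace_iff linear_harmonics_def vdotD_add DdotD_add vdotD_scale DdotD_scale distrib_left
      mult.left_commute)

lemma span_mult_closed:
  assumes "cpoly.subspace W" "p \<in> cpoly.span S" "q \<in> V" "\<And>s. s \<in> S \<Longrightarrow> s * q \<in> W"
  shows "p * q \<in> W"
  using assms(2)
proof (induction rule: cpoly.span_induct_alt)
  case base
  then show ?case using assms(1) by (simp add: subspace_iff)
next
  case (step c x y)
  then have "cst c * (x * q) + y * q \<in> W"
    using assms by (simp add: subspace_iff)
  then show ?case by (simp add: cscale_eq_cst algebra_simps)
qed

text \<open>For the harder inclusion, Euler's identity writes a u-linear \<open>p\<close> as the sum
  of the \<open>mvar (u j) * pd (u j) p\<close>, and these derivatives no longer contain u and are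
  harmonic in z.\<close>

lemma poly_tensor_linear_forms:
  assumes "u = X \<or> u = Y"
  shows "poly_tensor (linear_forms u) (harmonics a) = linear_harmonics u a"
proof
  have u: "u \<in> vecs" "u \<noteq> Z" using assms by auto
  have *: "mvar (u j) * q \<in> linear_harmonics u a" if "q \<in> harmonics a" for j q
  proof -
    have 1: "Euler v (mvar (u j) * q) = (if v = u then mvar (u j) * q else 0) + mvar (u j) * Euler v q"
      if "v \<in> vecs" for v
      using that u by (simp add: vdotD_mult vdotD_mvar)
    have 2: "Laplace Z (mvar (u j) * q) = mvar (u j) * Laplace Z q"
      using u by (simp add: DdotD_def pd_mult pd_mvar_vec sum_distrib_left)
    have "Euler u q = 0" and q: "Euler X q = 0" "Euler Y q = 0" "Euler Z q = of_int a * q" "Laplace Z q = 0"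
      using that assms by (auto simp: harmonics_iff)
    then show ?thesis
      using 1[of X] 1[of Y] 1[of Z] 2 assms
      by (elim disjE) (simp_all add: linear_harmonics_X linear_harmonics_Y mult.left_commute)
  qed
  have "p * q \<in> linear_harmonics u a" if "p \<in> linear_forms u" "q \<in> harmonics a" for p q
    by (rule span_mult_closed[OF subspace_linear_harmonics that(1)[unfolded linear_forms_def] that(2)])
      (use that(2) * in blast)
  then show "poly_tensor (linear_forms u) (harmonics a) \<subseteq> linear_harmonics u a"
    unfolding poly_tensor_def by (intro cpoly.span_minimal subspace_linear_harmonics) auto
  show "linear_harmonics u a \<subseteq> poly_tensor (linear_forms u) (harmonics a)"
  proof
    fix p :: "'a cpoly"
    assume p: "p \<in> linear_harmonics u a"
    have "pd (u j) p \<in> harmonics a" for j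
    proof -
      have "Euler v (pd (u j) p) = (if v = u then 0 else pd (u j) (Euler v p))" if "v \<in> vecs" for v
        using pd_vdotD[of u v j v p] u that p by (auto simp: linear_harmonics_def)
      moreover have "pd (u j) (of_int a * p) = of_int a * pd (u j) p"
        by (simp add: pd_mult)
      ultimately show ?thesis
        using p assms by (auto simp: linear_harmonics_def harmonics_iff simp flip: pd_DdotD)
    qed
    moreover have "mvar (u j) \<in> linear_forms u" for j
      unfolding linear_forms_def by (intro cpoly.span_base) auto
    ultimately have "mvar (u j) * pd (u j) p \<in> poly_tensor (linear_forms u) (harmonics a)" for j
      unfolding poly_tensor_def by (intro cpoly.span_base) auto
    then have "Euler u p \<in> poly_tensor (linear_forms u) (harmonics a)"
      unfolding poly_tensor_def vdotD_def by (intro cpoly.span_sum) auto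
    then show "p \<in> poly_tensor (linear_forms u) (harmonics a)"
      using p by (simp add: linear_harmonics_def)
  qed
qed

lemma harmonics_neg: "a < 0 \<Longrightarrow> harmonics a = {0}"
  using Euler_eigenvalue_nonneg[of Z _ a] by (auto simp: harmonics_iff)

lemma linear_harmonics_neg: "a < 0 \<Longrightarrow> linear_harmonics u a = {0}"
  using Euler_eigenvalue_nonneg[of Z _ a] by (auto simp: linear_harmonics_def)

lemma vdotD_eq_0_if_Euler_eq_0:
  assumes "v \<in> vecs" "Euler v p = 0"
  shows "vdotD u v p = 0"
  using pd_eq_0_if_Euler_eq_0[OF assms] by (simp add: vdotD_def)

lemma DdotD_eq_0_if_Euler_eq_0:
  assumes "v \<in> vecs" "Euler v p = 0"
  shows "DdotD v u p = 0"
  using pd_eq_0_if_Euler_eq_0[OF assms] by (simp add: DdotD_def pd_commute[of "v _"])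

lemma op_inverse_0: "diagonal B \<Longrightarrow> op_inverse B 0 = 0"
  using op_inverse_eigenvector[of B 0 0] by (auto simp: diagonal_def poly_mapping_eq_iff fun_eq_iff)

lemma Laplace_linear:
  assumes "u \<in> vecs" "Euler u p = p"
  shows "Laplace u p = 0"
proof -
  have "Euler u (pd (u j) p) = 0" for j
    using pd_vdotD[of u u j u p] assms by simp
  then show ?thesis using assms by (simp add: DdotD_def pd_eq_0_if_Euler_eq_0)
qed

text \<open>The dominance condition in \<open>simplicial_harmonics\<close> is automatic: for k < 0
  only 0 has degree k in z, and for k = 0 the commutator of \<open>vdotD u Z\<close> and
  \<open>vdotD Z u\<close>, a difference of Euler operators, forces \<open>Euler u p = 0\<close>,
  whereas \<open>Euler u p = p\<close>.\<close>

lemma simplicial_harmonics_1: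
  assumes "u = X \<or> u = Y"
  shows "simplicial_harmonics u k 1 = {p \<in> linear_harmonics u k. DdotD Z u p = 0 \<and> vdotD Z u p = 0}"
proof (cases "k \<ge> 1")
  case True
  have "p \<in> homogeneous_in (range u) 1 \<longleftrightarrow> Euler u p = p" for p
    using assms homogeneous_in_range_iff[of u p 1] by auto
  then show ?thesis
    using True assms
    by (auto simp: simplicial_harmonics_def linear_harmonics_def homogeneous_in_range_iff[of Z]
        polynomials_in_ZX_iff polynomials_in_ZY_iff intro: Laplace_linear)
next
  case False
  have u: "u \<in> vecs" "u \<noteq> Z" using assms by auto
  have "p = 0" if "p \<in> linear_harmonics u k" "vdotD Z u p = 0" for p :: "'a cpoly"
  proof (cases "k = 0")
    case True
    then have "Euler Z p = 0" using that by (simp add: linear_harmonics_def)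
    then have "vdotD u Z p = 0" by (simp add: vdotD_eq_0_if_Euler_eq_0)
    then have "Euler u p = 0"
      using vdotD_commutator[of u Z Z u p] u that \<open>Euler Z p = 0\<close> by simp
    then show ?thesis using that by (simp add: linear_harmonics_def)
  qed (use False that linear_harmonics_neg[of k u] in auto)
  moreover have "0 \<in> linear_harmonics u k" by (simp add: linear_harmonics_def)
  ultimately have "{p \<in> linear_harmonics u k. DdotD Z u p = 0 \<and> vdotD Z u p = 0} = {0}" by auto
  then show ?thesis using False by (simp add: simplicial_harmonics_def)
qed

section \<open>Closed forms of the transvector operators and of the projection\<close>

lemma opS_harmonics:
  assumes "u = X \<or> u = Y" "f \<in> harmonics a"
  shows "opS u f = vdotD u Z f"
proof -
  have "DdotD u Z f = 0"
    using assms by (auto simp: harmonics_iff intro: DdotD_eq_0_if_Euler_eq_0)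
  then show ?thesis by (simp add: opS_def op_inverse_0 diagonal_euler_denom)
qed

text \<open>The product \<open>vdot u Z * g\<close>, corrected by a multiple of |z|^2 so as to
  become harmonic in z. The denominator is 2 E_z + m - 4 at degree b + 1 in z.\<close>

definition harmonic_mult :: "('n::finite \<Rightarrow> 'n var) \<Rightarrow> int \<Rightarrow> 'n cpoly \<Rightarrow> 'n cpoly" where
  "harmonic_mult u b g =
     vdot u Z * g - cst (1 / of_int (2 * b + int CARD('n) - 2)) * (vdot Z Z * vdotD u Z g)"

text \<open>Since \<open>g\<close> is free of u, the two terms of \<open>opC\<close> that
  differentiate by u vanish, and the remaining denominator acts on a polynomial of degree b + 1 in
  z. For b < 0 its eigenvalue may be 0, but then \<open>g = 0\<close>.\<close>

lemma opC_harmonics: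
  fixes g :: "'n::finite cpoly"
  assumes "u = X \<or> u = Y" "g \<in> harmonics b" "CARD('n) \<ge> 3"
  shows "opC u g = harmonic_mult u b g"
proof -
  have u: "u \<in> vecs" "u \<noteq> Z" using assms by auto
  have g: "Euler u g = 0" "Euler Z g = of_int b * g"
    using assms by (auto simp: harmonics_iff)
  have 0: "op_inverse (euler_denom u) 0 = 0" "op_inverse (euler_denom u \<circ> euler_denom Z) 0 = 0"
    by (simp_all add: op_inverse_0 diagonal_comp diagonal_euler_denom)
  have 1: "vdotD Z u g = 0" "DdotD u Z g = 0"
    using u g by (auto intro: vdotD_eq_0_if_Euler_eq_0 DdotD_eq_0_if_Euler_eq_0)
  let ?q = "vdot Z Z * vdotD u Z g"
  have E: "Euler Z (vdotD u Z g) = of_int b * vdotD u Z g - vdotD u Z g"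
    using vdotD_commutator[of Z Z u Z g] u g by (simp add: vdotD_mult)
  have "Euler Z ?q = of_int (b + 1) * ?q"
    using vdotD_vdot_mult[of Z Z Z Z "vdotD u Z g"] by (simp add: E algebra_simps)
  then have 2: "euler_denom Z ?q = cst (of_int (2 * b + int CARD('n) - 2)) * ?q"
    unfolding cst_of_int by (simp add: euler_denom_def cscale_eq_cst cst_diff algebra_simps)
  have "b \<ge> 0 \<or> ?q = 0"
  proof (cases "b < 0")
    case True
    then have "g = 0" using assms(2) harmonics_neg by blast
    then show ?thesis by simp
  qed simp
  then have "of_int (2 * b + int CARD('n) - 2) \<noteq> (0::complex) \<or> ?q = 0"
    using assms(3) by (auto simp del: of_int_add of_int_diff)
  from op_inverse_eigenvector[of "euler_denom Z" ?q, OF diagonal_euler_denom 2 this]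
  show ?thesis
    by (simp only: opC_def harmonic_mult_def 0 1 mult_zero_right diff_zero add_0_right)
qed

text \<open>With \<open>s = vdotD X Y p\<close>, \<open>opR (opL p)\<close> is p plus half of |z|^2
  s. Replacing y by x lowers the eigenvalue of \<open>opE\<close> by 2 and the factor |z|^2 raises
  it by 2, so the sum is an eigenvector for b + m/2 + 1, and the operator to be inverted acts on it
  as b + m/2 - 1.\<close>

lemma proj_L_linear_harmonics:
  fixes p :: "'n::finite cpoly"
  assumes "p \<in> linear_harmonics Y b" "CARD('n) \<ge> 3"
  shows "proj_L p = p + cst (1 / (of_int b + of_nat CARD('n) / 2 - 1)) * (p + cst (1/2) * (vdot Z Z * vdotD X Y p))"
proof -
  have p: "Euler X p = 0" "Euler Y p = p" "Euler Z p = of_int b * p" "Laplace Z p = 0"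
    using assms by (auto simp: linear_harmonics_def)
  have YX: "vdotD Y X p = 0" using p by (simp add: vdotD_eq_0_if_Euler_eq_0)
  define s where "s = vdotD X Y p"
  have L: "opL p = s" using p by (simp add: opL_def s_def cscale_eq_cst)
  have "vdotD Y X s = p"
    using vdotD_commutator[of Y X X Y p] p YX by (simp add: s_def)
  then have R: "opR (opL p) = p + cst (1/2) * (vdot Z Z * s)"
    by (simp add: L opR_def cscale_eq_cst)
  let ?q = "p + cst (1/2) * (vdot Z Z * s)"
  have s: "Euler X s = s" "Euler Y s = 0" "Euler Z s = of_int b * s"
    using vdotD_commutator[of X X X Y p] vdotD_commutator[of Y Y X Y p] vdotD_commutator[of Z Z X Y p] p
    by (simp_all add: s_def vdotD_mult)
  have "Euler X (vdot Z Z * s) = vdot Z Z * s" "Euler Y (vdot Z Z * s) = 0"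
    "Euler Z (vdot Z Z * s) = of_int (b + 2) * (vdot Z Z * s)"
    using vdotD_vdot_mult[of X Z Z X s] vdotD_vdot_mult[of Y Z Z Y s] vdotD_vdot_mult[of Z Z Z Z s] s
    by (simp_all add: algebra_simps)
  then have 1: "opE ?q - cscale 2 ?q = cst (of_int b + of_nat CARD('n) / 2 - 1) * ?q"
  proof -
    have "Euler X ?q = cst (1/2) * (vdot Z Z * s)" "Euler Y ?q = p"
      "Euler Z ?q = of_int b * p + cst (1/2) * (of_int (b + 2) * (vdot Z Z * s))"
      using p \<open>Euler X (vdot Z Z * s) = _\<close> \<open>Euler Y (vdot Z Z * s) = _\<close> \<open>Euler Z (vdot Z Z * s) = _\<close>
      by (simp_all only: vdotD_add vdotD_scale) simp_all
    then show ?thesis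
      by (simp add: opE_def cscale_eq_cst cst_add cst_diff algebra_simps)
  qed
  have "b \<ge> 0 \<or> ?q = 0"
  proof (cases "b < 0")
    case True
    then have "p = 0" using assms(1) linear_harmonics_neg by blast
    then show ?thesis by (simp add: s_def)
  qed simp
  moreover have "of_int b + of_nat CARD('n) / 2 - 1 \<noteq> (0::complex)" if "b \<ge> 0"
  proof
    assume "of_int b + of_nat CARD('n) / 2 - 1 = (0::complex)"
    then have "of_int (2 * b + int CARD('n) - 2) = (0::complex)" by (simp add: field_simps)
    then have "2 * b + int CARD('n) - 2 = 0" by (simp only: of_int_eq_0_iff)
    then show False using that assms(2) by simp
  qed
  ultimately have 2: "of_int b + of_nat CARD('n) / 2 - 1 \<noteq> (0::complex) \<or> ?q = 0" by blast
  show ?thesis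
    unfolding proj_L_def R using op_inverse_eigenvector[of "\<lambda>q. opE q - cscale 2 q" ?q, OF diagonal_opE 1 2] by (simp add: s_def)
qed

section \<open>Direct sums and the action of so(m)\<close>

lemma listset_2: "listset [A, B] = {[a, b] | a b. a \<in> A \<and> b \<in> B}"
  and listset_3: "listset [A, B, C] = {[a, b, c] | a b c. a \<in> A \<and> b \<in> B \<and> c \<in> C}"
  by (auto simp: set_Cons_def)

lemma subspace_add: "cpoly.subspace U \<Longrightarrow> p \<in> U \<Longrightarrow> q \<in> U \<Longrightarrow> p + q \<in> U"
  and subspace_diff: "cpoly.subspace U \<Longrightarrow> p \<in> U \<Longrightarrow> q \<in> U \<Longrightarrow> p - q \<in> U"
  and subspace_0: "cpoly.subspace U \<Longrightarrow> 0 \<in> U"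
  by (simp_all add: cpoly.subspace_add cpoly.subspace_diff cpoly.subspace_0)

lemma subspace_scale: "cpoly.subspace U \<Longrightarrow> p \<in> U \<Longrightarrow> cst c * p \<in> U"
  by (simp add: subspace_iff)

lemma is_direct_sum_2I:
  assumes "cpoly.subspace A" "cpoly.subspace B"
    and "\<And>a b. a \<in> A \<Longrightarrow> b \<in> B \<Longrightarrow> a + b \<in> W"
    and "\<And>p. p \<in> W \<Longrightarrow> \<exists>a\<in>A. \<exists>b\<in>B. p = a + b"
    and "\<And>a b. a \<in> A \<Longrightarrow> b \<in> B \<Longrightarrow> a + b = 0 \<Longrightarrow> a = 0 \<and> b = 0"
  shows "is_direct_sum W [A, B]"
proof -
  have "inj_on sum_list (listset [A, B])"
  proof (rule inj_onI)
    fix s t assume s: "s \<in> listset [A, B]" and t: "t \<in> listset [A, B]" and eq: "sum_list s = sum_list t"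
    obtain a b where s': "s = [a, b]" "a \<in> A" "b \<in> B" using s unfolding listset_2 by blast
    obtain a' b' where t': "t = [a', b']" "a' \<in> A" "b' \<in> B" using t unfolding listset_2 by blast
    have "(a - a') + (b - b') = 0" using eq s' t' by (simp add: algebra_simps)
    moreover have "a - a' \<in> A" "b - b' \<in> B" using s' t' assms(1,2) by (auto intro: subspace_diff)
    ultimately have "a - a' = 0 \<and> b - b' = 0" using assms(5) by blast
    then show "s = t" using s' t' by simp
  qed
  moreover have "sum_list ` listset [A, B] = W"
    unfolding listset_2 using assms(3,4) by (auto simp: image_iff) (metis add.right_neutral sum_list.Cons sum_list.Nil)
  ultimately show ?thesis
    using assms(1,2) unfolding is_direct_sum_def bij_betw_def by simp
qed

lemma is_direct_sum_3I:
  assumes "cpoly.subspace A" "cpoly.subspace B" "cpoly.subspace C"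
    and "\<And>a b c. a \<in> A \<Longrightarrow> b \<in> B \<Longrightarrow> c \<in> C \<Longrightarrow> a + b + c \<in> W"
    and "\<And>p. p \<in> W \<Longrightarrow> \<exists>a\<in>A. \<exists>b\<in>B. \<exists>c\<in>C. p = a + b + c"
    and "\<And>a b c. a \<in> A \<Longrightarrow> b \<in> B \<Longrightarrow> c \<in> C \<Longrightarrow> a + b + c = 0 \<Longrightarrow> a = 0 \<and> b = 0 \<and> c = 0"
  shows "is_direct_sum W [A, B, C]"
proof -
  have "inj_on sum_list (listset [A, B, C])"
  proof (rule inj_onI)
    fix s t assume s: "s \<in> listset [A, B, C]" and t: "t \<in> listset [A, B, C]" and eq: "sum_list s = sum_list t"
    obtain a b c where s': "s = [a, b, c]" "a \<in> A" "b \<in> B" "c \<in> C" using s unfolding listset_3 by blast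
    obtain a' b' c' where t': "t = [a', b', c']" "a' \<in> A" "b' \<in> B" "c' \<in> C" using t unfolding listset_3 by blast
    have "(a - a') + (b - b') + (c - c') = 0" using eq s' t' by (simp add: algebra_simps)
    moreover have "a - a' \<in> A" "b - b' \<in> B" "c - c' \<in> C" using s' t' assms(1-3) by (auto intro: subspace_diff)
    ultimately have "a - a' = 0 \<and> b - b' = 0 \<and> c - c' = 0" using assms(6) by blast
    then show "s = t" using s' t' by simp
  qed
  moreover have "sum_list ` listset [A, B, C] = W"
  proof
    show "sum_list ` listset [A, B, C] \<subseteq> W"
      unfolding listset_3 using assms(4) by (auto simp: add.assoc)
    show "W \<subseteq> sum_list ` listset [A, B, C]"
    proof
      fix p assume "p \<in> W"
      then obtain a b c where "a \<in> A" "b \<in> B" "c \<in> C" "p = sum_list [a, b, c]"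
        using assms(5)[of p] by (auto simp: add.assoc)
      then show "p \<in> sum_list ` listset [A, B, C]" unfolding listset_3 by blast
    qed
  qed
  ultimately show ?thesis
    using assms(1-3) unfolding is_direct_sum_def bij_betw_def by simp
qed

text \<open>Linearity is stated relative to a set because \<open>op_inverse\<close> has an
  unspecified value outside the range of its operator; additivity is available only where an
  explicit formula holds.\<close>

definition linear_on_set :: "'n cpoly set \<Rightarrow> ('n cpoly \<Rightarrow> 'n cpoly) \<Rightarrow> bool" where
  "linear_on_set U T \<longleftrightarrow> (\<forall>p\<in>U. \<forall>q\<in>U. T (p + q) = T p + T q) \<and> (\<forall>c. \<forall>p\<in>U. T (cst c * p) = cst c * T p)"

lemma linear_on_set_0: "linear_on_set U T \<Longrightarrow> p \<in> U \<Longrightarrow> T 0 = 0"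
  unfolding linear_on_set_def by (metis cst_0 mult_zero_left)

lemma linear_on_set_subset: "linear_on_set U T \<Longrightarrow> V \<subseteq> U \<Longrightarrow> linear_on_set V T"
  unfolding linear_on_set_def by blast

lemma subspace_image:
  assumes "cpoly.subspace U" "linear_on_set U T"
  shows "cpoly.subspace (T ` U)"
proof -
  have "T 0 = 0" using linear_on_set_0 assms subspace_0 by blast
  then have "0 \<in> T ` U" using subspace_0[OF assms(1)] by (metis imageI)
  moreover have "T p + T q \<in> T ` U" if "p \<in> U" "q \<in> U" for p q
    using that assms subspace_add unfolding linear_on_set_def by (metis imageI)
  moreover have "cst c * T p \<in> T ` U" if "p \<in> U" for c p
    using that assms subspace_scale unfolding linear_on_set_def by (metis imageI)
  ultimately show ?thesis unfolding subspace_iff by blast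
qed

lemma is_direct_sum_image:
  assumes "is_direct_sum W [A, B, C]" "linear_on_set W T" "inj_on T W" "A \<subseteq> W" "B \<subseteq> W" "C \<subseteq> W"
    "cpoly.subspace W"
  shows "is_direct_sum (T ` W) [T ` A, T ` B, T ` C]"
proof -
  have sub: "cpoly.subspace A" "cpoly.subspace B" "cpoly.subspace C"
    and bij: "bij_betw sum_list (listset [A, B, C]) W"
    using assms(1) by (auto simp: is_direct_sum_def)
  have im: "sum_list ` listset [A, B, C] = W" and inj: "inj_on sum_list (listset [A, B, C])"
    using bij by (auto simp: bij_betw_def)
  have T3: "T (a + b + c) = T a + T b + T c" "a + b + c \<in> W" if "a \<in> A" "b \<in> B" "c \<in> C" for a b c
  proof -
    have "a \<in> W" "b \<in> W" "c \<in> W" using that assms by auto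
    then show "T (a + b + c) = T a + T b + T c" "a + b + c \<in> W"
      using assms(2) subspace_add[OF assms(7)] unfolding linear_on_set_def by auto
  qed
  show ?thesis
  proof (rule is_direct_sum_3I)
    show "cpoly.subspace (T ` A)" "cpoly.subspace (T ` B)" "cpoly.subspace (T ` C)"
      using sub assms by (auto intro!: subspace_image intro: linear_on_set_subset)
    show "a + b + c \<in> T ` W" if "a \<in> T ` A" "b \<in> T ` B" "c \<in> T ` C" for a b c
      using that T3 by (auto simp: image_iff) metis
    show "\<exists>a\<in>T ` A. \<exists>b\<in>T ` B. \<exists>c\<in>T ` C. p = a + b + c" if p: "p \<in> T ` W" for p
    proof -
      obtain w where w: "w \<in> W" "p = T w" using p by blast
      then obtain a b c where "a \<in> A" "b \<in> B" "c \<in> C" "w = a + b + c"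
        using im unfolding listset_3 by (auto simp: image_iff add.assoc)
      then show ?thesis using T3(1) w by blast
    qed
    show "a = 0 \<and> b = 0 \<and> c = 0" if abc: "a \<in> T ` A" "b \<in> T ` B" "c \<in> T ` C" "a + b + c = 0" for a b c
    proof -
      obtain a' b' c' where h: "a' \<in> A" "b' \<in> B" "c' \<in> C" "a = T a'" "b = T b'" "c = T c'"
        using abc by blast
      have T0: "T 0 = 0" using linear_on_set_0[OF assms(2)] subspace_0[OF assms(7)] by blast
      then have "T (a' + b' + c') = T 0" using T3(1) h abc by simp
      then have "a' + b' + c' = 0"
        using assms(3) T3(2) h subspace_0[OF assms(7)] by (metis inj_onD)
      then have "sum_list [a', b', c'] = sum_list [0, 0, 0]" by (simp add: add.assoc)
      moreover have "[a', b', c'] \<in> listset [A, B, C]" "[0, 0, 0] \<in> listset [A, B, C]"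
        unfolding listset_3 using h sub subspace_0 by auto
      ultimately have "[a', b', c'] = [0, 0, 0]" using inj by (meson inj_onD)
      then show ?thesis using h T0 by simp
    qed
  qed
qed

section \<open>Invariance under so(m)\<close>

definition gl_act :: "'n::finite \<Rightarrow> 'n \<Rightarrow> 'n cpoly \<Rightarrow> 'n cpoly" where
  "gl_act i j p = mvar (X i) * pd (X j) p + mvar (Y i) * pd (Y j) p + mvar (Z i) * pd (Z j) p"

lemma so_act_gl: "so_act A p = (\<Sum>i\<in>UNIV. \<Sum>j\<in>UNIV. cst (of_real (A $ i $ j)) * gl_act i j p)"
  by (simp add: so_act_def gl_act_def cscale_eq_cst)

lemma gl_act_add: "gl_act i j (p + q) = gl_act i j p + gl_act i j q"
  and gl_act_mult: "gl_act i j (p * q) = gl_act i j p * q + p * gl_act i j q"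
  by (simp_all add: gl_act_def pd_add pd_mult algebra_simps)

lemma gl_act_0 [simp]: "gl_act i j 0 = 0" and gl_act_cst [simp]: "gl_act i j (cst c) = 0"
  by (simp_all add: gl_act_def)

lemma gl_act_sum: "gl_act i j (sum f S) = (\<Sum>k\<in>S. gl_act i j (f k))"
  by (induction S rule: infinite_finite_induct) (simp_all add: gl_act_add)

lemma gl_act_mvar: "u \<in> vecs \<Longrightarrow> gl_act i j (mvar (u k)) = (if j = k then mvar (u i) else 0)"
  unfolding vecs_def by (elim insertE emptyE) (simp_all add: gl_act_def pd_mvar)

lemma gl_act_pd:
  assumes "u \<in> vecs"
  shows "gl_act i j (pd (u k) p) = pd (u k) (gl_act i j p) - (if i = k then pd (u j) p else 0)"
  using assms by (auto simp: vecs_def gl_act_def pd_add pd_mult pd_mvar pd_commute[of "_ k"])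

lemma gl_act_vdotD:
  assumes "u \<in> vecs" "v \<in> vecs"
  shows "gl_act i j (vdotD u v p) = vdotD u v (gl_act i j p)"
proof -
  have "gl_act i j (vdotD u v p) = (\<Sum>k\<in>UNIV. (if j = k then mvar (u i) * pd (v k) p else 0)
     + (mvar (u k) * pd (v k) (gl_act i j p) - (if i = k then mvar (u k) * pd (v j) p else 0)))"
    unfolding vdotD_def gl_act_sum
    by (intro sum.cong refl) (simp add: gl_act_mult gl_act_mvar gl_act_pd assms right_diff_distrib)
  then show ?thesis
    by (simp add: sum.distrib sum_subtractf vdotD_def)
qed

lemma gl_act_DdotD:
  assumes "u \<in> vecs" "v \<in> vecs"
  shows "gl_act i j (DdotD u v p) = DdotD u v (gl_act i j p) - (pd (u j) (pd (v i) p) + pd (u i) (pd (v j) p))"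
proof -
  have "gl_act i j (DdotD u v p) = (\<Sum>k\<in>UNIV. pd (u k) (pd (v k) (gl_act i j p))
     - (if i = k then pd (u k) (pd (v j) p) else 0) - (if i = k then pd (u j) (pd (v k) p) else 0))"
    unfolding DdotD_def gl_act_sum
    by (intro sum.cong refl) (simp add: gl_act_pd assms pd_diff)
  then show ?thesis
    by (simp add: sum_subtractf DdotD_def)
qed

lemma gl_act_vdot:
  assumes "u \<in> vecs" "v \<in> vecs"
  shows "gl_act i j (vdot u v) = mvar (u i) * mvar (v j) + mvar (u j) * mvar (v i)"
  by (simp add: vdot_def gl_act_sum gl_act_mult gl_act_mvar assms sum.distrib mult_of_if
    if_distrib[of "\<lambda>x. x * _"] if_distrib[of "(*) _"] cong: if_cong)

text \<open>This is how skewness enters: by \<open>gl_act_DdotD\<close> and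
  \<open>gl_act_vdot\<close> the defect of \<open>gl_act i j\<close> in commuting with
  \<open>DdotD\<close>, and its value on \<open>vdot\<close>, are symmetric in i and j, so that they
  cancel against a skew matrix.\<close>

lemma skew_sum_symmetric:
  fixes A :: "real^'n^'n" and s :: "'n::finite \<Rightarrow> 'n \<Rightarrow> 'n cpoly"
  assumes "transpose A = - A" "\<And>i j. s i j = s j i"
  shows "(\<Sum>i\<in>UNIV. \<Sum>j\<in>UNIV. cst (of_real (A $ i $ j)) * s i j) = 0" (is "?S = 0")
proof -
  have A: "A $ j $ i = - A $ i $ j" for i j
    using arg_cong[OF assms(1), of "\<lambda>B. B $ i $ j"] by (simp add: transpose_def)
  have "cst (of_real (A $ j $ i)) = - (cst (of_real (A $ i $ j)) :: 'n cpoly)" for i j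
    by (simp only: A[of j i] of_real_minus cst_minus)
  then have "(\<Sum>i\<in>UNIV. \<Sum>j\<in>UNIV. cst (of_real (A $ j $ i)) * s j i) =
      (\<Sum>i\<in>UNIV. \<Sum>j\<in>UNIV. - (cst (of_real (A $ i $ j)) * s i j))"
    by (intro sum.cong refl) (metis assms(2) mult_minus_left)
  also have "\<dots> = - ?S"
    by (simp add: sum_negf)
  finally have "?S = - ?S" by (subst (asm) sum.swap) simp
  then have "of_nat 2 * ?S = 0" by (simp add: eq_neg_iff_add_eq_0)
  then show ?thesis unfolding cpoly_char_0 by simp
qed

lemma so_act_add: "so_act A (p + q) = so_act A p + so_act A q"
  by (simp add: so_act_gl gl_act_add distrib_left sum.distrib)

lemma so_act_mult: "so_act A (p * q) = so_act A p * q + p * so_act A q"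
  by (simp add: so_act_gl gl_act_mult distrib_left sum.distrib sum_distrib_left sum_distrib_right mult_ac)

lemma so_act_cst [simp]: "so_act A (cst c) = 0"
  by (simp add: so_act_gl)

lemma so_act_0 [simp]: "so_act A 0 = 0"
  by (simp add: so_act_gl)

lemma so_act_scale: "so_act A (cst c * p) = cst c * so_act A p"
  by (simp add: so_act_mult)

lemma so_act_of_int [simp]: "so_act A (of_int i) = 0"
  using so_act_cst[of A "of_int i"] by simp

lemma so_act_diff: "so_act A (p - q) = so_act A p - so_act A q"
  using so_act_add[of A "p - q" q] by simp

lemma so_act_vdotD:
  assumes "u \<in> vecs" "v \<in> vecs"
  shows "so_act A (vdotD u v p) = vdotD u v (so_act A p)"
  by (simp add: so_act_gl gl_act_vdotD assms vdotD_sum vdotD_mult)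

lemma so_act_DdotD:
  assumes "transpose A = - A" "u \<in> vecs" "v \<in> vecs"
  shows "so_act A (DdotD u v p) = DdotD u v (so_act A p)"
proof -
  have "so_act A (DdotD u v p) = DdotD u v (so_act A p) -
      (\<Sum>i\<in>UNIV. \<Sum>j\<in>UNIV. cst (of_real (A $ i $ j)) * (pd (u j) (pd (v i) p) + pd (u i) (pd (v j) p)))"
    by (simp add: so_act_gl gl_act_DdotD assms DdotD_sum DdotD_scale right_diff_distrib sum_subtractf)
  then show ?thesis using skew_sum_symmetric[OF assms(1)] by (simp add: add.commute)
qed

lemma so_act_vdot:
  assumes "transpose A = - A" "u \<in> vecs" "v \<in> vecs"
  shows "so_act A (vdot u v) = 0"
proof -
  have "so_act A (vdot u v) =
      (\<Sum>i\<in>UNIV. \<Sum>j\<in>UNIV. cst (of_real (A $ i $ j)) * (mvar (u i) * mvar (v j) + mvar (u j) * mvar (v i)))"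
    by (simp add: so_act_gl gl_act_vdot assms)
  then show ?thesis using skew_sum_symmetric[OF assms(1)] by (simp add: add.commute)
qed

lemma so_submodule_harmonics: "so_submodule (harmonics a)"
  unfolding so_submodule_def
  by (auto simp: subspace_harmonics harmonics_iff so_act_mult simp flip: so_act_vdotD so_act_DdotD)

lemma so_submodule_linear_harmonics: "so_submodule (linear_harmonics u a)" if "u = X \<or> u = Y"
  using that unfolding so_submodule_def
  by (auto simp: subspace_linear_harmonics linear_harmonics_X linear_harmonics_Y so_act_mult
      simp flip: so_act_vdotD so_act_DdotD)

lemma so_submodule_simplicial_harmonics:
  assumes "u = X \<or> u = Y"
  shows "so_submodule (simplicial_harmonics u k 1)"
proof -
  have "cpoly.subspace (simplicial_harmonics u k 1)"
    using subspace_linear_harmonics[of u k] unfolding simplicial_harmonics_1[OF assms]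
    by (auto simp: subspace_iff vdotD_add DdotD_add vdotD_scale DdotD_scale)
  moreover have "so_act A p \<in> simplicial_harmonics u k 1"
    if "p \<in> simplicial_harmonics u k 1" "transpose A = - A" for A p
    using that so_submodule_linear_harmonics[OF assms, of k] assms unfolding simplicial_harmonics_1[OF assms]
    by (auto simp: so_submodule_def simp flip: so_act_vdotD so_act_DdotD)
  ultimately show ?thesis by (auto simp: so_submodule_def)
qed

definition so_hom_on :: "'n::finite cpoly set \<Rightarrow> ('n cpoly \<Rightarrow> 'n cpoly) \<Rightarrow> bool" where
  "so_hom_on U T \<longleftrightarrow> linear_on_set U T \<and>
     (\<forall>A. transpose A = - A \<longrightarrow> (\<forall>p\<in>U. T (so_act A p) = so_act A (T p)))"

text \<open>Transfers the property from an explicit formula to the operator that it describes on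
  \<open>U\<close>. A submodule is required because the formula is also evaluated at sums, multiples
  and \<open>so_act A p\<close>.\<close>

lemma so_hom_on_cong: "so_hom_on U T \<Longrightarrow> so_submodule U \<Longrightarrow> (\<And>p. p \<in> U \<Longrightarrow> T' p = T p) \<Longrightarrow> so_hom_on U T'"
  unfolding so_hom_on_def linear_on_set_def so_submodule_def
  by (simp add: image_subset_iff subspace_add subspace_scale)

lemma so_hom_on_subset: "so_hom_on U T \<Longrightarrow> V \<subseteq> U \<Longrightarrow> so_hom_on V T"
  unfolding so_hom_on_def linear_on_set_def by blast

lemma so_hom_on_comp:
  assumes "so_hom_on U S" "so_hom_on V T" "S ` U \<subseteq> V"
  shows "so_hom_on U (T \<circ> S)"
  using assms unfolding so_hom_on_def linear_on_set_def by (simp add: image_subset_iff)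

lemma so_submodule_image:
  assumes "so_submodule U" "so_hom_on U T"
  shows "so_submodule (T ` U)"
proof -
  have "so_act A (T p) \<in> T ` U" if "transpose A = - A" "p \<in> U" for A p
  proof -
    have "so_act A p \<in> U" using assms(1) that by (auto simp: so_submodule_def)
    moreover have "so_act A (T p) = T (so_act A p)" using assms(2) that by (simp add: so_hom_on_def)
    ultimately show ?thesis by simp
  qed
  moreover have "cpoly.subspace (T ` U)"
    using assms subspace_image unfolding so_submodule_def so_hom_on_def by blast
  ultimately show ?thesis unfolding so_submodule_def by blast
qed

lemma so_isomorphismI:
  assumes "so_submodule U" "so_hom_on U T" "inj_on T U"
  shows "so_isomorphism T U (T ` U)"
  using assms so_submodule_image[OF assms(1,2)]
  unfolding so_isomorphism_def so_hom_on_def linear_on_set_def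
  by (simp add: cscale_eq_cst bij_betw_def)

lemma inj_on_if_kernel_trivial:
  assumes "cpoly.subspace U" "linear_on_set U T" "\<And>p. p \<in> U \<Longrightarrow> T p = 0 \<Longrightarrow> p = 0"
  shows "inj_on T U"
proof (rule inj_onI)
  fix p q assume pq: "p \<in> U" "q \<in> U" "T p = T q"
  have m: "cst (-1) * q \<in> U" using pq assms(1) subspace_scale by blast
  have "T (p + cst (-1) * q) = T p + cst (-1) * T q"
    using pq m assms(2) unfolding linear_on_set_def by simp
  then have "T (p + cst (-1) * q) = 0" using pq by (simp add: cst_minus)
  then have "p + cst (-1) * q = 0" using assms(3) subspace_add[OF assms(1) pq(1) m] by blast
  then show "p = q" by (simp add: cst_minus)
qed

text \<open>The preimage in \<open>U\<close> of a submodule of the image is a submodule of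
  \<open>U\<close>.\<close>

lemma so_irreducible_image:
  assumes "so_irreducible U" "so_hom_on U T" "inj_on T U"
  shows "so_irreducible (T ` U)"
proof -
  have U: "so_submodule U" "cpoly.subspace U" "U \<noteq> {0}" and lin: "linear_on_set U T"
    using assms by (auto simp: so_irreducible_def so_submodule_def so_hom_on_def)
  have T0: "T 0 = 0" using linear_on_set_0[OF lin] subspace_0[OF U(2)] by blast
  have "T ` U \<noteq> {0}"
  proof
    assume *: "T ` U = {0}"
    have "p = 0" if "p \<in> U" for p
    proof -
      have "T p = T 0" using * that T0 by auto
      then show ?thesis using assms(3) that subspace_0[OF U(2)] by (meson inj_onD)
    qed
    then show False using U subspace_0 by blast
  qed
  moreover have "V = {0} \<or> V = T ` U" if V: "so_submodule V" "V \<subseteq> T ` U" for V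
  proof -
    let ?V = "{p \<in> U. T p \<in> V}"
    have "cpoly.subspace ?V"
      using U(2) V(1) lin T0 unfolding so_submodule_def subspace_iff linear_on_set_def by auto
    moreover have "so_act A p \<in> ?V" if "transpose A = - A" "p \<in> ?V" for A p
      using that U(1) V(1) assms(2) unfolding so_submodule_def so_hom_on_def by (auto simp: image_subset_iff)
    ultimately have "so_submodule ?V" unfolding so_submodule_def by blast
    then have "?V = {0} \<or> ?V = U"
      using assms(1) unfolding so_irreducible_def by blast
    moreover have VT: "V = T ` ?V" using V(2) by blast
    ultimately show ?thesis
    proof (elim disjE)
      assume "?V = {0}"
      then have "T ` ?V = {0}" by (simp only: image_insert image_empty T0)
      then show ?thesis by (intro disjI1 trans[OF VT])
    next
      assume "?V = U"
      then have "T ` ?V = T ` U" by (simp only:)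
      then show ?thesis by (intro disjI2 trans[OF VT])
    qed
  qed
  ultimately show ?thesis
    using so_submodule_image[OF U(1) assms(2)] unfolding so_irreducible_def by blast
qed

section \<open>Splitting the linear harmonics\<close>

lemma DdotD_DdotD_commute: "DdotD a b (DdotD c d p) = DdotD c d (DdotD a b p)"
  by (simp add: DdotD_def[of a b] pd_DdotD DdotD_sum)

lemma harmonics_D:
  assumes "u = X \<or> u = Y" "f \<in> harmonics b"
  shows "Euler u f = 0" "vdotD v u f = 0" "DdotD Z u f = 0" "Euler Z f = of_int b * f" "Laplace Z f = 0"
proof -
  have u: "u \<in> vecs" using assms(1) by auto
  show 0: "Euler u f = 0" "Euler Z f = of_int b * f" "Laplace Z f = 0"
    using assms by (auto simp: harmonics_iff)
  show "vdotD v u f = 0" using 0(1) u by (rule_tac vdotD_eq_0_if_Euler_eq_0)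
  show "DdotD Z u f = 0" using DdotD_eq_0_if_Euler_eq_0[OF u 0(1), of Z] by (simp add: DdotD_commute)
qed

text \<open>The last equation is the commutator of \<open>vdotD Z u\<close> and
  \<open>vdotD u Z\<close>, which equals \<open>Euler Z\<close> minus \<open>Euler u\<close>: on
  harmonics \<open>vdotD Z u\<close> undoes \<open>opS u\<close> up to the degree.\<close>

lemma vdotD_Z_linear_harmonics:
  assumes "u = X \<or> u = Y" "f \<in> harmonics b"
  shows "vdotD u Z f \<in> linear_harmonics u (b - 1)"
    and "DdotD Z u (vdotD u Z f) = 0" and "vdotD Z u (vdotD u Z f) = of_int b * f"
proof -
  have u: "u \<in> vecs" "u \<noteq> Z" "Z \<noteq> u" using assms(1) by auto
  note f = harmonics_D[OF assms]
  have f': "Euler X f = 0" "Euler Y f = 0" using assms(2) by (auto simp: harmonics_iff)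
  show "vdotD u Z f \<in> linear_harmonics u (b - 1)"
    using assms(1) f' f
      vdotD_commutator[of X X u Z f] vdotD_commutator[of Y Y u Z f] vdotD_commutator[of Z Z u Z f]
      DdotD_vdotD[of Z Z u Z f]
    by (elim disjE) (simp_all add: linear_harmonics_X linear_harmonics_Y vdotD_mult left_diff_distrib)
  show "DdotD Z u (vdotD u Z f) = 0"
    using DdotD_vdotD[of Z u u Z f] u f by simp
  show "vdotD Z u (vdotD u Z f) = of_int b * f"
    using vdotD_commutator[of Z u u Z f] u f by simp
qed

text \<open>Put \<open>s = vdotD u Z g\<close>. The two terms of \<open>harmonic_mult\<close> have
  Laplacians 2 s and, before scaling, 2 (2 b + m - 2) s, which explains the denominator. Contracting
  with \<open>DdotD Z u\<close> gives (m + b) g from the first term and 2 b g, before scaling, from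
  the second.\<close>

lemma harmonic_mult_linear_harmonics:
  fixes g :: "'n::finite cpoly"
  assumes "u = X \<or> u = Y" "g \<in> harmonics b" "CARD('n) \<ge> 3"
  shows "harmonic_mult u b g \<in> linear_harmonics u (b + 1)"
    and "DdotD Z u (harmonic_mult u b g) =
      cst (of_nat CARD('n) + of_int b - 2 * of_int b / of_int (2 * b + int CARD('n) - 2)) * g"
proof -
  have u: "u \<in> vecs" "u \<noteq> Z" "Z \<noteq> u" using assms(1) by auto
  note g = harmonics_D[OF assms(1,2)]
  have g': "Euler X g = 0" "Euler Y g = 0" using assms(2) by (auto simp: harmonics_iff)
  define s where "s = vdotD u Z g"
  note s = vdotD_Z_linear_harmonics[OF assms(1,2), folded s_def]
  define c :: complex where "c = 1 / of_int (2 * b + int CARD('n) - 2)"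
  have def: "harmonic_mult u b g = vdot u Z * g - cst c * (vdot Z Z * s)"
    by (simp add: harmonic_mult_def c_def s_def)
  have sZ: "Euler Z s = of_int b * s - s" "Laplace Z s = 0"
    using s(1) assms(1) by (auto simp: linear_harmonics_def algebra_simps)
  have Laplace: "Laplace Z (harmonic_mult u b g) = 0"
  proof (cases "b < 0")
    case True
    then have "g = 0" using assms(2) harmonics_neg by blast
    then show ?thesis by (simp add: harmonic_mult_def)
  next
    case False
    then have "of_int (2 * b + int CARD('n) - 2) \<noteq> (0 :: complex)"
      using assms(3) by (simp only: of_int_eq_0_iff)
    then have c: "cst c * of_int (2 * b + int CARD('n) - 2) = (1 :: 'n cpoly)"
      by (simp only: c_def flip: cst_of_int cst_mult) simp
    have "Laplace Z (vdot u Z * g) = 2 * s"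
      using DdotD_vdot_mult[of Z Z u Z g] u g by (simp add: s_def)
    moreover have "Laplace Z (vdot Z Z * s) = 2 * (of_int (2 * b + int CARD('n) - 2) * s)"
      using DdotD_vdot_mult[of Z Z Z Z s] sZ by (simp add: algebra_simps)
    then have "cst c * Laplace Z (vdot Z Z * s) = 2 * (cst c * of_int (2 * b + int CARD('n) - 2)) * s"
      by (simp only: mult_ac)
    ultimately show ?thesis unfolding c by (simp add: def DdotD_diff DdotD_scale)
  qed
  have E1: "Euler v (vdot u Z * g) = vdot u Z * Euler v g + (if v = u then vdot u Z * g else 0) + (if v = Z then vdot u Z * g else 0)"
    if "v \<in> vecs" for v
    using vdotD_vdot_mult[of v u Z v g] u that by auto (simp_all add: vdot_commute)
  have E2: "Euler v (vdot Z Z * s) = vdot Z Z * Euler v s + (if v = Z then 2 * (vdot Z Z * s) else 0)"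
    if "v \<in> vecs" for v
    using vdotD_vdot_mult[of v Z Z v s] that by auto
  have "Euler v (harmonic_mult u b g) = Euler v (vdot u Z * g) - cst c * Euler v (vdot Z Z * s)" for v
    unfolding def by (simp add: vdotD_diff vdotD_scale)
  from this[of X] this[of Y] this[of Z]
  show "harmonic_mult u b g \<in> linear_harmonics u (b + 1)"
    using assms(1) def Laplace E1[of X] E1[of Y] E1[of Z] E2[of X] E2[of Y] E2[of Z] g' g sZ s(1)
    by (elim disjE) (simp_all add: linear_harmonics_X linear_harmonics_Y ring_distribs
        mult_ac)
  have "DdotD Z u (vdot u Z * g) = (of_nat CARD('n) + of_int b) * g"
    using DdotD_vdot_mult[of Z u u Z g] u g by (simp add: distrib_right)
  moreover have "DdotD Z u (vdot Z Z * s) = 2 * (of_int b * g)"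
    using DdotD_vdot_mult[of Z u Z Z s] u s by simp
  ultimately have "DdotD Z u (harmonic_mult u b g) = (of_nat CARD('n) + of_int b) * g - cst c * (2 * of_int b) * g"
    by (simp add: def DdotD_diff DdotD_scale mult.assoc)
  also have "\<dots> = cst (of_nat CARD('n) + of_int b - c * (2 * of_int b)) * g"
    by (simp add: cst_add cst_diff cst_mult left_diff_distrib)
  finally show "DdotD Z u (harmonic_mult u b g) =
      cst (of_nat CARD('n) + of_int b - 2 * of_int b / of_int (2 * b + int CARD('n) - 2)) * g"
    by (simp add: c_def)
qed

text \<open>Clearing the denominator turns the vanishing into the integer equation (m + b) (2 b + m
  - 2) = 2 b, but the left side is at least 3 (2 b + 1).\<close>

lemma harmonic_mult_coefficient:
  assumes "b \<ge> 0" "m \<ge> 3"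
  shows "of_nat m + of_int b - 2 * of_int b / of_int (2 * b + int m - 2) \<noteq> (0 :: complex)"
proof
  assume *: "of_nat m + of_int b - 2 * of_int b / of_int (2 * b + int m - 2) = (0 :: complex)"
  have nz: "of_int (2 * b + int m - 2) \<noteq> (0 :: complex)"
    using assms by (simp only: of_int_eq_0_iff)
  have "of_int ((int m + b) * (2 * b + int m - 2) - 2 * b) =
     (of_nat m + of_int b - 2 * of_int b / of_int (2 * b + int m - 2)) * (of_int (2 * b + int m - 2) :: complex)"
    using nz by (simp only: left_diff_distrib times_divide_eq_left nonzero_mult_div_cancel_right) simp
  then have "(int m + b) * (2 * b + int m - 2) = 2 * b"
    using * by (simp only: mult_zero_left of_int_eq_0_iff)
  moreover have "(int m + b) * (2 * b + int m - 2) \<ge> 3 * (2 * b + int m - 2)"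
    using assms by (intro mult_right_mono) auto
  ultimately show False using assms by simp
qed

lemma so_hom_on_opS:
  assumes "u = X \<or> u = Y"
  shows "so_hom_on (harmonics b) (opS u)"
proof (rule so_hom_on_cong[of _ "vdotD u Z"])
  show "so_hom_on (harmonics b) (vdotD u Z)"
    using assms by (auto simp: so_hom_on_def linear_on_set_def vdotD_add vdotD_scale so_act_vdotD)
qed (use assms so_submodule_harmonics opS_harmonics in auto)

lemma so_hom_on_opC:
  assumes "u = X \<or> u = Y" "CARD('n::finite) \<ge> 3"
  shows "so_hom_on (harmonics b :: 'n cpoly set) (opC u)"
proof (rule so_hom_on_cong[of _ "harmonic_mult u b"])
  have u: "u \<in> vecs" using assms(1) by auto
  show "so_hom_on (harmonics b :: 'n cpoly set) (harmonic_mult u b)"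
    using u by (auto simp: so_hom_on_def linear_on_set_def harmonic_mult_def vdotD_add vdotD_scale so_act_vdotD
        so_act_diff so_act_mult so_act_vdot distrib_left right_diff_distrib mult.left_commute)
qed (use assms so_submodule_harmonics opC_harmonics in auto)

lemma linear_harmonics_direct_sum:
  assumes u: "u = X \<or> u = Y" and m: "CARD('n::finite) \<ge> 3"
  shows "is_direct_sum (linear_harmonics u a :: 'n cpoly set)
    [simplicial_harmonics u a 1, opS u ` harmonics (a + 1), opC u ` harmonics (a - 1)]"
proof -
  have uZ: "u \<in> vecs" "u \<noteq> Z" "Z \<noteq> u" using u by auto
  let ?LH = "linear_harmonics u a :: 'n cpoly set"
  define \<beta> :: complex where
    "\<beta> = of_nat CARD('n) + of_int (a - 1) - 2 * of_int (a - 1) / of_int (2 * (a - 1) + int CARD('n) - 2)"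
  have S: "opS u f \<in> ?LH" "DdotD Z u (opS u f) = 0" "vdotD Z u (opS u f) = of_int (a + 1) * f"
    if "f \<in> harmonics (a + 1)" for f
    using vdotD_Z_linear_harmonics[OF u that] by (simp_all add: opS_harmonics[OF u that])
  have C: "opC u g \<in> ?LH" "DdotD Z u (opC u g) = cst \<beta> * g" if "g \<in> harmonics (a - 1)" for g
    using harmonic_mult_linear_harmonics[OF u that m] by (simp_all add: opC_harmonics[OF u that m] \<beta>_def)
  have \<beta>: "\<beta> \<noteq> 0" if "a \<ge> 1"
    using harmonic_mult_coefficient[of "a - 1" "CARD('n)"] that m unfolding \<beta>_def by simp
  have H: "simplicial_harmonics u a 1 = {p \<in> ?LH. DdotD Z u p = 0 \<and> vdotD Z u p = 0}"
    by (rule simplicial_harmonics_1[OF u])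
  note LH = subspace_linear_harmonics[of u a]
  show ?thesis
  proof (rule is_direct_sum_3I)
    show "cpoly.subspace (simplicial_harmonics u a 1)"
      using so_submodule_simplicial_harmonics[OF u] by (simp add: so_submodule_def)
    show "cpoly.subspace (opS u ` harmonics (a + 1))" "cpoly.subspace (opC u ` harmonics (a - 1) :: 'n cpoly set)"
      using subspace_image subspace_harmonics so_hom_on_opS[OF u] so_hom_on_opC[OF u m]
      unfolding so_hom_on_def by blast+
    show "h + s + c \<in> ?LH"
      if "h \<in> simplicial_harmonics u a 1" "s \<in> opS u ` harmonics (a + 1)" "c \<in> opC u ` harmonics (a - 1)" for h s c
      using that S(1) C(1) LH unfolding H by (auto intro!: subspace_add)
    show "\<exists>h\<in>simplicial_harmonics u a 1. \<exists>s\<in>opS u ` harmonics (a + 1). \<exists>c\<in>opC u ` harmonics (a - 1).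
       p = h + s + c" if p: "p \<in> ?LH" for p
    proof (cases "a < 0")
      case True
      then have "p = 0" using p linear_harmonics_neg by blast
      moreover have "0 \<in> simplicial_harmonics u a 1" "0 \<in> opS u ` harmonics (a + 1)" "0 \<in> opC u ` harmonics (a - 1)"
        using subspace_0 \<open>cpoly.subspace (simplicial_harmonics u a 1)\<close>
          \<open>cpoly.subspace (opS u ` harmonics (a + 1))\<close> \<open>cpoly.subspace (opC u ` harmonics (a - 1))\<close> by blast+
      ultimately show ?thesis by (intro bexI[of _ 0]) auto
    next
      case False
      have B: "DdotD Z u q \<in> harmonics (a - 1)" if q: "q \<in> ?LH" for q
      proof -
        have "DdotD Z u (of_int a * q) = of_int a * DdotD Z u q" by (rule DdotD_of_int_mult)
        then show ?thesis
          using u q DdotD_vdotD[of Z u X X q] DdotD_vdotD[of Z u Y Y q] DdotD_vdotD[of Z u Z Z q]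
            DdotD_DdotD_commute[of Z Z Z u q]
          by (elim disjE) (simp_all add: linear_harmonics_X linear_harmonics_Y harmonics_iff algebra_simps)
      qed
      define g where "g = cst (1 / \<beta>) * DdotD Z u p"
      have g: "g \<in> harmonics (a - 1)"
        unfolding g_def using B[OF p] subspace_harmonics subspace_scale by blast
      define p1 where "p1 = p - opC u g"
      have p1: "p1 \<in> ?LH" unfolding p1_def using p C(1)[OF g] LH subspace_diff by blast
      \<comment> \<open>For a = 0 the constant \<open>\<beta>\<close> may be 0, but the contraction
        is then harmonic of degree -1, hence 0.\<close>
      have "cst \<beta> * g = DdotD Z u p"
      proof (cases "a = 0")
        case True
        then have "DdotD Z u p = 0" using B[OF p] harmonics_neg[of "a - 1"] by auto
        then show ?thesis by (simp add: g_def)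
      next
        case False
        then show ?thesis using \<beta> \<open>\<not> a < 0\<close> by (simp add: g_def flip: mult.assoc cst_mult)
      qed
      then have Bp1: "DdotD Z u p1 = 0" using C(2)[OF g] by (simp add: p1_def DdotD_diff)
      define f where "f = cst (1 / of_int (a + 1)) * vdotD Z u p1"
      have "vdotD Z u (of_int a * p1) = of_int a * vdotD Z u p1" by (simp add: vdotD_mult)
      \<comment> \<open>The Laplacian of \<open>vdotD Z u p1\<close> is twice
        \<open>DdotD Z u p1\<close>, which is why the image of \<open>opC u\<close> is split off
        first.\<close>
      then have "vdotD Z u p1 \<in> harmonics (a + 1)"
        using u p1 Bp1 DdotD_commute[of Z u p1] vdotD_commutator[of X X Z u p1] vdotD_commutator[of Y Y Z u p1]
          vdotD_commutator[of Z Z Z u p1] DdotD_vdotD[of Z Z Z u p1]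
        by (elim disjE) (simp_all add: linear_harmonics_X linear_harmonics_Y harmonics_iff algebra_simps)
      then have f: "f \<in> harmonics (a + 1)"
        unfolding f_def using subspace_harmonics subspace_scale by blast
      have nz: "of_int (a + 1) \<noteq> (0 :: complex)" using False by (simp only: of_int_eq_0_iff)
      have "of_int (a + 1) * f = cst (of_int (a + 1) * (1 / of_int (a + 1))) * vdotD Z u p1"
        unfolding f_def cst_mult cst_of_int by (simp only: mult.assoc)
      also have "\<dots> = vdotD Z u p1" using nz by (simp del: of_int_add)
      finally have "vdotD Z u (p1 - opS u f) = 0" using S(3)[OF f] by (simp add: vdotD_diff)
      moreover have "p1 - opS u f \<in> ?LH" using p1 S(1)[OF f] LH subspace_diff by blast
      ultimately have "p1 - opS u f \<in> simplicial_harmonics u a 1"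
        unfolding H using Bp1 S(2)[OF f] by (simp add: DdotD_diff)
      moreover have "p = (p1 - opS u f) + opS u f + opC u g" by (simp add: p1_def)
      ultimately show ?thesis using f g by blast
    qed
    show "h = 0 \<and> s = 0 \<and> c = 0"
      if h: "h \<in> simplicial_harmonics u a 1" and s: "s \<in> opS u ` harmonics (a + 1)" and c: "c \<in> opC u ` harmonics (a - 1)"
        and sum: "h + s + c = 0" for h s c
    proof (cases "a < 0")
      case True
      then have "?LH = {0}" by (rule linear_harmonics_neg)
      then show ?thesis using that S(1) C(1) unfolding H by auto
    next
      case False
      obtain f g where f: "f \<in> harmonics (a + 1)" "s = opS u f" and g: "g \<in> harmonics (a - 1)" "c = opC u g"
        using s c by blast
      have "DdotD Z u (h + s + c) = cst \<beta> * g"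
        using h S(2) C(2) f g unfolding H by (simp add: DdotD_add)
      then have "cst \<beta> * g = 0" using sum by simp
      then have "g = 0"
        using \<beta> g(1) harmonics_neg[of "a - 1"] False by (cases "a = 0") auto
      then have c: "c = 0"
        using g(2) linear_on_set_0[of "harmonics (a - 1)" "opC u"] g(1) so_hom_on_opC[OF u m]
        by (auto simp: so_hom_on_def)
      then have "vdotD Z u (h + s + c) = of_int (a + 1) * f"
        using h S(3) f unfolding H by (simp add: vdotD_add)
      then have "cst (of_int (a + 1)) * f = vdotD Z u 0" unfolding cst_of_int using sum by simp
      then have "cst (of_int (a + 1)) * f = 0" by (simp only: vdotD_0)
      then have "f = 0" using False unfolding cst_mult_eq_0_iff of_int_eq_0_iff by auto
      then have "s = 0"
        using f(2) opS_harmonics[OF u f(1)] by simp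
      then show ?thesis using c sum by simp
    qed
  qed
qed

section \<open>The kernel of L\<close>

text \<open>The first number is the denominator c of \<open>proj_L\<close>, the second is c + 1.
  Together they make the factor 1 + 1/c of the y-part defined and nonzero.\<close>

lemma proj_L_coefficients:
  assumes "b \<ge> 0" "m \<ge> 3"
  shows "of_int b + of_nat m / 2 - 1 \<noteq> (0::complex)" and "of_int b + of_nat m / 2 \<noteq> (0::complex)"
proof -
  have "of_int (2 * b + int m - 2) \<noteq> (0::complex)" "of_int (2 * b + int m) \<noteq> (0::complex)"
    using assms by (simp_all only: of_int_eq_0_iff)
  then show "of_int b + of_nat m / 2 - 1 \<noteq> (0::complex)" "of_int b + of_nat m / 2 \<noteq> (0::complex)"
    by (auto simp: field_simps)
qed

lemma Euler_proj_L:
  fixes q :: "'n::finite cpoly"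
  assumes "q \<in> linear_harmonics Y b" "CARD('n) \<ge> 3"
  shows "Euler Y (proj_L q) = cst (1 + 1 / (of_int b + of_nat CARD('n) / 2 - 1)) * q"
proof -
  have q: "Euler X q = 0" "Euler Y q = q"
    using assms by (auto simp: linear_harmonics_Y)
  have "Euler Y (vdotD X Y q) = 0"
    using vdotD_commutator[of Y Y X Y q] q by simp
  then have "Euler Y (vdot Z Z * vdotD X Y q) = 0"
    using vdotD_vdot_mult[of Y Z Z Y "vdotD X Y q"] by simp
  then show ?thesis
    using q by (simp add: proj_L_linear_harmonics[OF assms] vdotD_add vdotD_scale cst_add distrib_right)
qed

text \<open>One correction suffices because \<open>opL\<close> annihilates \<open>s = opL q\<close>.
  With c = b + m/2 - 1, the term \<open>vdotD X Y\<close> contributes (1 + 1/c) s, and the Laplacian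
  of |z|^2 s is 4 (c + 1) s, which enters \<open>opL\<close> with weight -1/(4 c).\<close>

lemma proj_L_in_ker_L:
  fixes q :: "'n::finite cpoly"
  assumes q: "q \<in> linear_harmonics Y b" and m: "CARD('n) \<ge> 3"
    and \<alpha>: "\<alpha> = of_nat CARD('n) / 2 + 1 + of_int b"
  shows "proj_L q \<in> ker_L 1 \<alpha>"
proof (cases "b < 0")
  case True
  then have "q = 0" using q linear_harmonics_neg by blast
  then show ?thesis using proj_L_linear_harmonics[OF q m]
    by (simp add: ker_L_def homogeneous_in_XY_iff opL_def opE_def cscale_eq_cst)
next
  case False
  define c :: complex where "c = of_int b + of_nat CARD('n) / 2 - 1"
  have c: "c \<noteq> 0" using proj_L_coefficients[of b "CARD('n)"] False m by (simp add: c_def)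
  define s where "s = vdotD X Y q"
  have q': "Euler X q = 0" "Euler Y q = q" "Euler Z q = of_int b * q" "Laplace Z q = 0"
    using q by (auto simp: linear_harmonics_Y)
  have s: "Euler X s = s" "Euler Y s = 0" "Euler Z s = of_int b * s" "Laplace Z s = 0" "vdotD X Y s = 0"
    using vdotD_commutator[of X X X Y q] vdotD_commutator[of Y Y X Y q] vdotD_commutator[of Z Z X Y q]
      DdotD_vdotD[of Z Z X Y q] q' vdotD_eq_0_if_Euler_eq_0[of Y s X]
    by (simp_all add: s_def vdotD_mult)
  define t where "t = vdot Z Z * s"
  have t: "Euler X t = t" "Euler Y t = 0" "Euler Z t = of_int (b + 2) * t" "vdotD X Y t = 0"
    using vdotD_vdot_mult[of X Z Z X s] vdotD_vdot_mult[of Y Z Z Y s] vdotD_vdot_mult[of Z Z Z Z s]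
      vdotD_vdot_mult[of Y Z Z X s] s
    by (simp_all add: t_def algebra_simps)
  have Lt: "Laplace Z t = cst (4 * (c + 1)) * s"
  proof -
    have "4 * (c + 1) = 4 * of_int b + 2 * of_nat CARD('n)" by (simp add: c_def)
    then have "cst (4 * (c + 1)) = (4 * of_int b + 2 * of_nat CARD('n) :: 'n cpoly)"
      by (simp only: cst_add cst_mult cst_of_int cst_of_nat cst_numeral)
    then show ?thesis
      using DdotD_vdot_mult[of Z Z Z Z s] s by (simp add: t_def algebra_simps)
  qed
  have P: "proj_L q = q + cst (1 / c) * (q + cst (1/2) * t)"
    using proj_L_linear_harmonics[OF q m] by (simp add: s_def c_def t_def)
  have EX: "Euler X (proj_L q) = cst (1 / c) * (cst (1/2) * t)"
    and EY: "Euler Y (proj_L q) = q + cst (1 / c) * q"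
    and EZ: "Euler Z (proj_L q) = of_int b * q + cst (1 / c) * (of_int b * q + cst (1/2) * (of_int (b + 2) * t))"
    using q' t unfolding P by (simp_all only: vdotD_add vdotD_scale) simp_all
  have "proj_L q \<in> homogeneous_in (range X \<union> range Y) 1"
    unfolding homogeneous_in_XY_iff EX EY by (simp add: P ring_distribs)
  moreover have "opE (proj_L q) = cscale \<alpha> (proj_L q)"
    unfolding opE_def EX EY EZ
    by (simp add: P \<alpha> cscale_eq_cst cst_add ring_distribs mult_ac)
  moreover have "opL (proj_L q) = 0"
  proof -
    have "vdotD X Y (proj_L q) = s + cst (1 / c) * s"
      using t unfolding P by (simp only: vdotD_add vdotD_scale) (simp add: s_def)
    moreover have "Laplace Z (proj_L q) = cst (1 / c) * (cst (1/2) * (cst (4 * (c + 1)) * s))"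
      using q' Lt unfolding P by (simp only: DdotD_add DdotD_scale) simp
    ultimately have "opL (proj_L q) = cst (1 + 1 / c - 1 / 2 * (1 / c * (1 / 2 * (4 * (c + 1))))) * s"
      unfolding opL_def cscale_eq_cst cst_diff cst_add cst_mult by (simp only: ring_distribs mult_ac cst_1 mult_1)
    also have "1 + 1 / c - 1 / 2 * (1 / c * (1 / 2 * (4 * (c + 1)))) = 0"
      using c by (simp add: field_simps)
    finally show ?thesis by simp
  qed
  ultimately show ?thesis by (simp add: ker_L_def)
qed

lemma so_hom_on_proj_L:
  assumes "CARD('n::finite) \<ge> 3"
  shows "so_hom_on (linear_harmonics Y b :: 'n cpoly set) proj_L"
proof (rule so_hom_on_cong)
  let ?T = "\<lambda>p. p + cst (1 / (of_int b + of_nat CARD('n) / 2 - 1)) * (p + cst (1/2) * (vdot Z Z * vdotD X Y p))"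
  show "so_hom_on (linear_harmonics Y b :: 'n cpoly set) ?T"
    by (auto simp: so_hom_on_def linear_on_set_def vdotD_add vdotD_scale so_act_vdotD so_act_add so_act_scale
        so_act_mult so_act_vdot distrib_left mult.left_commute)
qed (use assms so_submodule_linear_harmonics proj_L_linear_harmonics in auto)

lemma inj_on_proj_L:
  assumes "CARD('n::finite) \<ge> 3"
  shows "inj_on proj_L (linear_harmonics Y b :: 'n cpoly set)"
proof (rule inj_on_if_kernel_trivial)
  show "cpoly.subspace (linear_harmonics Y b :: 'n cpoly set)" by (rule subspace_linear_harmonics)
  show "linear_on_set (linear_harmonics Y b :: 'n cpoly set) proj_L"
    using so_hom_on_proj_L[OF assms] by (simp add: so_hom_on_def)
  show "q = 0" if q: "q \<in> linear_harmonics Y b" "proj_L q = 0" for q :: "'n cpoly"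
  proof (cases "b < 0")
    case True
    then show ?thesis using q linear_harmonics_neg by blast
  next
    case False
    then have "1 + 1 / (of_int b + of_nat CARD('n) / 2 - 1) \<noteq> (0::complex)"
      using proj_L_coefficients[of b "CARD('n)"] assms by (simp add: divide_simps)
    then show ?thesis using Euler_proj_L[OF q(1) assms] q(2) by simp
  qed
qed

lemma opL_add: "opL (p + q) = opL p + opL q"
  and opE_add: "opE (p + q) = opE p + opE q"
  and opL_scale: "opL (cst c * p) = cst c * opL p"
  and opE_scale: "opE (cst c * p) = cst c * opE p"
  by (simp_all add: opL_def opE_def cscale_eq_cst vdotD_add DdotD_add vdotD_scale DdotD_scale
      distrib_left right_diff_distrib mult.left_commute)

lemma opL_0 [simp]: "opL 0 = 0" and opE_0 [simp]: "opE 0 = 0"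
  by (simp_all add: opL_def opE_def cscale_eq_cst)

text \<open>Every monomial of \<open>p\<close> has degree 0 or 1 in y, so \<open>Euler Y\<close>
  extracts the y-part and is a projection.\<close>

lemma degree_1_split:
  fixes p :: "'n::finite cpoly"
  assumes "Euler X p + Euler Y p = p"
  shows "Euler Y (Euler Y p) = Euler Y p"
proof (rule poly_mapping_eqI)
  fix \<mu> :: "'n var \<Rightarrow>\<^sub>0 nat"
  let ?x = "\<Sum>j\<in>UNIV. Poly_Mapping.lookup \<mu> (X j)" and ?y = "\<Sum>j\<in>UNIV. Poly_Mapping.lookup \<mu> (Y j)"
  have "of_nat (?x + ?y) * Poly_Mapping.lookup p \<mu> = 1 * Poly_Mapping.lookup p \<mu>"
    using arg_cong[OF assms, of "\<lambda>p. Poly_Mapping.lookup p \<mu>"]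
    by (simp add: lookup_add lookup_Euler distrib_right del: of_nat_sum)
  then have "Poly_Mapping.lookup p \<mu> = 0 \<or> of_nat (?x + ?y) = (of_nat 1 :: complex)"
    unfolding mult_cancel_right by simp
  then have "Poly_Mapping.lookup p \<mu> = 0 \<or> ?x + ?y = 1"
    unfolding of_nat_eq_iff .
  then have "Poly_Mapping.lookup p \<mu> = 0 \<or> ?y = 0 \<or> ?y = 1"
    by linarith
  then show "Poly_Mapping.lookup (Euler Y (Euler Y p)) \<mu> = Poly_Mapping.lookup (Euler Y p) \<mu>"
    unfolding lookup_Euler by (elim disjE) simp_all
qed

text \<open>The shift by 2 comes from \<open>opE\<close>: its eigenvalue is m/2 - 1 plus the
  z-degree on x-linear polynomials and m/2 + 1 plus the z-degree on y-linear ones.\<close>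

lemma ker_L_direct_sum:
  assumes m: "CARD('n::finite) \<ge> 3" and \<alpha>: "\<alpha> = of_nat CARD('n) / 2 - 1 + of_int a"
  shows "is_direct_sum (ker_L 1 \<alpha> :: 'n cpoly set)
     [linear_harmonics X a, proj_L ` linear_harmonics Y (a - 2)]"
proof -
  let ?K = "ker_L 1 \<alpha> :: 'n cpoly set" and ?LY = "linear_harmonics Y (a - 2) :: 'n cpoly set"
  have K: "p \<in> ?K \<longleftrightarrow> Euler X p + Euler Y p = p \<and> opL p = 0 \<and> opE p = cst \<alpha> * p" for p
    by (simp add: ker_L_def homogeneous_in_XY_iff cscale_eq_cst)
  have subK: "cpoly.subspace ?K"
    unfolding subspace_iff
    by (auto simp: K opL_add opE_add opL_scale opE_scale vdotD_add vdotD_scale distrib_left mult.left_commute)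
      (simp_all add: add.assoc add.left_commute flip: distrib_left)
  have X: "p \<in> ?K" if "p \<in> linear_harmonics X a" for p
  proof -
    have p: "Euler X p = p" "Euler Y p = 0" "Euler Z p = of_int a * p" "Laplace Z p = 0"
      using that by (auto simp: linear_harmonics_X)
    then show ?thesis
      using vdotD_eq_0_if_Euler_eq_0[of Y p X]
      unfolding K by (simp add: opL_def opE_def cscale_eq_cst \<alpha> cst_add cst_diff ring_distribs)
  qed
  have Y: "proj_L q \<in> ?K" if "q \<in> ?LY" for q
    by (rule proj_L_in_ker_L[OF that m]) (simp add: \<alpha>)
  define k :: complex where "k = 1 + 1 / (of_int (a - 2) + of_nat CARD('n) / 2 - 1)"
  have EY: "Euler Y (proj_L q) = cst k * q" if "q \<in> ?LY" for q
    unfolding k_def by (rule Euler_proj_L[OF that m])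
  have k: "k \<noteq> 0" if "a \<ge> 2"
    using proj_L_coefficients[of "a - 2" "CARD('n)"] m that unfolding k_def
    by (simp add: divide_simps) (simp add: field_simps)
  have k': "cst (1 / k) * (cst k * q) = q" if "q \<in> ?LY" for q
  proof (cases "a \<ge> 2")
    case True
    then show ?thesis using k by (simp flip: mult.assoc cst_mult)
  next
    case False
    then have "q = 0" using that linear_harmonics_neg[of "a - 2" Y] by auto
    then show ?thesis by simp
  qed
  show ?thesis
  proof (rule is_direct_sum_2I)
    show "cpoly.subspace (linear_harmonics X a :: 'n cpoly set)" by (rule subspace_linear_harmonics)
    show "cpoly.subspace (proj_L ` ?LY)"
      using so_hom_on_proj_L[OF m] subspace_linear_harmonics subspace_image unfolding so_hom_on_def by blast
    show "p + r \<in> ?K" if "p \<in> linear_harmonics X a" "r \<in> proj_L ` ?LY" for p r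
      using that X Y subK subspace_add by blast
    show "p = 0 \<and> r = 0" if p: "p \<in> linear_harmonics X a" and r: "r \<in> proj_L ` ?LY" and sum: "p + r = 0" for p r
    proof -
      obtain q where q: "q \<in> ?LY" "r = proj_L q" using r by blast
      have "Euler Y (p + r) = cst k * q"
        using p EY[OF q(1)] q(2) by (simp add: vdotD_add linear_harmonics_X)
      then have "cst k * q = 0" using sum by simp
      then have "cst (1 / k) * 0 = q" using k'[OF q(1)] by (simp only:)
      then have "q = 0" by simp
      then have "r = 0" using q proj_L_linear_harmonics[OF q(1) m] by simp
      then show ?thesis using sum by simp
    qed
    show "\<exists>p'\<in>linear_harmonics X a. \<exists>r\<in>proj_L ` ?LY. p = p' + r" if p: "p \<in> ?K" for p
    proof -
      have p': "Euler X p + Euler Y p = p" "opL p = 0" "opE p = cst \<alpha> * p" using p by (auto simp: K)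
      define y where "y = Euler Y p"
      have yy: "Euler Y y = y" unfolding y_def by (rule degree_1_split[OF p'(1)])
      have xp: "Euler X p = p - y" using p'(1) by (simp add: y_def algebra_simps)
      have Yx: "Euler Y (Euler X p) = 0" unfolding xp using yy by (simp add: vdotD_diff y_def)
      have "Euler X (Euler Y p) = Euler Y (Euler X p)"
        using vdotD_commutator[of X X Y Y p] by simp
      then have xy: "Euler X y = 0" using Yx by (simp add: y_def)
      have YZ: "Euler Y (Euler Z p) = Euler Z y"
        using vdotD_commutator[of Y Y Z Z p] by (simp add: y_def)
      have "Euler Y (opE p) = y + Euler Z y + cst (of_nat CARD('n) / 2) * y"
        using yy Yx YZ by (simp only: opE_def cscale_eq_cst vdotD_add vdotD_diff vdotD_scale) (simp add: y_def)
      moreover have "Euler Y (opE p) = cst \<alpha> * y"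
        unfolding p'(3) by (simp only: vdotD_scale y_def)
      ultimately have "Euler Z y = cst \<alpha> * y - y - cst (of_nat CARD('n) / 2) * y"
        by (simp add: algebra_simps)
      also have "\<dots> = of_int (a - 2) * y"
        by (simp add: \<alpha> cst_add cst_diff ring_distribs)
      finally have yZ: "Euler Z y = of_int (a - 2) * y" .
      \<comment> \<open>\<open>vdotD X Y\<close> kills the x-part of \<open>p\<close> and makes the
        y-part linear in x. So the y-component of the kernel equation involves only the Laplacian of
        the y-part.\<close>
      have "Euler Y (vdotD X Y p) = 0"
      proof -
        have "Euler Y (vdotD X Y p) = vdotD X Y y - vdotD X Y p"
          using vdotD_commutator[of Y Y X Y p] by (simp add: y_def)
        also have "\<dots> = - vdotD X Y (Euler X p)" unfolding xp by (simp add: vdotD_diff)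
        also have "vdotD X Y (Euler X p) = 0"
        proof -
          have "Euler Y (Euler X p) = 0" by (rule Yx)
          then show ?thesis by (rule vdotD_eq_0_if_Euler_eq_0[rotated]) simp
        qed
        finally show ?thesis by simp
      qed
      moreover have "Euler Y (Laplace Z p) = Laplace Z y"
        using DdotD_vdotD[of Z Z Y Y p] by (simp add: y_def)
      ultimately have "Euler Y (opL p) = - (cst (1/2) * Laplace Z y)"
        by (simp add: opL_def cscale_eq_cst vdotD_diff vdotD_scale)
      then have "Laplace Z y = 0" using p'(2) by simp
      then have y: "y \<in> ?LY" using yy xy yZ by (simp add: linear_harmonics_Y)
      define q where "q = cst (1 / k) * y"
      have q: "q \<in> ?LY" unfolding q_def using y subspace_linear_harmonics subspace_scale by blast
      have "cst k * q = y" using k'[OF y] by (simp add: q_def mult.left_commute)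
      \<comment> \<open>The difference has no y-part, and for such polynomials the kernel equations
        are those of the linear harmonics in x.\<close>
      define r where "r = p - proj_L q"
      have "r \<in> ?K" unfolding r_def using p Y[OF q] subK subspace_diff by blast
      then have r: "Euler X r + Euler Y r = r" "opL r = 0" "opE r = cst \<alpha> * r" by (auto simp: K)
      have rY: "Euler Y r = 0"
        using EY[OF q] \<open>cst k * q = y\<close> by (simp add: r_def vdotD_diff y_def)
      then have rX: "Euler X r = r" using r(1) by simp
      have "- r + Euler Z r + cst (of_nat CARD('n) / 2) * r = cst \<alpha> * r"
        using r(3) rX rY by (simp add: opE_def cscale_eq_cst)
      then have "Euler Z r = cst \<alpha> * r + r - cst (of_nat CARD('n) / 2) * r"
        by (simp add: algebra_simps)
      also have "\<dots> = of_int a * r"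
        by (simp add: \<alpha> cst_add cst_diff ring_distribs)
      finally have "Euler Z r = of_int a * r" .
      moreover have "Laplace Z r = 0"
        using r(2) vdotD_eq_0_if_Euler_eq_0[of Y r X] rY by (simp add: opL_def cscale_eq_cst)
      ultimately have "r \<in> linear_harmonics X a" using rX rY by (simp add: linear_harmonics_X)
      moreover have "p = r + proj_L q" by (simp add: r_def)
      ultimately show ?thesis using q by blast
    qed
  qed
qed

section \<open>The Fischer form\<close>

lemma finite_UNIV_var [simp]: "finite (UNIV :: 'n::finite var set)"
proof -
  have "(UNIV :: 'n var set) = range X \<union> range Y \<union> range Z"
  proof (intro equalityI subsetI)
    fix v :: "'n var"
    show "v \<in> range X \<union> range Y \<union> range Z" by (cases v) auto
  qed simp
  moreover have "finite (range X \<union> range Y \<union> range Z :: 'n var set)" by simp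
  ultimately show ?thesis by (rule ssubst)
qed

definition mfact :: "('n::finite var \<Rightarrow>\<^sub>0 nat) \<Rightarrow> complex" where
  "mfact \<mu> = of_nat (\<Prod>v\<in>UNIV. fact (Poly_Mapping.lookup \<mu> v))"

lemma mfact_add_single:
  "mfact (\<mu> + Poly_Mapping.single v 1) = of_nat (Poly_Mapping.lookup \<mu> v + 1) * mfact \<mu>"
proof -
  have "(\<Prod>w\<in>UNIV. fact (Poly_Mapping.lookup (\<mu> + Poly_Mapping.single v 1) w)) =
     fact (Poly_Mapping.lookup \<mu> v + 1) * (\<Prod>w\<in>UNIV - {v}. fact (Poly_Mapping.lookup (\<mu> + Poly_Mapping.single v 1) w) :: nat)"
    by (subst prod.remove[of _ v]) (simp_all add: lookup_add)
  also have "(\<Prod>w\<in>UNIV - {v}. fact (Poly_Mapping.lookup (\<mu> + Poly_Mapping.single v 1) w) :: nat) =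
     (\<Prod>w\<in>UNIV - {v}. fact (Poly_Mapping.lookup \<mu> w))"
    by (intro prod.cong) (auto simp: lookup_add lookup_single)
  also have "fact (Poly_Mapping.lookup \<mu> v + 1) * (\<Prod>w\<in>UNIV - {v}. fact (Poly_Mapping.lookup \<mu> w)) =
     (Poly_Mapping.lookup \<mu> v + 1) * (\<Prod>w\<in>UNIV. fact (Poly_Mapping.lookup \<mu> w) :: nat)"
    by (subst (2) prod.remove[of _ v]) (simp_all add: algebra_simps)
  finally show ?thesis unfolding mfact_def by (simp only: of_nat_mult)
qed

text \<open>The inner product that pairs p and q to the value at 0 of p(d) applied to the conjugate
  of q. The factorials make multiplication by a variable adjoint to its derivative, see
  \<open>fischer_mvar\<close>.\<close>

definition fischer :: "'n::finite cpoly \<Rightarrow> 'n cpoly \<Rightarrow> complex" where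
  "fischer p q = (\<Sum>\<mu>\<in>Poly_Mapping.keys p. mfact \<mu> * Poly_Mapping.lookup p \<mu> * cnj (Poly_Mapping.lookup q \<mu>))"

lemma fischer_superset:
  assumes "finite S" "Poly_Mapping.keys p \<subseteq> S"
  shows "fischer p q = (\<Sum>\<mu>\<in>S. mfact \<mu> * Poly_Mapping.lookup p \<mu> * cnj (Poly_Mapping.lookup q \<mu>))"
  unfolding fischer_def by (rule sum.mono_neutral_left) (use assms in \<open>auto simp: in_keys_iff\<close>)

lemma fischer_add_left: "fischer (p + p') q = fischer p q + fischer p' q"
proof -
  let ?S = "Poly_Mapping.keys p \<union> Poly_Mapping.keys p'"
  have S: "finite ?S" "Poly_Mapping.keys p \<subseteq> ?S" "Poly_Mapping.keys p' \<subseteq> ?S" "Poly_Mapping.keys (p + p') \<subseteq> ?S"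
    using keys_add[of p p'] by auto
  show ?thesis
    unfolding fischer_superset[OF S(1,2)] fischer_superset[OF S(1,3)] fischer_superset[OF S(1,4)]
    by (simp add: lookup_add algebra_simps sum.distrib)
qed

lemma fischer_add_right: "fischer p (q + q') = fischer p q + fischer p q'"
  by (simp add: fischer_def lookup_add algebra_simps sum.distrib)

lemma fischer_scale_right: "fischer p (cst c * q) = cnj c * fischer p q"
  by (simp add: fischer_def lookup_cst_mult sum_distrib_left mult.left_commute)

lemma fischer_0_left [simp]: "fischer 0 q = 0"
  by (simp add: fischer_def)

lemma fischer_0_right [simp]: "fischer p 0 = 0"
  by (simp add: fischer_def)

lemma fischer_cnj: "fischer q p = cnj (fischer p q)"
proof -
  let ?S = "Poly_Mapping.keys p \<union> Poly_Mapping.keys q"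
  have S: "finite ?S" "Poly_Mapping.keys p \<subseteq> ?S" "Poly_Mapping.keys q \<subseteq> ?S"
    by auto
  show ?thesis
    unfolding fischer_superset[OF S(1,2)] fischer_superset[OF S(1,3)]
    by (simp add: mfact_def mult_ac)
qed

lemma fischer_scale_left: "fischer (cst c * p) q = c * fischer p q"
  by (metis fischer_cnj fischer_scale_right complex_cnj_cnj complex_cnj_mult)

lemma fischer_sum_left: "fischer (sum f S) q = (\<Sum>i\<in>S. fischer (f i) q)"
  by (induction S rule: infinite_finite_induct) (simp_all add: fischer_add_left)

lemma fischer_sum_right: "fischer p (sum f S) = (\<Sum>i\<in>S. fischer p (f i))"
  by (induction S rule: infinite_finite_induct) (simp_all add: fischer_add_right)

lemma fischer_self_eq_0:
  assumes "fischer p p = 0"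
  shows "p = 0"
proof -
  let ?f = "\<lambda>\<mu>. of_nat (\<Prod>v\<in>UNIV. fact (Poly_Mapping.lookup \<mu> v)) * (cmod (Poly_Mapping.lookup p \<mu>))\<^sup>2"
  have "complex_of_real (\<Sum>\<mu>\<in>Poly_Mapping.keys p. ?f \<mu>) = fischer p p"
    unfolding fischer_def mfact_def of_real_sum
    by (intro sum.cong refl) (simp only: of_real_mult of_real_of_nat_eq complex_norm_square mult.assoc)
  then have "(\<Sum>\<mu>\<in>Poly_Mapping.keys p. ?f \<mu>) = 0"
    using assms by (simp only: of_real_eq_0_iff)
  then have "?f \<mu> = 0" if "\<mu> \<in> Poly_Mapping.keys p" for \<mu>
    using that by (subst (asm) sum_nonneg_eq_0_iff) (auto simp del: of_nat_prod)
  moreover have "?f \<mu> \<noteq> 0" if "\<mu> \<in> Poly_Mapping.keys p" for \<mu>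
    using that by (auto simp: in_keys_iff simp del: of_nat_prod)
  ultimately have "Poly_Mapping.keys p = {}" by blast
  then show ?thesis by simp
qed

lemma fischer_mvar: "fischer (mvar v * p) q = fischer p (pd v q)"
proof (induction p rule: cpoly_induct)
  case (single \<mu> c)
  have s: "fischer (Poly_Mapping.single \<nu> c) r = mfact \<nu> * c * cnj (Poly_Mapping.lookup r \<nu>)" for \<nu> and r :: "'a cpoly"
    by (cases "c = 0") (simp_all add: fischer_def)
  have "mvar v * Poly_Mapping.single \<mu> c = Poly_Mapping.single (\<mu> + Poly_Mapping.single v 1) c"
    by (simp add: mvar_def mult_single add.commute)
  then show ?case
    by (simp only: s mfact_add_single lookup_pd complex_cnj_mult complex_cnj_of_nat mult_ac)
qed (simp add: distrib_left fischer_add_left)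

lemma fischer_pd: "fischer (pd v p) q = fischer p (mvar v * q)"
  by (metis fischer_mvar fischer_cnj)

lemma fischer_gl_act: "fischer (gl_act i j p) q = fischer p (gl_act j i q)"
  by (simp add: gl_act_def fischer_add_left fischer_add_right fischer_mvar fischer_pd)

text \<open>The adjoint of \<open>gl_act i j\<close> is \<open>gl_act j i\<close>, and the entries
  of \<open>A\<close> are real. This makes the orthogonal complement of a submodule
  invariant.\<close>

lemma fischer_so_act: "fischer (so_act A p) q = fischer p (so_act (transpose A) q)"
proof -
  have "fischer (so_act A p) q = (\<Sum>i\<in>UNIV. \<Sum>j\<in>UNIV. of_real (A $ i $ j) * fischer p (gl_act j i q))"
    by (simp add: so_act_gl fischer_sum_left fischer_scale_left fischer_gl_act)
  also have "\<dots> = (\<Sum>j\<in>UNIV. \<Sum>i\<in>UNIV. of_real (A $ i $ j) * fischer p (gl_act j i q))"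
    by (rule sum.swap)
  also have "\<dots> = fischer p (so_act (transpose A) q)"
    by (simp add: so_act_gl fischer_sum_right fischer_scale_right transpose_def)
  finally show ?thesis .
qed

lemma subspace_orthogonal: "cpoly.subspace {q. fischer p q = 0}"
  by (simp add: subspace_iff fischer_add_right fischer_scale_right)

lemma orthogonal_projection:
  assumes "finite B"
  shows "\<exists>u\<in>cpoly.span B. \<forall>q\<in>cpoly.span B. fischer (p - u) q = 0"
  using assms
proof (induction B arbitrary: p)
  case empty
  then show ?case by (simp add: cpoly.span_empty)
next
  case (insert b B)
  obtain u where u: "u \<in> cpoly.span B" "\<forall>q\<in>cpoly.span B. fischer (p - u) q = 0"
    using insert.IH by blast
  obtain v where v: "v \<in> cpoly.span B" "\<forall>q\<in>cpoly.span B. fischer (b - v) q = 0"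
    using insert.IH by blast
  have mono: "cpoly.span B \<subseteq> cpoly.span (insert b B)" by (rule cpoly.span_mono) auto
  \<comment> \<open>A Gram-Schmidt step. If \<open>b\<close> already lies in the span of
    \<open>B\<close>, then \<open>b - v = 0\<close>, and division by zero makes c equal to
    0.\<close>
  define c where "c = fischer (p - u) (b - v) / fischer (b - v) (b - v)"
  define w where "w = u + cst c * (b - v)"
  have pw: "p - w = (p - u) + cst (- c) * (b - v)" by (simp add: w_def cst_minus)
  have "b - v \<in> cpoly.span (insert b B)"
    using mono v(1) by (intro cpoly.span_diff) (auto intro: cpoly.span_base)
  then have "w \<in> cpoly.span (insert b B)"
    unfolding w_def using mono u(1) cpoly.span_scale[of "b - v" "insert b B" c]
    by (intro cpoly.span_add) (auto simp: cscale_eq_cst)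
  moreover have "fischer (p - w) q = 0" if "q \<in> cpoly.span (insert b B)" for q
  proof -
    have B: "fischer (p - w) q = 0" if "q \<in> cpoly.span B" for q
      using that u(2) v(2) by (simp add: pw fischer_add_left fischer_scale_left)
    have "fischer (p - w) (b - v) = 0"
      using fischer_self_eq_0[of "b - v"]
      by (cases "fischer (b - v) (b - v) = 0") (simp_all add: pw fischer_add_left fischer_scale_left c_def)
    then have "fischer (p - w) ((b - v) + v) = 0" using B[OF v(1)] by (simp only: fischer_add_right add_0)
    then have "insert b B \<subseteq> {q. fischer (p - w) q = 0}" using B cpoly.span_base by auto
    then show ?thesis using cpoly.span_minimal[OF _ subspace_orthogonal] that by blast
  qed
  ultimately show ?case by blast
qed

lemma finite_bounded_exponents: "finite {\<mu> :: 'n::finite var \<Rightarrow>\<^sub>0 nat. \<forall>v. Poly_Mapping.lookup \<mu> v \<le> K}"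
proof (rule finite_imageD)
  show "finite (Poly_Mapping.lookup ` {\<mu> :: 'n var \<Rightarrow>\<^sub>0 nat. \<forall>v. Poly_Mapping.lookup \<mu> v \<le> K})"
  proof (rule finite_subset)
    show "finite (Pi\<^sub>E (UNIV :: 'n var set) (\<lambda>_. {..K}))" by (rule finite_PiE) auto
  qed (auto simp: PiE_iff)
  show "inj_on Poly_Mapping.lookup {\<mu> :: 'n var \<Rightarrow>\<^sub>0 nat. \<forall>v. Poly_Mapping.lookup \<mu> v \<le> K}"
    by (rule inj_onI) (rule poly_mapping_eqI, simp)
qed

text \<open>The exponent bound puts \<open>V\<close> into the span of finitely many monomials. Hence
  \<open>U\<close> has a finite basis and admits orthogonal projections, and the residue of a vector
  of \<open>V\<close> outside \<open>U\<close> is a nonzero element of the complement.\<close>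

lemma orthogonal_complement:
  fixes U V :: "'n::finite cpoly set"
  assumes V: "so_submodule V" and U: "so_submodule U" "U \<subseteq> V" "U \<noteq> V"
    and K: "\<And>p \<mu> v. p \<in> V \<Longrightarrow> \<mu> \<in> Poly_Mapping.keys p \<Longrightarrow> Poly_Mapping.lookup \<mu> v \<le> K"
  obtains W where "so_submodule W" "W \<subseteq> V" "W \<noteq> {0}" "U \<inter> W = {0}"
proof -
  define M where "M = (\<lambda>\<mu>. Poly_Mapping.single \<mu> (1::complex)) ` {\<mu> :: 'n var \<Rightarrow>\<^sub>0 nat. \<forall>v. Poly_Mapping.lookup \<mu> v \<le> K}"
  have fin: "finite M" unfolding M_def using finite_bounded_exponents by blast
  have VM: "V \<subseteq> cpoly.span M"
  proof
    fix p assume p: "p \<in> V"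
    have "p = (\<Sum>\<mu>\<in>Poly_Mapping.keys p. cscale (Poly_Mapping.lookup p \<mu>) (Poly_Mapping.single \<mu> 1))"
      by (rule poly_mapping_eqI)
        (simp add: lookup_sum cscale_def mult_single lookup_single when_def in_keys_iff)
    also have "\<dots> \<in> cpoly.span M"
      using K[OF p] by (intro cpoly.span_sum cpoly.span_scale cpoly.span_base) (auto simp: M_def)
    finally show "p \<in> cpoly.span M" .
  qed
  obtain B where B: "B \<subseteq> U" "cpoly.independent B" "U \<subseteq> cpoly.span B"
    using cpoly.maximal_independent_subset by blast
  have "finite B"
    using cpoly.independent_span_bound[OF fin B(2)] B(1) U(2) VM by blast
  have sub: "cpoly.subspace U" "cpoly.subspace V" using U(1) V by (auto simp: so_submodule_def)
  have span: "cpoly.span B = U"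
    using B(1,3) sub(1) by (simp add: cpoly.span_minimal subset_antisym)
  define W where "W = {p \<in> V. \<forall>q\<in>U. fischer p q = 0}"
  have "cpoly.subspace W"
    using sub(2) by (auto simp: W_def subspace_iff fischer_add_left fischer_scale_left)
  moreover have "so_act A p \<in> W" if A: "transpose A = - A" and p: "p \<in> W" for A p
  proof -
    have "fischer (so_act A p) q = 0" if "q \<in> U" for q
    proof -
      have "transpose (transpose A) = - transpose A" using A by (metis minus_minus transpose_transpose)
      then have "so_act (transpose A) q \<in> U"
        using U(1) that unfolding so_submodule_def image_subset_iff by blast
      then show ?thesis using p by (simp add: W_def fischer_so_act)
    qed
    then show ?thesis using V A p by (auto simp: W_def so_submodule_def)
  qed
  ultimately have "so_submodule W" by (auto simp: so_submodule_def)
  moreover have "W \<subseteq> V" by (auto simp: W_def)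
  moreover have "W \<noteq> {0}"
  proof -
    obtain p where p: "p \<in> V" "p \<notin> U" using U(2,3) by blast
    obtain u where u: "u \<in> U" "\<forall>q\<in>U. fischer (p - u) q = 0"
      using orthogonal_projection[OF \<open>finite B\<close>, of p] span by auto
    have "p - u \<in> V" using subspace_diff[OF sub(2) p(1)] u(1) U(2) by blast
    then have "p - u \<in> W" using u(2) by (auto simp: W_def)
    moreover have "p - u \<noteq> 0" using p u by auto
    ultimately show ?thesis by blast
  qed
  moreover have "U \<inter> W = {0}"
  proof -
    have "0 \<in> U \<inter> W" using sub(1) \<open>cpoly.subspace W\<close> subspace_0 by blast
    moreover have "p = 0" if "p \<in> U \<inter> W" for p
      using that fischer_self_eq_0 by (auto simp: W_def)
    ultimately show ?thesis by blast
  qed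
  ultimately show ?thesis by (rule that)
qed

lemma lookup_le_if_Euler:
  assumes "Euler u p = of_int k * p" "\<mu> \<in> Poly_Mapping.keys p"
  shows "Poly_Mapping.lookup \<mu> (u j) \<le> nat k"
proof -
  have "of_nat (\<Sum>j\<in>UNIV. Poly_Mapping.lookup \<mu> (u j)) * Poly_Mapping.lookup p \<mu> = of_int k * Poly_Mapping.lookup p \<mu>"
    using arg_cong[OF assms(1), of "\<lambda>p. Poly_Mapping.lookup p \<mu>"]
    by (simp only: lookup_Euler lookup_of_int_mult)
  then have "of_nat (\<Sum>j\<in>UNIV. Poly_Mapping.lookup \<mu> (u j)) = (of_int k :: complex)"
    using assms(2) by (simp only: mult_cancel_right in_keys_iff) simp
  then have "int (\<Sum>j\<in>UNIV. Poly_Mapping.lookup \<mu> (u j)) = k"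
    by (metis of_int_eq_iff of_int_of_nat_eq)
  moreover have "Poly_Mapping.lookup \<mu> (u j) \<le> (\<Sum>j\<in>UNIV. Poly_Mapping.lookup \<mu> (u j))"
    by (rule member_le_sum) auto
  ultimately show ?thesis by linarith
qed

section \<open>Locally nilpotent derivations\<close>

text \<open>Lets statements about derivations be checked on the variables.\<close>

lemma cpoly_ring_induct [case_names cst mvar add mult]:
  fixes p :: "'n::finite cpoly"
  assumes cst: "\<And>c. P (cst c)" and mvar: "\<And>v. P (mvar v)"
    and add: "\<And>p q. P p \<Longrightarrow> P q \<Longrightarrow> P (p + q)" and mult: "\<And>p q. P p \<Longrightarrow> P q \<Longrightarrow> P (p * q)"
  shows "P p"
proof (induction p rule: cpoly_induct)
  case (single \<mu> c)
  show ?case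
  proof (induction "\<Sum>v\<in>UNIV. Poly_Mapping.lookup \<mu> v" arbitrary: \<mu>)
    case 0
    then have "\<mu> = 0" by (auto intro!: poly_mapping_eqI)
    then show ?case using cst by (simp add: cst_def)
  next
    case (Suc n)
    obtain v where v: "Poly_Mapping.lookup \<mu> v \<noteq> 0"
      using Suc.hyps(2) by (metis Zero_not_Suc sum.neutral)
    define \<nu> where "\<nu> = \<mu> - Poly_Mapping.single v 1"
    have \<mu>: "\<mu> = Poly_Mapping.single v 1 + \<nu>"
      using v by (auto intro!: poly_mapping_eqI simp: \<nu>_def lookup_add lookup_minus lookup_single when_def)
    have "(\<Sum>w\<in>UNIV. Poly_Mapping.lookup \<mu> w) = 1 + (\<Sum>w\<in>UNIV. Poly_Mapping.lookup \<nu> w)"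
      by (simp add: \<mu> lookup_add sum.distrib lookup_single when_def)
    then have "P (Poly_Mapping.single \<nu> c)" using Suc.hyps by simp
    then have "P (mvar v * Poly_Mapping.single \<nu> c)" using mult mvar by blast
    then show ?case by (simp add: \<mu> mvar_def mult_single)
  qed
qed (rule add)

definition derivation :: "('n cpoly \<Rightarrow> 'n cpoly) \<Rightarrow> bool" where
  "derivation T \<longleftrightarrow> (\<forall>p q. T (p + q) = T p + T q) \<and> (\<forall>p q. T (p * q) = T p * q + p * T q) \<and> (\<forall>c. T (cst c) = 0)"

lemma derivation_add: "derivation T \<Longrightarrow> T (p + q) = T p + T q"
  and derivation_mult: "derivation T \<Longrightarrow> T (p * q) = T p * q + p * T q"
  and derivation_cst: "derivation T \<Longrightarrow> T (cst c) = 0"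
  by (simp_all add: derivation_def)

lemma derivation_0: "derivation T \<Longrightarrow> T 0 = 0"
  using derivation_cst[of T 0] by simp

lemma derivation_scale: "derivation T \<Longrightarrow> T (cst c * p) = cst c * T p"
  by (simp add: derivation_mult derivation_cst)

lemma derivation_minus: "derivation T \<Longrightarrow> T (- p) = - T p"
  using derivation_scale[of T "-1" p] by (simp add: cst_minus)

lemma derivation_diff: "derivation T \<Longrightarrow> T (p - q) = T p - T q"
  using derivation_add[of T p "- q"] by (simp add: derivation_minus)

lemma derivation_pd: "derivation (pd v)"
  by (simp add: derivation_def pd_add pd_mult)

lemma derivation_lin:
  "derivation S \<Longrightarrow> derivation T \<Longrightarrow> derivation (\<lambda>p. S p + cst c * T p)"
  by (simp add: derivation_def algebra_simps)

lemma derivation_funpow_0: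
  assumes "derivation T"
  shows "(T ^^ n) 0 = 0"
  by (induction n) (simp_all add: derivation_0[OF assms])

lemma derivation_funpow_add:
  assumes "derivation T"
  shows "(T ^^ n) (p + q) = (T ^^ n) p + (T ^^ n) q"
  by (induction n) (simp_all add: derivation_add[OF assms])

text \<open>The Leibniz rule makes \<open>T (p * q)\<close> a sum of two products, in each of which
  one of the two exponents has dropped by one.\<close>

lemma derivation_funpow_mult_eq_0:
  assumes T: "derivation T"
  shows "(T ^^ n) p = 0 \<Longrightarrow> (T ^^ m) q = 0 \<Longrightarrow> (T ^^ (n + m)) (p * q) = 0"
proof (induction "n + m" arbitrary: n m p q)
  case 0
  then show ?case by simp
next
  case (Suc k)
  show ?case
  proof (cases "n = 0 \<or> m = 0")
    case True
    then show ?thesis using Suc.prems derivation_funpow_0[OF T] by auto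
  next
    case False
    then obtain n' m' where n: "n = Suc n'" and m: "m = Suc m'" by (metis not0_implies_Suc)
    have k: "k = n' + m" "k = n + m'" using Suc.hyps(2) n m by auto
    have "(T ^^ (n' + m)) (T p * q) = 0"
      by (rule Suc.hyps(1)[OF k(1)]) (use Suc.prems n in \<open>simp_all add: funpow_swap1\<close>)
    moreover have "(T ^^ (n + m')) (p * T q) = 0"
      by (rule Suc.hyps(1)[OF k(2)]) (use Suc.prems m in \<open>simp_all add: funpow_swap1\<close>)
    ultimately have "(T ^^ k) (T (p * q)) = 0"
      by (simp add: derivation_mult[OF T] derivation_funpow_add[OF T] flip: k)
    then show ?thesis by (simp add: funpow_swap1 flip: Suc.hyps(2))
  qed
qed

text \<open>Three applications are what \<open>raise j\<close> takes: coordinates e and f go to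
  coordinate j, this to the isotropic coordinate, and that to 0.\<close>

lemma locally_nilpotent:
  fixes T :: "'n::finite cpoly \<Rightarrow> 'n cpoly"
  assumes T: "derivation T" and var: "\<And>v. T (T (T (mvar v))) = 0"
  shows "\<exists>n. (T ^^ n) p = 0"
proof (induction p rule: cpoly_ring_induct)
  case (cst c)
  then show ?case by (intro exI[of _ 1]) (simp add: derivation_cst[OF T])
next
  case (mvar v)
  then show ?case by (intro exI[of _ 3]) (simp add: eval_nat_numeral var)
next
  case (add p q)
  then obtain n m where "(T ^^ n) p = 0" "(T ^^ m) q = 0" by blast
  then have "(T ^^ (m + n)) p = 0" "(T ^^ (n + m)) q = 0"
    by (simp_all only: funpow_add o_apply derivation_funpow_0[OF T])
  then show ?case
    by (intro exI[of _ "n + m"]) (simp add: derivation_funpow_add[OF T] add.commute)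
next
  case (mult p q)
  then show ?case using derivation_funpow_mult_eq_0[OF T] by blast
qed

text \<open>The commutator of two derivations is a derivation, so it equals \<open>R\<close> as soon
  as it does on the variables.\<close>

lemma derivation_commute:
  fixes S T :: "'n::finite cpoly \<Rightarrow> 'n cpoly"
  assumes "derivation S" "derivation T" "derivation R" "\<And>v. S (T (mvar v)) = T (S (mvar v)) + R (mvar v)"
  shows "S (T p) = T (S p) + R p"
proof (induction p rule: cpoly_ring_induct)
  case (cst c)
  then show ?case using assms by (simp add: derivation_cst derivation_0)
next
  case (mult p q)
  then show ?case using assms(1-3) by (simp add: derivation_mult derivation_add algebra_simps)
qed (use assms in \<open>simp_all add: derivation_add\<close>)

lemma derivation_zero: "derivation (\<lambda>p. 0)"
  by (simp add: derivation_def)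

lemma cst_i_mult_cst_i: "cst \<i> * cst \<i> = -1" "cst \<i> * (cst \<i> * p) = - p"
  by (simp_all add: cst_minus flip: cst_mult mult.assoc)

lemma const_if_pd_eq_0:
  assumes "\<And>v. pd v p = 0"
  shows "\<exists>c. p = cst c"
proof -
  have "Poly_Mapping.lookup p \<mu> = Poly_Mapping.lookup (cst (Poly_Mapping.lookup p 0)) \<mu>" for \<mu>
  proof (cases "\<mu> = 0")
    case True
    then show ?thesis by (simp add: cst_def)
  next
    case False
    then obtain v where v: "Poly_Mapping.lookup \<mu> v \<noteq> 0" by (metis poly_mapping_eqI lookup_zero)
    have "\<mu> = (\<mu> - Poly_Mapping.single v 1) + Poly_Mapping.single v 1"
      using v by (auto intro!: poly_mapping_eqI simp: lookup_add lookup_minus lookup_single when_def)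
    then have "Poly_Mapping.lookup p \<mu> = 0"
      using arg_cong[OF assms[of v], of "\<lambda>p. Poly_Mapping.lookup p (\<mu> - Poly_Mapping.single v 1)"] v
      by (simp add: lookup_pd)  (metis of_nat_Suc of_nat_eq_0_iff nat.distinct(1))
    then show ?thesis using False by (simp add: cst_def lookup_single)
  qed
  then show ?thesis by (intro exI poly_mapping_eqI)
qed

lemma rot_in_submodule:
  fixes U :: "'n::finite cpoly set"
  assumes "so_submodule U" "p \<in> U"
  shows "gl_act i j p - gl_act j i p \<in> U"
proof -
  define A :: "real^'n^'n" where
    "A = (\<chi> a b. (if a = i then if b = j then 1 else 0 else 0) - (if a = j then if b = i then 1 else 0 else 0))"
  have "transpose A = - A" by (auto simp: A_def transpose_def vec_eq_iff)
  moreover have "so_act A p = gl_act i j p - gl_act j i p"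
  proof -
    have "so_act A p = (\<Sum>a\<in>UNIV. \<Sum>b\<in>UNIV. (if b = j then if a = i then gl_act a b p else 0 else 0) -
        (if b = i then if a = j then gl_act a b p else 0 else 0))"
      unfolding so_act_gl by (intro sum.cong refl) (auto simp: A_def cst_diff left_diff_distrib)
    also have "\<dots> = gl_act i j p - gl_act j i p"
      by (simp add: sum_subtractf)
    finally show ?thesis .
  qed
  ultimately show ?thesis
    using assms unfolding so_submodule_def image_subset_iff by metis
qed

section \<open>Vectors annihilated by the raising operators\<close>

lemma var_cases_vec: obtains u k where "u \<in> vecs" "v = u k"
  by (cases v) (use vecs_simps in metis)+

locale isotropic_plane =
  fixes e f :: "'n::finite"
  assumes ef: "e \<noteq> f"
begin

definition iso_coord :: "('n \<Rightarrow> 'n var) \<Rightarrow> 'n cpoly" where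
  "iso_coord u = mvar (u e) + cst \<i> * mvar (u f)"

definition coiso_coord :: "('n \<Rightarrow> 'n var) \<Rightarrow> 'n cpoly" where
  "coiso_coord u = mvar (u e) - cst \<i> * mvar (u f)"

text \<open>Since the vector spanned by \<open>e\<close> and \<open>f\<close> is isotropic, the derivative in its direction annihilates
  the corresponding coordinate: \<open>d_iso\<close> kills \<open>iso_coord\<close>, and \<open>d_coiso\<close> maps it to 2.\<close>

definition d_iso :: "('n \<Rightarrow> 'n var) \<Rightarrow> 'n cpoly \<Rightarrow> 'n cpoly" where
  "d_iso u p = pd (u e) p + cst \<i> * pd (u f) p"

definition d_coiso :: "('n \<Rightarrow> 'n var) \<Rightarrow> 'n cpoly \<Rightarrow> 'n cpoly" where
  "d_coiso u p = pd (u e) p - cst \<i> * pd (u f) p"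

definition perp :: "'n set" where
  "perp = UNIV - {e, f}"

text \<open>For \<open>j \<in> perp\<close> these operators span the nilradical of the stabiliser of the isotropic line.\<close>

definition raise :: "'n \<Rightarrow> 'n cpoly \<Rightarrow> 'n cpoly" where
  "raise j p = (gl_act e j p - gl_act j e p) + cst \<i> * (gl_act f j p - gl_act j f p)"

definition rot :: "'n \<Rightarrow> 'n \<Rightarrow> 'n cpoly \<Rightarrow> 'n cpoly" where
  "rot i j p = gl_act i j p - gl_act j i p"

lemma derivation_d_iso: "derivation (d_iso u)" and derivation_d_coiso: "derivation (d_coiso u)"
  and derivation_raise: "derivation (raise j)" and derivation_rot: "derivation (rot i j)"
  by (auto simp: derivation_def d_iso_def d_coiso_def raise_def rot_def pd_add pd_mult gl_act_add gl_act_mult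
      algebra_simps)

lemmas d_iso_simps = derivation_d_iso[THEN derivation_add] derivation_d_iso[THEN derivation_mult]
  derivation_d_iso[THEN derivation_diff] derivation_d_iso[THEN derivation_minus]

lemmas d_coiso_simps = derivation_d_coiso[THEN derivation_add] derivation_d_coiso[THEN derivation_mult]
  derivation_d_coiso[THEN derivation_diff] derivation_d_coiso[THEN derivation_minus]

lemmas raise_simps = derivation_raise[THEN derivation_add] derivation_raise[THEN derivation_mult]
  derivation_raise[THEN derivation_diff] derivation_raise[THEN derivation_minus]

lemma d_const [simp]: "d_iso u (cst c) = 0" "d_coiso u (cst c) = 0" "raise j (cst c) = 0" "rot i j (cst c) = 0"
  "d_iso u 0 = 0" "d_coiso u 0 = 0" "raise j 0 = 0" "rot i j 0 = 0"
  by (simp_all add: d_iso_def d_coiso_def raise_def rot_def)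

lemma perpD: "j \<in> perp \<Longrightarrow> j \<noteq> e" "j \<in> perp \<Longrightarrow> j \<noteq> f" "j \<in> perp \<Longrightarrow> e \<noteq> j" "j \<in> perp \<Longrightarrow> f \<noteq> j"
  by (auto simp: perp_def)

lemma d_iso_mvar:
  "u \<in> vecs \<Longrightarrow> v \<in> vecs \<Longrightarrow> d_iso u (mvar (v k)) =
     (if u = v then if k = e then 1 else if k = f then cst \<i> else 0 else 0)"
  using ef by (auto simp: d_iso_def pd_mvar_vec)

lemma d_coiso_mvar:
  "u \<in> vecs \<Longrightarrow> v \<in> vecs \<Longrightarrow> d_coiso u (mvar (v k)) =
     (if u = v then if k = e then 1 else if k = f then - cst \<i> else 0 else 0)"
  using ef by (auto simp: d_coiso_def pd_mvar_vec)

lemma d_iso_iso: "u \<in> vecs \<Longrightarrow> v \<in> vecs \<Longrightarrow> d_iso u (iso_coord v) = 0"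
  using ef by (auto simp: iso_coord_def d_iso_simps d_iso_mvar cst_i_mult_cst_i)

lemma d_coiso_iso: "u \<in> vecs \<Longrightarrow> v \<in> vecs \<Longrightarrow> d_coiso u (iso_coord v) = (if u = v then 2 else 0)"
  using ef by (auto simp: iso_coord_def d_coiso_simps d_coiso_mvar cst_i_mult_cst_i)

lemma pd_iso:
  "u \<in> vecs \<Longrightarrow> v \<in> vecs \<Longrightarrow> pd (u k) (iso_coord v) =
     (if u = v then if k = e then 1 else if k = f then cst \<i> else 0 else 0)"
  using ef by (auto simp: iso_coord_def pd_add pd_mult pd_mvar_vec)

lemma raise_mvar:
  "u \<in> vecs \<Longrightarrow> raise j (mvar (u k)) =
     (if k = j then iso_coord u else 0) - (if k = e then mvar (u j) else 0) - (if k = f then cst \<i> * mvar (u j) else 0)"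
  by (auto simp: raise_def gl_act_mvar iso_coord_def algebra_simps)

lemma rot_mvar:
  "u \<in> vecs \<Longrightarrow> rot i j (mvar (u k)) = (if k = j then mvar (u i) else 0) - (if k = i then mvar (u j) else 0)"
  by (auto simp: rot_def gl_act_mvar)

lemma raise_eq:
  "raise j p = (iso_coord X * pd (X j) p - mvar (X j) * d_iso X p) + (iso_coord Y * pd (Y j) p - mvar (Y j) * d_iso Y p) +
     (iso_coord Z * pd (Z j) p - mvar (Z j) * d_iso Z p)"
  by (simp add: raise_def gl_act_def iso_coord_def d_iso_def algebra_simps)

text \<open>\<open>raise j\<close> annihilates the isotropic vector, hence commutes with the
  derivative along it.\<close>

lemma raise_d_iso:
  assumes "u \<in> vecs" "j \<in> perp"
  shows "d_iso u (raise j p) = raise j (d_iso u p)"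
proof -
  have "d_iso u (raise j (mvar v)) = raise j (d_iso u (mvar v)) + 0" for v
  proof -
    obtain w k where v: "w \<in> vecs" "v = w k" by (rule var_cases_vec)
    show ?thesis
      using v assms ef perpD[OF assms(2)]
      by (auto simp: raise_mvar d_iso_mvar d_iso_simps d_iso_iso simp flip: cst_1)
  qed
  from derivation_commute[OF derivation_d_iso derivation_raise derivation_zero this] show ?thesis by simp
qed

text \<open>Where \<open>d_iso u p = 0\<close>, the derivatives \<open>pd (u k)\<close> therefore
  commute with the raising operators, and the coefficients of an annihilated vector are annihilated
  too.\<close>

lemma pd_raise:
  assumes "u \<in> vecs" "j \<in> perp" "k \<in> perp"
  shows "pd (u k) (raise j p) = raise j (pd (u k) p) - (if k = j then d_iso u p else 0)"
  using assms perpD[OF assms(2)] perpD[OF assms(3)]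
  by (auto simp: raise_eq pd_add pd_diff pd_mult pd_iso d_iso_def pd_mvar_vec vecs_def pd_commute[of "_ k"])

lemma raise_commute:
  assumes "i \<in> perp" "j \<in> perp"
  shows "raise i (raise j p) = raise j (raise i p)"
proof -
  \<comment> \<open>The images of the e-term and the f-term cancel, since i times -i is 1; thus
    \<open>raise j\<close> annihilates the isotropic coordinate.\<close>
  have iso_coord: "raise j (iso_coord u) = - mvar (u j) + mvar (u j)" if "j \<in> perp" "u \<in> vecs" for j u
    using that perpD[OF that(1)] ef by (simp add: iso_coord_def raise_simps raise_mvar cst_i_mult_cst_i)
  have "raise i (raise j (mvar v)) = raise j (raise i (mvar v)) + 0" for v
  proof -
    obtain w k where v: "w \<in> vecs" "v = w k" by (rule var_cases_vec)
    show ?thesis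
      using v assms ef perpD[OF assms(1)] perpD[OF assms(2)] iso_coord
      by (auto simp: raise_mvar raise_simps)
  qed
  from derivation_commute[OF derivation_raise derivation_raise derivation_zero this] show ?thesis by simp
qed

text \<open>The raising operators form the vector representation of so(perp). Hence the rotations
  \<open>rot i j\<close> preserve their common kernel.\<close>

lemma raise_rot:
  assumes "i \<in> perp" "j \<in> perp" "l \<in> perp" "i \<noteq> j"
  shows "raise l (rot i j p) =
    rot i j (raise l p) + ((if l = i then raise j p else 0) - (if l = j then raise i p else 0))"
proof (rule derivation_commute[OF derivation_raise derivation_rot])
  show "derivation (\<lambda>p. (if l = i then raise j p else 0) - (if l = j then raise i p else 0))"
    using assms(4) derivation_raise[of i] derivation_raise[of j] derivation_lin[OF derivation_zero derivation_raise, of "-1" i]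
    by (cases "l = i"; cases "l = j") (simp_all add: derivation_zero cst_minus)
  show "raise l (rot i j (mvar v)) =
    rot i j (raise l (mvar v)) + ((if l = i then raise j (mvar v) else 0) - (if l = j then raise i (mvar v) else 0))" for v
  proof -
    obtain w k where v: "w \<in> vecs" "v = w k" by (rule var_cases_vec)
    have "rot i j (iso_coord w) = 0"
      using v(1) perpD[OF assms(1)] perpD[OF assms(2)]
      by (simp add: iso_coord_def derivation_add[OF derivation_rot] derivation_scale[OF derivation_rot] rot_mvar)
    then show ?thesis
      using v assms ef perpD[OF assms(1)] perpD[OF assms(2)] perpD[OF assms(3)]
      by (auto simp: raise_mvar rot_mvar raise_simps derivation_diff[OF derivation_rot]
          derivation_minus[OF derivation_rot] derivation_scale[OF derivation_rot])
  qed
qed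

text \<open>\<open>raise j\<close> is a complex combination of two real rotations; it preserves
  \<open>U\<close> because \<open>U\<close> is a complex subspace.\<close>

lemma raise_in_submodule: "so_submodule U \<Longrightarrow> p \<in> U \<Longrightarrow> raise j p \<in> U"
  unfolding raise_def
  by (intro subspace_add subspace_scale rot_in_submodule) (auto simp: so_submodule_def)

lemma rot_in: "so_submodule U \<Longrightarrow> p \<in> U \<Longrightarrow> rot i j p \<in> U"
  unfolding rot_def by (rule rot_in_submodule)

lemma raise_locally_nilpotent:
  assumes "j \<in> perp"
  shows "\<exists>n. (raise j ^^ n) p = 0"
proof (rule locally_nilpotent[OF derivation_raise])
  fix v :: "'n var"
  obtain w k where v: "w \<in> vecs" "v = w k" by (rule var_cases_vec)
  have "raise j (iso_coord w) = 0"
    using v(1) perpD[OF assms(1)] ef by (simp add: iso_coord_def raise_simps raise_mvar cst_i_mult_cst_i)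
  then show "raise j (raise j (raise j (mvar v))) = 0"
    using v assms ef perpD[OF assms] by (auto simp: raise_mvar raise_simps)
qed

lemma d_iso_locally_nilpotent:
  assumes "u \<in> vecs"
  shows "\<exists>n. (d_iso u ^^ n) p = 0"
proof (rule locally_nilpotent[OF derivation_d_iso])
  fix v :: "'n var"
  obtain w k where v: "w \<in> vecs" "v = w k" by (rule var_cases_vec)
  show "d_iso u (d_iso u (d_iso u (mvar v))) = 0"
    using v assms by (auto simp: d_iso_mvar simp flip: cst_1)
qed

lemma last_nonzero_iterate:
  assumes "(T ^^ n) p = 0" "p \<noteq> 0"
  obtains m where "(T ^^ m) p \<noteq> 0" "T ((T ^^ m) p) = 0"
proof -
  have "\<exists>m. (T ^^ m) p \<noteq> 0 \<and> (T ^^ Suc m) p = 0"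
  proof (rule ccontr)
    assume "\<not> ?thesis"
    then have "(T ^^ m) p \<noteq> 0" for m
      using assms(2) by (induction m) auto
    then show False using assms(1) by blast
  qed
  then show ?thesis using that by auto
qed

text \<open>Engel's argument: pass to the last nonzero iterate of one operator at a time;
  commutativity preserves what was annihilated before.\<close>

lemma raise_invariant_exists:
  assumes U: "so_submodule U" "U \<noteq> {0}"
  shows "\<exists>p\<in>U. p \<noteq> 0 \<and> (\<forall>j\<in>perp. raise j p = 0)"
proof -
  have "\<exists>p\<in>U. p \<noteq> 0 \<and> (\<forall>j\<in>S. raise j p = 0)" if "finite S" "S \<subseteq> perp" for S
    using that
  proof (induction S rule: finite_induct)
    case empty
    have "0 \<in> U" using U(1) subspace_0 by (auto simp: so_submodule_def)
    then show ?case using U(2) by auto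
  next
    case (insert i S)
    then obtain p where p: "p \<in> U" "p \<noteq> 0" "\<And>j. j \<in> S \<Longrightarrow> raise j p = 0" by auto
    obtain n where "(raise i ^^ n) p = 0" using raise_locally_nilpotent insert.prems by blast
    then obtain m where m: "(raise i ^^ m) p \<noteq> 0" "raise i ((raise i ^^ m) p) = 0"
      using last_nonzero_iterate p(2) by blast
    have "(raise i ^^ m) p \<in> U"
      using p(1) by (induction m) (auto intro: raise_in_submodule[OF U(1)])
    moreover have "raise j ((raise i ^^ m) p) = 0" if "j \<in> S" for j
    proof (induction m)
      case 0
      then show ?case using p(3) that by simp
    next
      case (Suc m)
      then show ?case using raise_commute[of j i] insert.prems that by auto
    qed
    ultimately show ?case using m by auto
  qed
  then show ?thesis by (simp add: perp_def)
qed

text \<open>The polynomial ring is not available as an integral domain, since its variables are not linearly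
  ordered.\<close>

lemma iso_regular:
  assumes u: "u \<in> vecs" and p: "iso_coord u * p = 0"
  shows "p = 0"
proof -
  let ?T = "pd (u e)"
  have T: "(?T ^^ Suc n) (iso_coord u * q) = iso_coord u * (?T ^^ Suc n) q + of_nat (Suc n) * (?T ^^ n) q" for n q
  proof (induction n)
    case 0
    then show ?case using u by (simp add: pd_mult pd_iso)
  next
    case (Suc n)
    have "(?T ^^ Suc (Suc n)) (iso_coord u * q) = ?T (iso_coord u * (?T ^^ Suc n) q + of_nat (Suc n) * (?T ^^ n) q)"
      using Suc by simp
    also have "\<dots> = iso_coord u * (?T ^^ Suc (Suc n)) q + of_nat (Suc (Suc n)) * (?T ^^ Suc n) q"
      using u by (simp add: pd_add pd_mult pd_iso algebra_simps)
    finally show ?case .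
  qed
  have T0: "(?T ^^ n) 0 = 0" for n by (induction n) auto
  \<comment> \<open>\<open>?T\<close> maps the isotropic coordinate to 1, so \<open>T\<close> has
    one extra term. As \<open>iso_coord u * p = 0\<close>, that term lets the exponent that kills
    \<open>p\<close> descend to 0.\<close>
  have step: "(?T ^^ n) p = 0" if "(?T ^^ Suc n) p = 0" for n
  proof -
    have "of_nat (Suc n) * (?T ^^ n) p = 0" using T[of n p] p that T0[of "Suc n"] by (simp del: funpow.simps of_nat_Suc)
    then show ?thesis unfolding cpoly_char_0 by simp
  qed
  have "\<exists>n. (?T ^^ n) p = 0"
    by (rule locally_nilpotent[OF derivation_pd]) (simp add: pd_mvar)
  then obtain n where "(?T ^^ n) p = 0" by blast
  then have "(?T ^^ 0) p = 0"
    by (induction n) (use step in blast)+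
  then show ?thesis by simp
qed

lemma iso_power_regular: "u \<in> vecs \<Longrightarrow> iso_coord u ^ k * p = 0 \<Longrightarrow> p = 0"
  by (induction k) (auto simp: mult.assoc dest: iso_regular)

end

lemma derivation_power_eq_0: "derivation T \<Longrightarrow> T p = 0 \<Longrightarrow> T (p ^ k) = 0"
  by (induction k) (simp_all add: derivation_mult derivation_cst[of T 1, simplified])

lemma derivation_power: "derivation T \<Longrightarrow> T (p ^ Suc k) = of_nat (Suc k) * (p ^ k * T p)"
  by (induction k) (simp_all add: derivation_mult derivation_cst[of T 1, simplified] algebra_simps)

lemma derivation_vdotD: "derivation (vdotD u v)"
  by (simp add: derivation_def vdotD_add vdotD_mult)

section \<open>Coordinates adapted to the isotropic plane\<close>

context isotropic_plane
begin

lemma sum_UNIV_split: "(\<Sum>i\<in>UNIV. g i) = (g e + g f + (\<Sum>i\<in>perp. g i) :: 'n cpoly)"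
proof -
  have "(UNIV :: 'n set) = insert e (insert f perp)" by (auto simp: perp_def)
  then have "(\<Sum>i\<in>UNIV. g i) = (\<Sum>i\<in>insert e (insert f perp). g i)" by simp
  then show ?thesis using ef by (simp add: perp_def add.assoc)
qed

definition vdotD_perp :: "('n \<Rightarrow> 'n var) \<Rightarrow> ('n \<Rightarrow> 'n var) \<Rightarrow> 'n cpoly \<Rightarrow> 'n cpoly" where
  "vdotD_perp u v p = (\<Sum>j\<in>perp. mvar (u j) * pd (v j) p)"

definition DdotD_perp :: "('n \<Rightarrow> 'n var) \<Rightarrow> ('n \<Rightarrow> 'n var) \<Rightarrow> 'n cpoly \<Rightarrow> 'n cpoly" where
  "DdotD_perp u v p = (\<Sum>j\<in>perp. pd (u j) (pd (v j) p))"

text \<open>In isotropic coordinates the part in e and f is half the sum of two mixed products; the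
  factor 2 keeps the identity free of fractions.\<close>

lemma vdotD_split:
  "2 * vdotD u v p = 2 * vdotD_perp u v p + iso_coord u * d_coiso v p + coiso_coord u * d_iso v p"
  by (simp add: vdotD_def sum_UNIV_split vdotD_perp_def iso_coord_def coiso_coord_def d_iso_def d_coiso_def algebra_simps
      cst_i_mult_cst_i)

lemma DdotD_split:
  "2 * DdotD u v p = 2 * DdotD_perp u v p + d_iso u (d_coiso v p) + d_coiso u (d_iso v p)"
  by (simp add: DdotD_def sum_UNIV_split DdotD_perp_def d_iso_def d_coiso_def pd_add pd_diff pd_scale algebra_simps
      cst_i_mult_cst_i)

lemma d_commute: "d_coiso u (d_iso v p) = d_iso v (d_coiso u p)" "d_iso u (d_iso v p) = d_iso v (d_iso u p)"
  "d_iso u (pd w p) = pd w (d_iso u p)" "d_coiso u (pd w p) = pd w (d_coiso u p)"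
  by (simp_all add: d_iso_def d_coiso_def pd_add pd_diff pd_scale pd_commute[of _ "v _"] pd_commute[of w]
      algebra_simps)

lemma d_vdotD:
  assumes "u \<in> vecs" "a \<in> vecs"
  shows "d_iso u (vdotD a b p) = vdotD a b (d_iso u p) + (if u = a then d_iso b p else 0)"
    and "d_coiso u (vdotD a b p) = vdotD a b (d_coiso u p) + (if u = a then d_coiso b p else 0)"
  using assms by (simp_all add: d_iso_def d_coiso_def pd_vdotD vdotD_add vdotD_diff vdotD_scale algebra_simps)

lemma d_DdotD: "d_iso u (DdotD a b p) = DdotD a b (d_iso u p)"
  by (simp add: d_iso_def pd_DdotD DdotD_add DdotD_scale)

lemma d_eq_0_if_Euler_eq_0:
  assumes "u \<in> vecs" "Euler u p = 0"
  shows "d_iso u p = 0" "d_coiso u p = 0" "DdotD_perp Z u p = 0" "vdotD_perp v u p = 0"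
  using pd_eq_0_if_Euler_eq_0[OF assms]
  by (simp_all add: d_iso_def d_coiso_def DdotD_perp_def vdotD_perp_def)

lemma pd_perp_mvar_mult:
  assumes "u \<in> vecs" "j \<in> perp"
  shows "pd (Z j) (iso_coord u * p) = iso_coord u * pd (Z j) p"
    and "pd (Z j) (mvar (u j) * p) = mvar (u j) * pd (Z j) p + (if u = Z then p else 0)"
  using assms perpD[OF assms(2)] by (auto simp: pd_mult pd_iso pd_mvar_vec)

text \<open>The divergence of \<open>raise j p = 0\<close>, that is, \<open>\<partial>/\<partial>z\<^sub>j\<close> applied and summed over \<open>j\<close>.\<close>

lemma raise_invariant_identity:
  assumes "\<And>j. j \<in> perp \<Longrightarrow> raise j p = 0"
  shows "(iso_coord X * DdotD_perp Z X p - vdotD_perp X Z (d_iso X p)) + (iso_coord Y * DdotD_perp Z Y p - vdotD_perp Y Z (d_iso Y p))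
     + (iso_coord Z * DdotD_perp Z Z p - vdotD_perp Z Z (d_iso Z p)) = of_nat (card perp) * d_iso Z p"
proof -
  have "0 = (\<Sum>j\<in>perp. pd (Z j) (raise j p))" using assms by simp
  also have "\<dots> = (\<Sum>j\<in>perp. (iso_coord X * pd (Z j) (pd (X j) p) - mvar (X j) * pd (Z j) (d_iso X p))
     + (iso_coord Y * pd (Z j) (pd (Y j) p) - mvar (Y j) * pd (Z j) (d_iso Y p))
     + (iso_coord Z * pd (Z j) (pd (Z j) p) - mvar (Z j) * pd (Z j) (d_iso Z p)) - d_iso Z p)"
    by (intro sum.cong refl) (simp add: raise_eq pd_add pd_diff pd_perp_mvar_mult)
  finally show ?thesis
    by (simp add: sum.distrib sum_subtractf DdotD_perp_def vdotD_perp_def sum_distrib_left)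
qed

section \<open>Annihilated vectors in the harmonics\<close>

lemma d_iso_harmonics:
  assumes "p \<in> harmonics k"
  shows "d_iso Z p \<in> harmonics (k - 1)"
proof -
  have p: "Euler X p = 0" "Euler Y p = 0" "Euler Z p = of_int k * p" "Laplace Z p = 0"
    using assms by (auto simp: harmonics_iff)
  have "d_iso Z (of_int k * p) = of_int k * d_iso Z p"
    using derivation_scale[OF derivation_d_iso, of Z "of_int k" p] by simp
  then show ?thesis
    using p d_vdotD(1)[of Z X X p] d_vdotD(1)[of Z Y Y p] d_vdotD(1)[of Z Z Z p] d_DdotD[of Z Z Z p]
    by (simp add: harmonics_iff left_diff_distrib eq_diff_eq)
qed

lemma raise_harmonics:
  assumes "Euler X p = 0" "Euler Y p = 0"
  shows "raise j p = iso_coord Z * pd (Z j) p - mvar (Z j) * d_iso Z p"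
  using assms d_eq_0_if_Euler_eq_0[of X p] d_eq_0_if_Euler_eq_0[of Y p]
    pd_eq_0_if_Euler_eq_0[of X p] pd_eq_0_if_Euler_eq_0[of Y p]
  by (simp add: raise_eq)

lemma pd_perp_eq_0:
  assumes "Euler X p = 0" "Euler Y p = 0" "raise j p = 0" "d_iso Z p = 0"
  shows "pd (Z j) p = 0"
  using raise_harmonics[OF assms(1,2), of j] assms(3,4) iso_regular[of Z] by simp

text \<open>Let N be the cardinality of \<open>perp\<close> and \<open>q = d_iso Z p\<close>. The
  Laplace equation gives \<open>DdotD_perp Z Z p = - d_coiso Z q\<close>, so by
  \<open>raise_invariant_identity\<close> N q is the negative of
  \<open>iso_coord Z * d_coiso Z q\<close>, while the Euler equation of q identifies this product
  with 2 (k - 1) q. The sum N + 2 (k - 1) is positive for k >= 1.\<close>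

lemma raise_invariant_harmonic_step:
  assumes p: "p \<in> harmonics k" and inv: "\<And>j. j \<in> perp \<Longrightarrow> raise j p = 0"
    and dd: "d_iso Z (d_iso Z p) = 0" and perp: "perp \<noteq> {}"
  shows "d_iso Z p = 0"
proof -
  have p': "Euler X p = 0" "Euler Y p = 0" "Laplace Z p = 0" using p by (auto simp: harmonics_iff)
  define q where "q = d_iso Z p"
  have q: "q \<in> harmonics (k - 1)" unfolding q_def by (rule d_iso_harmonics[OF p])
  then have q': "Euler X q = 0" "Euler Y q = 0" "Euler Z q = of_int (k - 1) * q"
    by (auto simp: harmonics_iff)
  have dq: "d_iso Z q = 0" using dd by (simp add: q_def)
  have "raise j q = 0" if "j \<in> perp" for j
    using raise_d_iso[of Z j p] inv that by (simp add: q_def)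
  then have pd: "pd (Z j) q = 0" if "j \<in> perp" for j
    using pd_perp_eq_0[OF q'(1,2) _ dq] that by blast
  have E: "vdotD_perp Z Z q = 0" unfolding vdotD_perp_def by (rule sum.neutral) (simp add: pd)
  have L: "2 * (of_int (k - 1) * q) = iso_coord Z * d_coiso Z q"
    using vdotD_split[of Z Z q] by (simp only: E dq q'(3)) simp
  have "2 * (DdotD_perp Z Z p + d_coiso Z q) = 0"
    using DdotD_split[of Z Z p] by (simp add: p'(3) d_commute q_def algebra_simps)
  then have "DdotD_perp Z Z p + d_coiso Z q = 0"
    using cpoly_char_0[of 2 "DdotD_perp Z Z p + d_coiso Z q"] by simp
  then have D: "DdotD_perp Z Z p = - d_coiso Z q" by (simp add: eq_neg_iff_add_eq_0)
  have "iso_coord Z * DdotD_perp Z Z p = of_nat (card perp) * q"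
    using raise_invariant_identity[OF inv] d_eq_0_if_Euler_eq_0[of X p] d_eq_0_if_Euler_eq_0[of Y p] p' E
    by (simp add: q_def vdotD_perp_def)
  then have M: "of_nat (card perp) * q = - (iso_coord Z * d_coiso Z q)" unfolding D by simp
  have *: "2 * (of_int (k - 1) * q) + of_nat (card perp) * q = 0"
    unfolding L M by simp
  show ?thesis
  proof (cases "k \<ge> 1")
    case True
    then have "of_nat (2 * nat (k - 1) + card perp) * q = 2 * (of_int (k - 1) * q) + of_nat (card perp) * q"
      by (simp add: algebra_simps)
    then have "of_nat (2 * nat (k - 1) + card perp) * q = 0" unfolding * .
    moreover have "card perp \<noteq> 0" using perp by (simp add: card_eq_0_iff)
    ultimately show ?thesis unfolding cpoly_char_0 q_def by simp
  next
    case False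
    then show ?thesis using q harmonics_neg[of "k - 1"] by (auto simp: q_def)
  qed
qed

text \<open>\<open>d_iso Z\<close> is nilpotent on \<open>p\<close> and preserves the hypotheses, so
  induction on the number of iterates reduces to the case in which the second iterate
  vanishes.\<close>

lemma d_iso_raise_invariant_harmonic:
  assumes "p \<in> harmonics k" "\<And>j. j \<in> perp \<Longrightarrow> raise j p = 0" "perp \<noteq> {}"
  shows "d_iso Z p = 0"
proof -
  obtain n where "(d_iso Z ^^ n) p = 0" using d_iso_locally_nilpotent[of Z p] by auto
  then show ?thesis
    using assms(1,2)
  proof (induction n arbitrary: p k)
    case 0
    then show ?case by simp
  next
    case (Suc n)
    have "d_iso Z p \<in> harmonics (k - 1)" by (rule d_iso_harmonics[OF Suc.prems(2)])
    moreover have "raise j (d_iso Z p) = 0" if "j \<in> perp" for j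
      using raise_d_iso[of Z j p] Suc.prems(3) that by simp
    moreover have "(d_iso Z ^^ n) (d_iso Z p) = 0" using Suc.prems(1) by (simp add: funpow_swap1)
    ultimately have "d_iso Z (d_iso Z p) = 0" using Suc.IH by blast
    then show ?case using raise_invariant_harmonic_step Suc.prems(2,3) assms(3) by blast
  qed
qed

text \<open>In degree n the Euler equation becomes
  \<open>2 * n * p = iso_coord Z * d_coiso Z p\<close>, and \<open>d_coiso Z p\<close> satisfies the
  same hypotheses in degree n - 1.\<close>

lemma raise_invariant_harmonic_aux:
  assumes "Euler X p = 0" "Euler Y p = 0" "Euler Z p = of_nat n * p" "d_iso Z p = 0"
    "\<And>j. j \<in> perp \<Longrightarrow> pd (Z j) p = 0"
  shows "\<exists>c. p = cst c * iso_coord Z ^ n"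
  using assms
proof (induction n arbitrary: p)
  case 0
  then have E: "Euler Z p = 0" by simp
  have "pd v p = 0" for v
    by (cases v) (simp_all add: pd_eq_0_if_Euler_eq_0 0(1,2) E)
  then show ?case using const_if_pd_eq_0[of p] by auto
next
  case (Suc n)
  define g where "g = d_coiso Z p"
  have "d_coiso Z (of_nat (Suc n) * p) = of_nat (Suc n) * d_coiso Z p"
    using derivation_scale[OF derivation_d_coiso, of Z "of_nat (Suc n)" p] unfolding cst_of_nat .
  then have "Euler Z g = of_nat n * g"
    using d_vdotD(2)[of Z Z Z p] Suc.prems(3) by (simp add: g_def algebra_simps)
  moreover have "Euler X g = 0" "Euler Y g = 0"
    using d_vdotD(2)[of Z X X p] d_vdotD(2)[of Z Y Y p] Suc.prems(1,2) by (simp_all add: g_def)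
  moreover have "d_iso Z g = 0" using d_commute(1)[of Z Z p] Suc.prems(4) by (simp add: g_def)
  moreover have "pd (Z j) g = 0" if "j \<in> perp" for j
    using d_commute(4)[of Z "Z j" p] Suc.prems(5)[OF that] by (simp add: g_def)
  ultimately obtain c where c: "g = cst c * iso_coord Z ^ n" using Suc.IH by blast
  have "vdotD_perp Z Z p = 0" unfolding vdotD_perp_def by (rule sum.neutral) (simp add: Suc.prems(5))
  then have "2 * (of_nat (Suc n) * p) = iso_coord Z * g"
    using vdotD_split[of Z Z p] Suc.prems(3,4) by (simp add: g_def)
  then have "of_nat (2 * Suc n) * p = iso_coord Z * g" by (simp add: algebra_simps)
  then have "cst (1 / of_nat (2 * Suc n)) * (cst (of_nat (2 * Suc n)) * p) = cst (1 / of_nat (2 * Suc n)) * (iso_coord Z * g)"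
    unfolding cst_of_nat by (simp only:)
  moreover have "cst (1 / of_nat (2 * Suc n)) * (cst (of_nat (2 * Suc n)) * p) = p"
    unfolding mult.assoc[symmetric] cst_mult[symmetric] by (simp del: of_nat_Suc of_nat_mult)
  ultimately have "p = cst (1 / of_nat (2 * Suc n) * c) * iso_coord Z ^ Suc n"
    unfolding c cst_mult by (simp add: mult_ac)
  then show ?case by blast
qed

lemma raise_invariant_harmonic:
  assumes "p \<in> harmonics k" "\<And>j. j \<in> perp \<Longrightarrow> raise j p = 0" "perp \<noteq> {}"
  shows "\<exists>c. p = cst c * iso_coord Z ^ nat k"
proof (cases "k < 0")
  case True
  then have "p = 0" using assms(1) harmonics_neg by blast
  then show ?thesis by (intro exI[of _ 0]) simp
next
  case False
  have d: "d_iso Z p = 0" by (rule d_iso_raise_invariant_harmonic[OF assms])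
  have p: "Euler X p = 0" "Euler Y p = 0" "Euler Z p = of_nat (nat k) * p"
    using assms(1) False by (auto simp: harmonics_iff)
  show ?thesis
    by (rule raise_invariant_harmonic_aux[OF p d]) (rule pd_perp_eq_0[OF p(1,2) assms(2) d])
qed

lemma vdotD_iso:
  assumes "u \<in> vecs" "v \<in> vecs" "w \<in> vecs"
  shows "vdotD u v (iso_coord w) = (if v = w then iso_coord u else 0)"
  using assms by (simp add: iso_coord_def vdotD_add vdotD_mult vdotD_mvar)

lemma Laplace_eq_0_if_iso:
  assumes "d_iso Z p = 0" "\<And>j. j \<in> perp \<Longrightarrow> pd (Z j) p = 0"
  shows "Laplace Z p = 0"
proof -
  have "DdotD_perp Z Z p = 0" unfolding DdotD_perp_def by (rule sum.neutral) (simp add: assms(2))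
  then have "of_nat 2 * Laplace Z p = 0"
    using DdotD_split[of Z Z p] assms(1) by (simp add: d_commute(1)[symmetric])
  then show ?thesis unfolding cpoly_char_0 by simp
qed

lemma Euler_iso_power:
  "Euler X (iso_coord Z ^ k) = 0" "Euler Y (iso_coord Z ^ k) = 0" "Euler Z (iso_coord Z ^ k) = of_nat k * iso_coord Z ^ k"
proof -
  show "Euler X (iso_coord Z ^ k) = 0" "Euler Y (iso_coord Z ^ k) = 0"
    by (simp_all add: derivation_power_eq_0[OF derivation_vdotD] vdotD_iso)
  show "Euler Z (iso_coord Z ^ k) = of_nat k * iso_coord Z ^ k"
    by (cases k) (simp_all only: derivation_power[OF derivation_vdotD], simp_all add: vdotD_iso mult.commute)
qed

lemma d_iso_power: "d_iso Z (iso_coord Z ^ k) = 0" "j \<in> perp \<Longrightarrow> pd (Z j) (iso_coord Z ^ k) = 0"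
  by (simp_all add: derivation_power_eq_0[OF derivation_d_iso] derivation_power_eq_0[OF derivation_pd] d_iso_iso
      pd_iso perpD)

lemma iso_power_harmonics: "iso_coord Z ^ k \<in> harmonics (int k)"
  using Laplace_eq_0_if_iso[OF d_iso_power] by (simp add: harmonics_iff Euler_iso_power)

lemma iso_power_nonzero: "iso_coord Z ^ k \<noteq> 0"
  using iso_power_regular[of Z k 1] by auto

lemma so_irreducible_harmonics:
  assumes "k \<ge> 0" "perp \<noteq> {}"
  shows "so_irreducible (harmonics k :: 'n cpoly set)"
  unfolding so_irreducible_def
proof (intro conjI allI impI so_submodule_harmonics)
  show "harmonics k \<noteq> ({0} :: 'n cpoly set)"
    using iso_power_harmonics[of "nat k"] iso_power_nonzero[of "nat k"] assms(1) by auto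
  show "U = {0} \<or> U = harmonics k" if U: "so_submodule U \<and> U \<subseteq> harmonics k" for U :: "'n cpoly set"
  proof (rule ccontr)
    assume neg: "\<not> ?thesis"
    have bound: "Poly_Mapping.lookup \<mu> v \<le> nat k" if "p \<in> harmonics k" "\<mu> \<in> Poly_Mapping.keys p"
      for p :: "'n cpoly" and \<mu> v
    proof -
      have "Euler X p = of_int 0 * p" "Euler Y p = of_int 0 * p" "Euler Z p = of_int k * p"
        using that(1) by (auto simp: harmonics_iff)
      note le = lookup_le_if_Euler[OF this(1) that(2)] lookup_le_if_Euler[OF this(2) that(2)]
        lookup_le_if_Euler[OF this(3) that(2)]
      show ?thesis by (cases v) (use le in simp_all)
    qed
    obtain W where W: "so_submodule W" "W \<subseteq> harmonics k" "W \<noteq> {0}" "U \<inter> W = {0}"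
    proof (rule orthogonal_complement[OF so_submodule_harmonics])
      show "so_submodule U" "U \<subseteq> harmonics k" "U \<noteq> harmonics k" using U neg by auto
      show "Poly_Mapping.lookup \<mu> v \<le> nat k" if "p \<in> harmonics k" "\<mu> \<in> Poly_Mapping.keys p"
        for p :: "'n cpoly" and \<mu> v by (rule bound[OF that])
    qed
    obtain p where p: "p \<in> U" "p \<noteq> 0" "\<And>j. j \<in> perp \<Longrightarrow> raise j p = 0"
      using raise_invariant_exists U neg by blast
    obtain q where q: "q \<in> W" "q \<noteq> 0" "\<And>j. j \<in> perp \<Longrightarrow> raise j q = 0"
      using raise_invariant_exists[OF W(1,3)] by blast
    obtain c where c: "p = cst c * iso_coord Z ^ nat k"
      using raise_invariant_harmonic[of p k] p U assms(2) by blast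
    obtain d where d: "q = cst d * iso_coord Z ^ nat k"
      using raise_invariant_harmonic[of q k] q W assms(2) by blast
    have sub: "cpoly.subspace U" "cpoly.subspace W"
      using U W(1) by (simp_all add: so_submodule_def)
    \<comment> \<open>The two multiples are the same polynomial, which therefore lies in
      \<open>U \<inter> W = {0}\<close>.\<close>
    have "cst d * p \<in> U" "cst c * q \<in> W"
      using subspace_scale[OF sub(1) p(1)] subspace_scale[OF sub(2) q(1)] by blast+
    moreover have "cst d * p = cst c * q" by (simp add: c d mult_ac)
    ultimately have "cst d * p \<in> U \<inter> W" by simp
    then have "cst d * p = 0" unfolding W(4) by simp
    then have "d = 0" using p(2) by simp
    then show False using q(2) d by simp
  qed
qed

end

section \<open>Annihilated vectors in the linear and simplicial harmonics\<close>

lemma pd_linear_harmonics: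
  assumes "u = X \<or> u = Y" "p \<in> linear_harmonics u k"
  shows "pd (u i) p \<in> harmonics k" and "pd (u j) (pd (u i) p) = 0"
proof -
  have u: "u \<in> vecs" using assms(1) by auto
  show 1: "pd (u i) p \<in> harmonics k"
    using assms pd_vdotD[of u X i X p] pd_vdotD[of u Y i Y p] pd_vdotD[of u Z i Z p] pd_DdotD[of "u i" Z Z p]
    by (elim disjE) (simp_all add: linear_harmonics_X linear_harmonics_Y harmonics_iff pd_mult)
  then have "Euler u (pd (u i) p) = 0" using assms(1) by (auto simp: harmonics_iff)
  then show "pd (u j) (pd (u i) p) = 0" by (rule pd_eq_0_if_Euler_eq_0[OF u])
qed

context isotropic_plane
begin

lemma d_iso_linear_harmonics:
  assumes "u = X \<or> u = Y" "p \<in> linear_harmonics u k"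
  shows "d_iso u p \<in> harmonics k" "d_coiso u p \<in> harmonics k"
  using pd_linear_harmonics(1)[OF assms] subspace_harmonics[of k]
  unfolding d_iso_def d_coiso_def
  by (auto intro!: subspace_add subspace_diff subspace_scale)

lemma raise_linear_harmonics:
  assumes "u = X \<or> u = Y" "p \<in> linear_harmonics u k"
  shows "raise j p = (iso_coord u * pd (u j) p - mvar (u j) * d_iso u p) + (iso_coord Z * pd (Z j) p - mvar (Z j) * d_iso Z p)"
  using assms d_eq_0_if_Euler_eq_0[of X p] d_eq_0_if_Euler_eq_0[of Y p]
    pd_eq_0_if_Euler_eq_0[of X p] pd_eq_0_if_Euler_eq_0[of Y p]
  by (elim disjE) (simp_all add: linear_harmonics_X linear_harmonics_Y raise_eq)

lemma raise_invariant_identity_linear: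
  assumes "u = X \<or> u = Y" "p \<in> linear_harmonics u k" "\<And>j. j \<in> perp \<Longrightarrow> raise j p = 0"
  shows "(iso_coord u * DdotD_perp Z u p - vdotD_perp u Z (d_iso u p))
     + (iso_coord Z * DdotD_perp Z Z p - vdotD_perp Z Z (d_iso Z p)) = of_nat (card perp) * d_iso Z p"
proof -
  have "vdotD_perp v Z 0 = 0" for v by (simp add: vdotD_perp_def)
  then show ?thesis
    using assms(1,2) raise_invariant_identity[OF assms(3)] d_eq_0_if_Euler_eq_0[of X p] d_eq_0_if_Euler_eq_0[of Y p]
    by (elim disjE) (simp_all add: linear_harmonics_X linear_harmonics_Y)
qed

lemma d_iso_Z_linear_harmonics:
  assumes "u = X \<or> u = Y" "p \<in> linear_harmonics u k"
  shows "d_iso Z p \<in> linear_harmonics u (k - 1)"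
proof -
  have "d_iso Z (of_int k * p) = of_int k * d_iso Z p"
    using derivation_scale[OF derivation_d_iso, of Z "of_int k" p] by simp
  then show ?thesis
    using assms d_vdotD(1)[of Z X X p] d_vdotD(1)[of Z Y Y p] d_vdotD(1)[of Z Z Z p] d_DdotD[of Z Z Z p]
    by (elim disjE) (simp_all add: linear_harmonics_X linear_harmonics_Y left_diff_distrib eq_diff_eq)
qed

lemma raise_invariant_pd:
  assumes "u \<in> vecs" "\<And>j. j \<in> perp \<Longrightarrow> raise j p = 0" "d_iso u p = 0" "i \<in> perp" "j \<in> perp"
  shows "raise j (pd (u i) p) = 0"
  using pd_raise[OF assms(1,5,4), of p] assms by (simp split: if_splits)

lemma vdotD_perp_eq_0: "(\<And>j. j \<in> perp \<Longrightarrow> pd (v j) p = 0) \<Longrightarrow> vdotD_perp u v p = 0"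
  by (simp add: vdotD_perp_def)

text \<open>Twice the divergence identity is rewritten with the isotropic splittings of
  \<open>Laplace Z p = 0\<close>, of \<open>DdotD Z u p = 0\<close> and of the Euler equations in z
  and u for \<open>q = d_iso Z p\<close>. With N the cardinality of \<open>perp\<close>, the
  coefficient of q becomes 2 N + 4 (k - 1) + 2, and on the other side only the \<open>perp\<close>
  parts of the two Euler operators remain; these are then shown to vanish.\<close>

lemma raise_invariant_linear_step:
  assumes u: "u = X \<or> u = Y" and p: "p \<in> linear_harmonics u k" "DdotD Z u p = 0"
    and inv: "\<And>j. j \<in> perp \<Longrightarrow> raise j p = 0"
    and dd: "d_iso Z (d_iso Z p) = 0" and perp: "perp \<noteq> {}" and k: "k \<ge> 1"
  shows "of_nat (2 * card perp + 4 * nat k - 2) * d_iso Z p + iso_coord u * d_coiso Z (d_iso u p) = 0"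
proof -
  have uv: "u \<in> vecs" "u \<noteq> Z" "Z \<noteq> u" using u by auto
  have N: "0 < card perp" using perp by (simp add: card_gt_0_iff)
  have k1: "1 \<le> nat k" using k by simp
  define q where "q = d_iso Z p"
  have q: "q \<in> linear_harmonics u (k - 1)" unfolding q_def by (rule d_iso_Z_linear_harmonics[OF u p(1)])
  have q': "Euler u q = q" "Euler Z q = of_int (k - 1) * q" using q by (auto simp: linear_harmonics_def)
  have raise_dp: "raise j (d_iso u p) = 0" if "j \<in> perp" for j
    using raise_d_iso[OF uv(1) that, of p] inv[OF that] by simp
  obtain c where c: "d_iso u p = cst c * iso_coord Z ^ nat k"
    using raise_invariant_harmonic[OF d_iso_linear_harmonics(1)[OF u p(1)] raise_dp perp] by blast
  define h where "h = d_coiso Z (d_iso u p)"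
  have pdd: "pd (Z j) (d_iso u p) = 0" if "j \<in> perp" for j
    using that unfolding c by (simp add: pd_mult d_iso_power)
  have duq: "d_iso u q = 0"
    using d_commute(2)[of u Z p] unfolding c
    by (simp add: q_def d_iso_simps d_iso_power)
  have dZq: "d_iso Z q = 0" using dd by (simp add: q_def)
  have raise_q: "raise j q = 0" if "j \<in> perp" for j
    using raise_d_iso[of Z j p] inv that by (simp add: q_def)
  have eq1: "iso_coord u * DdotD_perp Z u p + (iso_coord Z * DdotD_perp Z Z p - vdotD_perp Z Z q) = of_nat (card perp) * q"
    using raise_invariant_identity_linear[OF u p(1) inv] vdotD_perp_eq_0[OF pdd, where u = u] by (simp add: q_def)
  have eq2: "2 * DdotD_perp Z Z p = - (2 * d_coiso Z q)"
    using DdotD_split[of Z Z p] p(1)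
    by (simp add: linear_harmonics_def d_commute q_def eq_neg_iff_add_eq_0 add.assoc)
  have eq3: "2 * DdotD_perp Z u p = - d_coiso u q - h"
    using DdotD_split[of Z u p] p(2)
    by (simp add: d_commute q_def h_def eq_diff_eq eq_neg_iff_add_eq_0 add_ac)
  have eq4: "iso_coord Z * d_coiso Z q = 2 * (of_int (k - 1) * q) - 2 * vdotD_perp Z Z q"
    using vdotD_split[of Z Z q] unfolding q'(2) by (simp add: dZq)
  have eq5: "iso_coord u * d_coiso u q = 2 * q - 2 * vdotD_perp u u q"
    using vdotD_split[of u u q] unfolding q'(1) by (simp add: duq)
  have "2 * (of_nat (card perp) * q) = iso_coord u * (2 * DdotD_perp Z u p) + (iso_coord Z * (2 * DdotD_perp Z Z p) - 2 * vdotD_perp Z Z q)"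
    unfolding eq1[symmetric] by (simp add: algebra_simps)
  also have "\<dots> = - (iso_coord u * d_coiso u q) - iso_coord u * h - 2 * (iso_coord Z * d_coiso Z q) - 2 * vdotD_perp Z Z q"
    unfolding eq2 eq3 by (simp add: algebra_simps)
  also have "\<dots> = - (2 * q) + 2 * vdotD_perp u u q - iso_coord u * h - 4 * (of_int (k - 1) * q) + 2 * vdotD_perp Z Z q"
    unfolding eq4 eq5 by (simp add: algebra_simps)
  finally have main: "of_nat (2 * card perp + 4 * nat k - 2) * q + iso_coord u * h =
      2 * vdotD_perp u u q + 2 * vdotD_perp Z Z q"
  proof -
    assume *: "2 * (of_nat (card perp) * q) =
      - (2 * q) + 2 * vdotD_perp u u q - iso_coord u * h - 4 * (of_int (k - 1) * q) + 2 * vdotD_perp Z Z q"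
    have E: "of_nat (2 * card perp + 4 * nat k - 2) = (of_int (2 * int (card perp) + 4 * (k - 1) + 2) :: 'n cpoly)"
    proof -
      have "int (2 * card perp + 4 * nat k - 2) = 2 * int (card perp) + 4 * (k - 1) + 2" using k by simp
      then show ?thesis by (metis of_int_of_nat_eq)
    qed
    have "of_nat (2 * card perp + 4 * nat k - 2) * q = 2 * (of_nat (card perp) * q) + 4 * (of_int (k - 1) * q) + 2 * q"
      unfolding E by (simp add: algebra_simps)
    then show ?thesis unfolding * by simp
  qed
  \<comment> \<open>This derivative is a multiple of a power of \<open>iso_coord Z\<close>.
    Differentiating \<open>main\<close> by u_j gives (2 N + 4 k - 2) qj = 2 qj, and 2 N + 4 k - 4 is
    positive.\<close>
  have pdq: "pd (u j) q = 0" if j: "j \<in> perp" for j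
  proof -
    define qj where "qj = pd (u j) q"
    have qj: "qj \<in> harmonics (k - 1)" unfolding qj_def by (rule pd_linear_harmonics(1)[OF u q])
    have "raise i qj = 0" if "i \<in> perp" for i
      unfolding qj_def by (rule raise_invariant_pd[OF uv(1) raise_q duq j that])
    then obtain d where d: "qj = cst d * iso_coord Z ^ nat (k - 1)"
      using raise_invariant_harmonic[OF qj _ perp] by blast
    have "pd (u j) (vdotD_perp u u q) = qj"
    proof -
      have "pd (u j) (vdotD_perp u u q) = (\<Sum>i\<in>perp. if j = i then pd (u i) q else 0)"
        unfolding vdotD_perp_def pd_sum
        by (intro sum.cong refl) (simp add: pd_mult pd_mvar_vec uv pd_linear_harmonics(2)[OF u q])
      then show ?thesis using j by (simp add: qj_def)
    qed
    moreover have "pd (u j) (vdotD_perp Z Z q) = 0"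
    proof -
      have "pd (u j) (vdotD_perp Z Z q) = (\<Sum>i\<in>perp. mvar (Z i) * pd (Z i) qj)"
        unfolding vdotD_perp_def pd_sum
        by (intro sum.cong refl) (simp add: pd_mult pd_mvar_vec uv qj_def pd_commute[of "u j"])
      then show ?thesis by (simp add: d pd_mult d_iso_power)
    qed
    moreover have "pd (u j) (iso_coord u * h) = 0"
    proof -
      have "pd (u j) (iso_coord Z ^ nat k) = 0"
        by (rule derivation_power_eq_0[OF derivation_pd]) (use uv in \<open>simp add: pd_iso\<close>)
      then have "pd (u j) h = 0"
        unfolding h_def c d_commute(4)[symmetric] by (simp add: pd_mult)
      then show ?thesis using uv perpD[OF j] by (simp add: pd_mult pd_iso)
    qed
    moreover have "pd (u j) (of_nat (2 * card perp + 4 * nat k - 2) * q + iso_coord u * h)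
      = of_nat (2 * card perp + 4 * nat k - 2) * qj + pd (u j) (iso_coord u * h)"
      by (simp only: pd_add pd_mult pd_of_nat qj_def) simp
    moreover have "pd (u j) (2 * vdotD_perp u u q + 2 * vdotD_perp Z Z q) =
      2 * pd (u j) (vdotD_perp u u q) + 2 * pd (u j) (vdotD_perp Z Z q)"
      by (simp add: pd_add pd_mult)
    ultimately have "of_nat (2 * card perp + 4 * nat k - 2) * qj = 2 * qj"
      unfolding main by simp
    moreover have "of_nat (2 * card perp + 4 * nat k - 2) = (of_nat (2 * card perp + 4 * nat k - 4) + 2 :: 'n cpoly)"
    proof -
      have "2 * card perp + 4 * nat k - 2 = (2 * card perp + 4 * nat k - 4) + 2" using N k1 by linarith
      then show ?thesis by (metis of_nat_add of_nat_numeral)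
    qed
    ultimately have "of_nat (2 * card perp + 4 * nat k - 4) * qj = 0" by (simp add: distrib_right)
    moreover have "2 * card perp + 4 * nat k - 4 \<noteq> 0" using N k1 by linarith
    ultimately show ?thesis unfolding cpoly_char_0 qj_def by simp
  qed
  \<comment> \<open>With the u-derivatives gone, cancelling \<open>iso_coord Z\<close> in
    \<open>raise j q = 0\<close> removes the z-derivatives.\<close>
  have "pd (Z j) q = 0" if "j \<in> perp" for j
    using raise_linear_harmonics[OF u q, of j] raise_q[OF that] pdq[OF that] duq dZq iso_regular[of Z]
    by simp
  then have "vdotD_perp u u q = 0" "vdotD_perp Z Z q = 0" using pdq by (auto intro: vdotD_perp_eq_0)
  then show ?thesis using main by (simp add: q_def h_def)
qed

text \<open>The assumption \<open>d_iso u p = 0\<close> removes the extra term of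
  \<open>raise_invariant_linear_step\<close>. \<open>d_iso Z\<close> preserves all hypotheses, so
  induction on the number of iterates supplies \<open>d_iso Z (d_iso Z p) = 0\<close>.\<close>

lemma raise_invariant_linear_aux:
  assumes u: "u = X \<or> u = Y" and perp: "perp \<noteq> {}"
    and "p \<in> linear_harmonics u k" "DdotD Z u p = 0" "\<And>j. j \<in> perp \<Longrightarrow> raise j p = 0" "d_iso u p = 0"
  shows "d_iso Z p = 0"
proof -
  obtain n where "(d_iso Z ^^ n) p = 0" using d_iso_locally_nilpotent[of Z p] by auto
  then show ?thesis
    using assms(3-)
  proof (induction n arbitrary: p k)
    case 0
    then show ?case by simp
  next
    case (Suc n)
    have uv: "u \<in> vecs" using u by auto
    have 1: "d_iso Z p \<in> linear_harmonics u (k - 1)" by (rule d_iso_Z_linear_harmonics[OF u Suc.prems(2)])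
    have "DdotD Z u (d_iso Z p) = 0" using d_DdotD[of Z Z u p] Suc.prems(3) by simp
    moreover have "raise j (d_iso Z p) = 0" if "j \<in> perp" for j
      using raise_d_iso[of Z j p] Suc.prems(4) that by simp
    moreover have "d_iso u (d_iso Z p) = 0" using d_commute(2)[of u Z p] Suc.prems(5) by simp
    moreover have "(d_iso Z ^^ n) (d_iso Z p) = 0" using Suc.prems(1) by (simp add: funpow_swap1)
    ultimately have dd: "d_iso Z (d_iso Z p) = 0" using Suc.IH 1 by blast
    show ?case
    proof (cases "k \<ge> 1")
      case True
      have "of_nat (2 * card perp + 4 * nat k - 2) * d_iso Z p = 0"
        using raise_invariant_linear_step[OF u Suc.prems(2,3,4) dd perp True] Suc.prems(5) by simp
      moreover have "card perp \<noteq> 0" using perp by (simp add: card_eq_0_iff)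
      then have "2 * card perp + 4 * nat k - 2 \<noteq> 0" using True by simp
      ultimately show ?thesis unfolding cpoly_char_0 by simp
    next
      case False
      then show ?thesis using 1 linear_harmonics_neg[of "k - 1" u] by simp
    qed
  qed
qed

text \<open>\<open>raise_invariant_linear_aux\<close> would assume the conclusion for
  \<open>p\<close>, but it applies to \<open>q = d_iso Z p\<close>: since \<open>d_iso u p\<close>
  is a multiple of a power of \<open>iso_coord Z\<close>, it follows that
  \<open>d_iso u q = 0\<close>. The resulting \<open>d_iso Z q = 0\<close> is what
  \<open>raise_invariant_linear_step\<close> requires.\<close>

lemma raise_invariant_simplicial:
  assumes u: "u = X \<or> u = Y" and perp: "perp \<noteq> {}" and k: "k \<ge> 1"
    and p: "p \<in> linear_harmonics u k" "DdotD Z u p = 0" "vdotD Z u p = 0"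
    and inv: "\<And>j. j \<in> perp \<Longrightarrow> raise j p = 0"
  shows "d_iso u p = 0"
proof -
  have uv: "u \<in> vecs" "u \<noteq> Z" "Z \<noteq> u" using u by auto
  have N: "0 < card perp" using perp by (simp add: card_gt_0_iff)
  have k1: "1 \<le> nat k" using k by simp
  have raise_dp: "raise j (d_iso u p) = 0" if "j \<in> perp" for j
    using raise_d_iso[OF uv(1) that, of p] inv[OF that] by simp
  obtain c where c: "d_iso u p = cst c * iso_coord Z ^ nat k"
    using raise_invariant_harmonic[OF d_iso_linear_harmonics(1)[OF u p(1)] raise_dp perp] by blast
  define q where "q = d_iso Z p"
  have "d_iso Z q = 0" unfolding q_def
  proof (rule raise_invariant_linear_aux[OF u perp d_iso_Z_linear_harmonics[OF u p(1)]])
    show "DdotD Z u (d_iso Z p) = 0" using d_DdotD[of Z Z u p] p(2) by simp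
    show "raise j (d_iso Z p) = 0" if "j \<in> perp" for j
      using raise_d_iso[of Z j p] inv that by simp
    show "d_iso u (d_iso Z p) = 0"
      using d_commute(2)[of u Z p] unfolding c by (simp add: d_iso_simps d_iso_power)
  qed
  then have step: "of_nat (2 * card perp + 4 * nat k - 2) * q + iso_coord u * d_coiso Z (d_iso u p) = 0"
    using raise_invariant_linear_step[OF u p(1,2) inv _ perp k] by (simp add: q_def)
  obtain n where n: "nat k = Suc n" using k by (metis Suc_le_D nat_le_iff nat_mono nat_one_as_int One_nat_def)
  have h: "d_coiso Z (d_iso u p) = cst c * (2 * (of_nat (nat k) * iso_coord Z ^ n))"
    unfolding c n by (simp only: d_coiso_simps derivation_power[OF derivation_d_coiso] d_coiso_iso vecs_simps)
      (simp add: algebra_simps)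
  have "vdotD Z u q + d_iso u p = 0"
    using d_vdotD(1)[of Z Z u p] p(3) by (simp add: q_def)
  then have vq: "vdotD Z u q = - d_iso u p" by (simp add: eq_neg_iff_add_eq_0)
  have vh: "vdotD Z u (d_coiso Z (d_iso u p)) = 0"
    unfolding h using uv
    by (simp add: vdotD_mult derivation_power_eq_0[OF derivation_vdotD] vdotD_iso)
  \<comment> \<open>Applying \<open>vdotD Z u\<close> to the equation \<open>step\<close> yields two different multiples of \<open>d_iso u p\<close>.\<close>
  have "0 = vdotD Z u (of_nat (2 * card perp + 4 * nat k - 2) * q + iso_coord u * d_coiso Z (d_iso u p))"
    unfolding step by simp
  also have "\<dots> = of_nat (2 * card perp + 4 * nat k - 2) * vdotD Z u q + iso_coord Z * d_coiso Z (d_iso u p)"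
    using uv by (simp only: vdotD_add vdotD_mult vh vdotD_of_nat vdotD_iso vecs_simps) simp
  also have "iso_coord Z * d_coiso Z (d_iso u p) = of_nat (2 * nat k) * d_iso u p"
    by (subst h) (simp add: c n algebra_simps)
  finally have "of_nat (2 * card perp + 4 * nat k - 2) * d_iso u p = of_nat (2 * nat k) * d_iso u p"
    by (simp add: vq)
  moreover have "2 * card perp + 4 * nat k - 2 = (2 * card perp + 2 * nat k - 2) + 2 * nat k" using N by linarith
  ultimately have "of_nat (2 * card perp + 2 * nat k - 2) * d_iso u p = 0"
    by (simp only: of_nat_add distrib_right add_cancel_left_left)
  moreover have "2 * card perp + 2 * nat k - 2 \<noteq> 0" using N k1 by linarith
  ultimately show ?thesis unfolding cpoly_char_0 by simp
qed

text \<open>Here \<open>p\<close> is half of \<open>iso_coord u * g\<close> with g free of u, so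
  \<open>vdotD Z u p = 0\<close> becomes \<open>iso_coord Z * g = 0\<close>.\<close>

lemma raise_invariant_simplicial_eq_0:
  assumes u: "u = X \<or> u = Y"
    and p: "p \<in> linear_harmonics u k" "vdotD Z u p = 0" "d_iso u p = 0"
    and pd: "\<And>j. j \<in> perp \<Longrightarrow> pd (u j) p = 0"
  shows "p = 0"
proof -
  have uv: "u \<in> vecs" "u \<noteq> Z" "Z \<noteq> u" using u by auto
  define g where "g = d_coiso u p"
  have "2 * Euler u p = iso_coord u * g"
    using vdotD_split[of u u p] vdotD_perp_eq_0[OF pd] p(3) by (simp add: g_def)
  then have ig: "2 * p = iso_coord u * g" using p(1) by (simp add: linear_harmonics_def)
  have "g \<in> harmonics k" unfolding g_def by (rule d_iso_linear_harmonics(2)[OF u p(1)])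
  then have "vdotD Z u g = 0" using harmonics_D[OF u] by blast
  moreover have "vdotD Z u (2 * p) = 0" using p(2) by (simp add: vdotD_mult)
  ultimately have "iso_coord Z * g = 0" unfolding ig using uv by (simp add: vdotD_mult vdotD_iso)
  then have "g = 0" using iso_regular[of Z g] by simp
  then have "of_nat 2 * p = 0" using ig by simp
  then show ?thesis unfolding cpoly_char_0 by simp
qed

end

section \<open>The vector representation of so(perp) and irreducibility\<close>

context isotropic_plane
begin

lemma pd_rot:
  assumes "u \<in> vecs"
  shows "pd (u l) (rot i j p) =
    rot i j (pd (u l) p) + ((if l = i then pd (u j) p else 0) - (if l = j then pd (u i) p else 0))"
  using gl_act_pd[OF assms, of i j l p] gl_act_pd[OF assms, of j i l p]
  by (auto simp: rot_def pd_diff)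

lemma rot_iso_power:
  assumes "i \<in> perp" "j \<in> perp"
  shows "rot i j (cst c * iso_coord Z ^ n) = 0"
proof -
  have "rot i j (iso_coord Z) = 0"
    using perpD[OF assms(1)] perpD[OF assms(2)]
    by (simp add: iso_coord_def derivation_add[OF derivation_rot] derivation_scale[OF derivation_rot] rot_mvar)
  then show ?thesis
    by (simp add: derivation_scale[OF derivation_rot] derivation_power_eq_0[OF derivation_rot])
qed

text \<open>Thus an annihilated vector has scalar coordinates indexed by \<open>perp\<close>; by the
  next lemma they determine it.\<close>

lemma raise_invariant_simplicial_pd:
  assumes u: "u = X \<or> u = Y" and perp: "perp \<noteq> {}" and k: "k \<ge> 1"
    and p: "p \<in> simplicial_harmonics u k 1" and inv: "\<And>j. j \<in> perp \<Longrightarrow> raise j p = 0"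
    and i: "i \<in> perp"
  obtains c where "pd (u i) p = cst c * iso_coord Z ^ nat k"
proof -
  have uv: "u \<in> vecs" using u by auto
  have p': "p \<in> linear_harmonics u k" "DdotD Z u p = 0" "vdotD Z u p = 0"
    using p unfolding simplicial_harmonics_1[OF u] by auto
  have d: "d_iso u p = 0" by (rule raise_invariant_simplicial[OF u perp k p' inv])
  have "raise j (pd (u i) p) = 0" if "j \<in> perp" for j
    by (rule raise_invariant_pd[OF uv inv d i that])
  then show ?thesis
    using raise_invariant_harmonic[OF pd_linear_harmonics(1)[OF u p'(1)] _ perp] that by blast
qed

lemma raise_invariant_simplicial_nonzero:
  assumes u: "u = X \<or> u = Y" and perp: "perp \<noteq> {}" and k: "k \<ge> 1"
    and p: "p \<in> simplicial_harmonics u k 1" "\<And>j. j \<in> perp \<Longrightarrow> raise j p = 0"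
    and pd: "\<And>j. j \<in> perp \<Longrightarrow> pd (u j) p = 0"
  shows "p = 0"
proof -
  have p': "p \<in> linear_harmonics u k" "DdotD Z u p = 0" "vdotD Z u p = 0"
    using p unfolding simplicial_harmonics_1[OF u] by auto
  show ?thesis
    by (rule raise_invariant_simplicial_eq_0[OF u p'(1,3) raise_invariant_simplicial[OF u perp k p' p(2)] pd])
qed

text \<open>The coefficients \<open>pd (u l) p\<close> are multiples of a power of
  \<open>iso_coord Z\<close>, which rotations within \<open>perp\<close> annihilate; only the
  commutator of \<open>pd (u l)\<close> with \<open>rot i j\<close> remains.\<close>

lemma rot_raise_invariant:
  assumes u: "u = X \<or> u = Y" and perp: "perp \<noteq> {}" and k: "k \<ge> 1"
    and p: "p \<in> simplicial_harmonics u k 1" and inv: "\<And>j. j \<in> perp \<Longrightarrow> raise j p = 0"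
    and ij: "i \<in> perp" "j \<in> perp" "i \<noteq> j" and l: "l \<in> perp"
  shows "raise l (rot i j p) = 0"
    and "pd (u l) (rot i j p) = (if l = i then pd (u j) p else 0) - (if l = j then pd (u i) p else 0)"
proof -
  show "raise l (rot i j p) = 0"
    using raise_rot[OF ij(1,2) l ij(3), of p] inv ij l by simp
  obtain c where "pd (u l) p = cst c * iso_coord Z ^ nat k"
    using raise_invariant_simplicial_pd[OF u perp k p inv l] by blast
  then have "rot i j (pd (u l) p) = 0" using rot_iso_power[OF ij(1,2)] by simp
  then show "pd (u l) (rot i j p) = (if l = i then pd (u j) p else 0) - (if l = j then pd (u i) p else 0)"
    using pd_rot[of u l i j p] u by auto
qed

text \<open>On these vectors \<open>rot i j\<close> acts through the coefficients \<open>pd (u l) p\<close> as on the vector representation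
  of \<open>so(perp)\<close>, so they can be moved to a prescribed coordinate \<open>t\<close>.\<close>

lemma raise_invariant_concentrated:
  assumes u: "u = X \<or> u = Y" and perp: "card perp \<ge> 3" and k: "k \<ge> 1"
    and U: "so_submodule U" "U \<subseteq> simplicial_harmonics u k 1" "U \<noteq> {0}" and t: "t \<in> perp"
  obtains p where "p \<in> U" "\<And>j. j \<in> perp \<Longrightarrow> raise j p = 0" "pd (u t) p \<noteq> 0"
    "\<And>l. l \<in> perp \<Longrightarrow> l \<noteq> t \<Longrightarrow> pd (u l) p = 0"
proof -
  have ne: "perp \<noteq> {}" using t by blast
  have fin: "finite perp" by (simp add: perp_def)
  have avoid: "\<exists>b\<in>perp. b \<noteq> x \<and> b \<noteq> y" for x y
  proof -
    have "card {x, y} \<le> 2" by (simp add: card_insert_if)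
    then have "\<not> perp \<subseteq> {x, y}" using perp card_mono[of "{x, y}" perp] by auto
    then show ?thesis by blast
  qed
  have inV: "q \<in> simplicial_harmonics u k 1" if "q \<in> U" for q using U(2) that by blast
  note R = rot_raise_invariant[OF u ne k inV]
  obtain p where p: "p \<in> U" "p \<noteq> 0" "\<And>j. j \<in> perp \<Longrightarrow> raise j p = 0"
    using raise_invariant_exists[OF U(1,3)] by blast
  obtain a where a: "a \<in> perp" "pd (u a) p \<noteq> 0"
    using raise_invariant_simplicial_nonzero[OF u ne k inV[OF p(1)] p(3)] p(2) by blast
  \<comment> \<open>Arranges a nonzero coefficient away from t; if it sits at t, one rotation moves
    it.\<close>
  have "\<exists>p a. p \<in> U \<and> (\<forall>j\<in>perp. raise j p = 0) \<and> a \<in> perp \<and> a \<noteq> t \<and> pd (u a) p \<noteq> 0"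
  proof (cases "a = t")
    case False
    then show ?thesis using p a by blast
  next
    case True
    obtain b where b: "b \<in> perp" "b \<noteq> t" using avoid[of t t] by blast
    have "pd (u b) (rot b t p) = pd (u t) p" using R(2)[OF p(1,3) b(1) t b(2) b(1)] b(2) by simp
    then have "pd (u b) (rot b t p) \<noteq> 0" using a True by simp
    moreover have "rot b t p \<in> U" by (rule rot_in[OF U(1) p(1)])
    moreover have "\<forall>j\<in>perp. raise j (rot b t p) = 0" using R(1)[OF p(1,3) b(1) t b(2)] by blast
    ultimately show ?thesis using b by blast
  qed
  then obtain p a where p: "p \<in> U" "\<And>j. j \<in> perp \<Longrightarrow> raise j p = 0" and a: "a \<in> perp" "a \<noteq> t" "pd (u a) p \<noteq> 0"
    by blast
  obtain b where b: "b \<in> perp" "b \<noteq> a" "b \<noteq> t" using avoid by blast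
  \<comment> \<open>The only coefficients of \<open>p2\<close> that can be nonzero are the one at b,
    taken over from a, and the one at a.\<close>
  define p2 where "p2 = rot b a p"
  have p2: "p2 \<in> U" "\<And>j. j \<in> perp \<Longrightarrow> raise j p2 = 0"
    unfolding p2_def using rot_in[OF U(1) p(1)] R(1)[OF p b(1) a(1) b(2)] by blast+
  have pd2: "pd (u b) p2 = pd (u a) p" "pd (u t) p2 = 0"
    unfolding p2_def using R(2)[OF p b(1) a(1) b(2)] b a(1,2) t by auto
  have tb: "t \<noteq> b" using b(3) by blast
  \<comment> \<open>This moves the coefficient at b to t, puts the negative of the vanishing
    coefficient at t to b, and clears all others.\<close>
  define p3 where "p3 = rot t b p2"
  have "p3 \<in> U" unfolding p3_def by (rule rot_in[OF U(1) p2(1)])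
  moreover have "raise j p3 = 0" if "j \<in> perp" for j
    unfolding p3_def by (rule R(1)[OF p2 t b(1) tb that])
  moreover have "pd (u t) p3 \<noteq> 0"
    unfolding p3_def using R(2)[OF p2 t b(1) tb t] pd2 a(3) tb by simp
  moreover have "pd (u l) p3 = 0" if "l \<in> perp" "l \<noteq> t" for l
    unfolding p3_def using R(2)[OF p2 t b(1) tb that(1)] that(2) pd2 by simp
  ultimately show ?thesis by (rule that)
qed

lemma simplicial_harmonics_nonzero:
  assumes u: "u = X \<or> u = Y" and k: "k \<ge> 1" and j: "j \<in> perp"
  shows "simplicial_harmonics u k 1 \<noteq> ({0} :: 'n cpoly set)"
proof -
  have uv: "u \<in> vecs" "u \<noteq> Z" "Z \<noteq> u" using u by auto
  obtain n where n: "k = int n + 1" using k by (metis zero_le_imp_eq_int add_diff_cancel_right' diff_ge_0_iff_ge diff_add_cancel)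
  \<comment> \<open>The 2 by 2 minor formed from the isotropic and the j-th coordinates of z and u;
    \<open>vdotD Z u\<close> replaces its u-entries by z-entries and so annihilates it.\<close>
  define s where "s = iso_coord Z * mvar (u j) - mvar (Z j) * iso_coord u"
  define p where "p = iso_coord Z ^ n * s"
  have Es: "Euler v s = (if v = u then s else 0) + (if v = Z then s else 0)" if "v \<in> vecs" for v
    using uv that unfolding s_def by (auto simp: vdotD_diff vdotD_mult vdotD_iso vdotD_mvar)
  have E: "Euler u p = p" "\<And>v. v \<in> vecs \<Longrightarrow> v \<noteq> u \<Longrightarrow> v \<noteq> Z \<Longrightarrow> Euler v p = 0" "Euler Z p = of_int k * p"
  proof -
    have "Euler v (iso_coord Z ^ n) = 0" if "v \<in> vecs" "v \<noteq> Z" for v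
      using that by (simp add: derivation_power_eq_0[OF derivation_vdotD] vdotD_iso)
    then show "Euler u p = p" "\<And>v. v \<in> vecs \<Longrightarrow> v \<noteq> u \<Longrightarrow> v \<noteq> Z \<Longrightarrow> Euler v p = 0"
      using uv Es by (simp_all add: p_def vdotD_mult)
    show "Euler Z p = of_int k * p"
      using uv Es[of Z] by (simp add: p_def vdotD_mult Euler_iso_power n algebra_simps)
  qed
  have "vdotD Z u (iso_coord Z ^ n) = 0"
    using uv by (simp add: derivation_power_eq_0[OF derivation_vdotD] vdotD_iso)
  moreover have "vdotD Z u s = 0" unfolding s_def using uv by (simp add: vdotD_diff vdotD_mult vdotD_iso vdotD_mvar)
  ultimately have V: "vdotD Z u p = 0" by (simp add: p_def vdotD_mult)
  have d: "d_iso v p = 0" if "v = u \<or> v = Z" for v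
  proof -
    have "d_iso v s = 0"
      using that uv perpD[OF j] unfolding s_def by (auto simp: d_iso_simps d_iso_iso d_iso_mvar)
    moreover have "d_iso v (iso_coord Z ^ n) = 0"
      by (rule derivation_power_eq_0[OF derivation_d_iso]) (use that uv in \<open>auto simp: d_iso_iso\<close>)
    ultimately show ?thesis by (simp add: p_def d_iso_simps)
  qed
  have pdu: "pd (u i) p = (if i = j then iso_coord Z ^ Suc n else 0)" if "i \<in> perp" for i
  proof -
    have "pd (u i) (iso_coord Z ^ n) = 0"
      by (rule derivation_power_eq_0[OF derivation_pd]) (use uv in \<open>simp add: pd_iso\<close>)
    then show ?thesis
      using uv perpD[OF that] by (simp add: p_def s_def pd_mult pd_diff pd_iso pd_mvar_vec mult.commute)
  qed
  have pdZ: "pd (Z i) p = (if i = j then - (iso_coord Z ^ n * iso_coord u) else 0)" if "i \<in> perp" for i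
    using uv perpD[OF that] d_iso_power(2)[OF that, of n]
    by (simp add: p_def s_def pd_mult pd_diff pd_iso pd_mvar_vec)
  have "pd (Z i) (pd (u i) p) = 0" "pd (Z i) (pd (Z i) p) = 0" if "i \<in> perp" for i
    using that uv perpD[OF that] d_iso_power(2)[OF that] unfolding pdu[OF that] pdZ[OF that]
    by (auto simp: pd_minus pd_mult pd_iso simp del: power_Suc)
  then have "DdotD_perp Z v p = 0" if "v = u \<or> v = Z" for v
    using that by (auto simp: DdotD_perp_def)
  then have "2 * DdotD Z v p = 0" if "v = u \<or> v = Z" for v
    using that DdotD_split[of Z v p] d by (simp add: d_commute(1)[symmetric])
  then have "of_nat 2 * DdotD Z v p = 0" if "v = u \<or> v = Z" for v
    using that by simp
  then have D: "DdotD Z v p = 0" if "v = u \<or> v = Z" for v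
    using that unfolding cpoly_char_0 by simp
  have "p \<in> simplicial_harmonics u k 1"
    unfolding simplicial_harmonics_1[OF u] linear_harmonics_def using u uv E V D by auto
  moreover have "p \<noteq> 0"
    using pdu[OF j] iso_power_nonzero[of "Suc n"] by auto
  ultimately show ?thesis by blast
qed

lemma so_irreducible_simplicial_harmonics:
  assumes u: "u = X \<or> u = Y" and k: "k \<ge> 1" and perp: "card perp \<ge> 3"
  shows "so_irreducible (simplicial_harmonics u k 1 :: 'n cpoly set)"
  unfolding so_irreducible_def
proof (intro conjI allI impI so_submodule_simplicial_harmonics[OF u])
  let ?V = "simplicial_harmonics u k 1 :: 'n cpoly set"
  obtain t where t: "t \<in> perp" using perp by fastforce
  then have ne: "perp \<noteq> {}" by blast
  show "?V \<noteq> {0}" by (rule simplicial_harmonics_nonzero[OF u k t])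
  show "U = {0} \<or> U = ?V" if U: "so_submodule U \<and> U \<subseteq> ?V" for U :: "'n cpoly set"
  proof (rule ccontr)
    assume neg: "\<not> ?thesis"
    have bound: "Poly_Mapping.lookup \<mu> v \<le> nat k" if "p \<in> ?V" "\<mu> \<in> Poly_Mapping.keys p"
      for p :: "'n cpoly" and \<mu> v
    proof -
      have "p \<in> linear_harmonics u k" using that(1) unfolding simplicial_harmonics_1[OF u] by blast
      then have "Euler Z p = of_int k * p" "\<exists>a\<in>{0,1}. Euler X p = of_int a * p" "\<exists>a\<in>{0,1}. Euler Y p = of_int a * p"
        using u by (auto simp: linear_harmonics_X linear_harmonics_Y)
      then obtain a b where ab: "Euler Z p = of_int k * p" "Euler X p = of_int a * p" "Euler Y p = of_int b * p"
        "a \<le> 1" "b \<le> 1" by fastforce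
      note le = lookup_le_if_Euler[OF ab(1) that(2)] lookup_le_if_Euler[OF ab(2) that(2)]
        lookup_le_if_Euler[OF ab(3) that(2)]
      \<comment> \<open>One bound serves all variables: the degrees in x and y are at most 1, and k
        is at least 1.\<close>
      have "nat a \<le> nat k" "nat b \<le> nat k" using ab(4,5) k by linarith+
      then show ?thesis using le order_trans by (cases v) blast+
    qed
    obtain W where W: "so_submodule W" "W \<subseteq> ?V" "W \<noteq> {0}" "U \<inter> W = {0}"
    proof (rule orthogonal_complement[OF so_submodule_simplicial_harmonics[OF u]])
      show "so_submodule U" "U \<subseteq> ?V" "U \<noteq> ?V" using U neg by auto
      show "Poly_Mapping.lookup \<mu> v \<le> nat k" if "p \<in> ?V" "\<mu> \<in> Poly_Mapping.keys p"
        for p :: "'n cpoly" and \<mu> v by (rule bound[OF that])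
    qed
    have U': "so_submodule U" "U \<subseteq> ?V" "U \<noteq> {0}" using U neg by auto
    obtain p where p: "p \<in> U" "\<And>j. j \<in> perp \<Longrightarrow> raise j p = 0" "pd (u t) p \<noteq> 0"
      "\<And>l. l \<in> perp \<Longrightarrow> l \<noteq> t \<Longrightarrow> pd (u l) p = 0"
      using raise_invariant_concentrated[OF u perp k U' t] by blast
    obtain q where q: "q \<in> W" "\<And>j. j \<in> perp \<Longrightarrow> raise j q = 0" "pd (u t) q \<noteq> 0"
      "\<And>l. l \<in> perp \<Longrightarrow> l \<noteq> t \<Longrightarrow> pd (u l) q = 0"
      using raise_invariant_concentrated[OF u perp k W(1-3) t] by blast
    have V: "p \<in> ?V" "q \<in> ?V" using p(1) q(1) U W(2) by auto
    obtain c where c: "pd (u t) p = cst c * iso_coord Z ^ nat k"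
      using raise_invariant_simplicial_pd[OF u ne k V(1) p(2) t] by blast
    obtain d where d: "pd (u t) q = cst d * iso_coord Z ^ nat k"
      using raise_invariant_simplicial_pd[OF u ne k V(2) q(2) t] by blast
    have sub: "cpoly.subspace U" "cpoly.subspace W" "cpoly.subspace ?V"
      using U W(1) so_submodule_simplicial_harmonics[OF u, of k] by (simp_all add: so_submodule_def)
    \<comment> \<open>Both vectors are concentrated at t, where their coefficients are c and d times
      the same power. Hence all coefficients of the combination vanish, and these determine
      it.\<close>
    have "cst d * p - cst c * q = 0"
    proof (rule raise_invariant_simplicial_nonzero[OF u ne k])
      show "cst d * p - cst c * q \<in> ?V"
        using V sub(3) by (intro subspace_diff subspace_scale)
      show "raise j (cst d * p - cst c * q) = 0" if "j \<in> perp" for j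
        using p(2)[OF that] q(2)[OF that] by (simp add: raise_simps)
      show "pd (u j) (cst d * p - cst c * q) = 0" if "j \<in> perp" for j
      proof (cases "j = t")
        case True
        then show ?thesis by (simp add: pd_diff pd_mult c d mult_ac)
      next
        case False
        then show ?thesis using p(4)[OF that] q(4)[OF that] by (simp add: pd_diff pd_mult)
      qed
    qed
    then have eq: "cst d * p = cst c * q" by simp
    have "cst d * p \<in> U" by (rule subspace_scale[OF sub(1) p(1)])
    moreover have "cst d * p \<in> W" unfolding eq by (rule subspace_scale[OF sub(2) q(1)])
    ultimately have "cst d * p \<in> U \<inter> W" by simp
    then have "cst d * p = 0" unfolding W(4) by simp
    moreover have "p \<noteq> 0" using p(3) by auto
    ultimately have "d = 0" by simp
    then show False using d q(3) by simp
  qed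
qed

end

section \<open>The decomposition\<close>

text \<open>Any two distinct coordinates can serve as e and f; at least four then remain.\<close>

lemma irreducible_harmonics_modules:
  assumes m: "CARD('n::finite) \<ge> 6"
  shows "b \<ge> 0 \<Longrightarrow> so_irreducible (harmonics b :: 'n cpoly set)"
    and "u = X \<or> u = Y \<Longrightarrow> b \<ge> 1 \<Longrightarrow> so_irreducible (simplicial_harmonics u b 1 :: 'n cpoly set)"
proof -
  have "\<not> CARD('n) \<le> Suc 0" using m by simp
  then obtain e f :: 'n where ef: "e \<noteq> f" by (auto simp: card_le_Suc0_iff_eq)
  interpret isotropic_plane e f by unfold_locales (rule ef)
  have "card perp = CARD('n) - 2" using ef by (simp add: perp_def card_Diff_subset)
  then have perp: "card perp \<ge> 3" using m by simp
  then have "perp \<noteq> {}" by auto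
  then show "b \<ge> 0 \<Longrightarrow> so_irreducible (harmonics b :: 'n cpoly set)"
    and "u = X \<or> u = Y \<Longrightarrow> b \<ge> 1 \<Longrightarrow> so_irreducible (simplicial_harmonics u b 1 :: 'n cpoly set)"
    using so_irreducible_harmonics so_irreducible_simplicial_harmonics perp by blast+
qed

text \<open>\<open>vdotD Z u\<close> recovers b f from the image of f. Constants, the case b = 0,
  are mapped to 0.\<close>

lemma inj_on_opS:
  assumes u: "u = X \<or> u = Y" and b: "b \<ge> 1"
  shows "inj_on (opS u) (harmonics b)"
proof (rule inj_on_if_kernel_trivial)
  show "linear_on_set (harmonics b) (opS u)" using so_hom_on_opS[OF u] by (simp add: so_hom_on_def)
  show "f = 0" if f: "f \<in> harmonics b" "opS u f = 0" for f :: "'a cpoly"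
  proof -
    have "vdotD u Z f = 0" using f opS_harmonics[OF u f(1)] by simp
    then have "of_nat (nat b) * f = 0"
      using vdotD_Z_linear_harmonics(3)[OF u f(1)] b by simp
    then show ?thesis using b unfolding cpoly_char_0 by simp
  qed
qed (rule subspace_harmonics)

lemma inj_on_opC:
  assumes u: "u = X \<or> u = Y" and b: "b \<ge> 0" and m: "CARD('n::finite) \<ge> 3"
  shows "inj_on (opC u) (harmonics b :: 'n cpoly set)"
proof (rule inj_on_if_kernel_trivial)
  show "linear_on_set (harmonics b :: 'n cpoly set) (opC u)"
    using so_hom_on_opC[OF u m] by (simp add: so_hom_on_def)
  show "g = 0" if g: "g \<in> harmonics b" "opC u g = 0" for g :: "'n cpoly"
  proof -
    have "harmonic_mult u b g = 0" using g opC_harmonics[OF u g(1) m] by simp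
    then have "cst (of_nat CARD('n) + of_int b - 2 * of_int b / of_int (2 * b + int CARD('n) - 2)) * g = 0"
      using harmonic_mult_linear_harmonics(2)[OF u g(1) m] by (simp only: DdotD_0)
    then show ?thesis
      using harmonic_mult_coefficient[OF b m] unfolding cst_mult_eq_0_iff by blast
  qed
qed (rule subspace_harmonics)

lemma opS_image_subset:
  assumes "u = X \<or> u = Y"
  shows "opS u ` harmonics b \<subseteq> linear_harmonics u (b - 1)"
  using vdotD_Z_linear_harmonics(1)[OF assms] opS_harmonics[OF assms] by fastforce

lemma opC_image_subset:
  assumes "u = X \<or> u = Y" "CARD('n::finite) \<ge> 3"
  shows "opC u ` harmonics b \<subseteq> (linear_harmonics u (b + 1) :: 'n cpoly set)"
  using harmonic_mult_linear_harmonics(1)[OF assms(1) _ assms(2)] opC_harmonics[OF assms(1) _ assms(2)]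
  by fastforce

lemma simplicial_harmonics_subset:
  assumes "u = X \<or> u = Y"
  shows "simplicial_harmonics u k 1 \<subseteq> linear_harmonics u k"
  unfolding simplicial_harmonics_1[OF assms] by blast

lemma irreducible_isomorphic_image:
  assumes "so_irreducible U" "so_hom_on U T" "inj_on T U"
  shows "so_irreducible (T ` U) \<and> so_isomorphism T U (T ` U)"
  using so_irreducible_image[OF assms] so_isomorphismI[OF _ assms(2,3)] assms(1)
  by (simp add: so_irreducible_def)

lemma irreducible_isomorphic_image_proj_L:
  assumes "so_irreducible U" "so_hom_on U T" "inj_on T U" "T ` U \<subseteq> linear_harmonics Y b"
    and m: "CARD('n::finite) \<ge> 3"
  shows "so_irreducible (proj_L ` T ` U :: 'n cpoly set) \<and> so_isomorphism (proj_L \<circ> T) U (proj_L ` T ` U)"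
proof -
  have "so_hom_on U (proj_L \<circ> T)" by (rule so_hom_on_comp[OF assms(2) so_hom_on_proj_L[OF m] assms(4)])
  moreover have "inj_on (proj_L \<circ> T) U"
    using assms(3) inj_on_subset[OF inj_on_proj_L[OF m] assms(4)] by (rule comp_inj_on)
  ultimately show ?thesis
    unfolding image_comp by (rule irreducible_isomorphic_image[OF assms(1)])
qed

text \<open>The conditions on a single out the nonzero summands. Simplicial labels require a first
  entry of at least 1, and \<open>opS Y\<close> maps constants to 0, so its summand starts at a = 2
  although the harmonics of degree a - 1 are nonzero already for a = 1.\<close>

theorem theorem5p5:
  fixes a :: nat and \<alpha> :: complex
  assumes "CARD('n::finite) \<ge> 6"
    and "\<alpha> = of_nat CARD('n) / 2 - 1 + of_nat a"
  defines "x_part \<equiv> poly_tensor (linear_forms X) (harmonics (int a)) :: 'n cpoly set"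
    and "y_part \<equiv> poly_tensor (linear_forms Y) (harmonics (int a - 2)) :: 'n cpoly set"
  shows
    "is_direct_sum (ker_L 1 \<alpha>) [x_part, proj_L ` y_part]
    \<and> is_direct_sum x_part
        [simplicial_harmonics X (int a) 1, opS X ` harmonics (int a + 1), opC X ` harmonics (int a - 1)]
    \<and> is_direct_sum y_part
        [simplicial_harmonics Y (int a - 2) 1, opS Y ` harmonics (int a - 1), opC Y ` harmonics (int a - 3)]
    \<and> is_direct_sum (proj_L ` y_part)
        [proj_L ` simplicial_harmonics Y (int a - 2) 1, proj_L ` opS Y ` harmonics (int a - 1),
         proj_L ` opC Y ` harmonics (int a - 3)]
    \<and> (a \<ge> 1 \<longrightarrow> so_irreducible (simplicial_harmonics X (int a) 1 :: 'n cpoly set))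
    \<and> (so_irreducible (opS X ` harmonics (int a + 1) :: 'n cpoly set)
        \<and> so_isomorphism (opS X) (harmonics (int a + 1) :: 'n cpoly set) (opS X ` harmonics (int a + 1)))
    \<and> (a \<ge> 1 \<longrightarrow> so_irreducible (opC X ` harmonics (int a - 1) :: 'n cpoly set)
        \<and> so_isomorphism (opC X) (harmonics (int a - 1) :: 'n cpoly set) (opC X ` harmonics (int a - 1)))
    \<and> (a \<ge> 3 \<longrightarrow> so_irreducible (proj_L ` simplicial_harmonics Y (int a - 2) 1 :: 'n cpoly set)
        \<and> so_isomorphism proj_L (simplicial_harmonics Y (int a - 2) 1 :: 'n cpoly set)
            (proj_L ` simplicial_harmonics Y (int a - 2) 1))
    \<and> (a \<ge> 2 \<longrightarrow> so_irreducible (proj_L ` opS Y ` harmonics (int a - 1) :: 'n cpoly set)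
        \<and> so_isomorphism (proj_L \<circ> opS Y) (harmonics (int a - 1) :: 'n cpoly set)
            (proj_L ` opS Y ` harmonics (int a - 1)))
    \<and> (a \<ge> 3 \<longrightarrow> so_irreducible (proj_L ` opC Y ` harmonics (int a - 3) :: 'n cpoly set)
        \<and> so_isomorphism (proj_L \<circ> opC Y) (harmonics (int a - 3) :: 'n cpoly set)
            (proj_L ` opC Y ` harmonics (int a - 3)))"
proof -
  have m: "CARD('n) \<ge> 3" using assms(1) by simp
  have XX: "X = X \<or> X = (Y :: 'n \<Rightarrow> 'n var)" and YY: "Y = X \<or> Y = (Y :: 'n \<Rightarrow> 'n var)" by auto
  have x: "x_part = linear_harmonics X (int a)" unfolding x_part_def by (rule poly_tensor_linear_forms) simp
  have y: "y_part = linear_harmonics Y (int a - 2)" unfolding y_part_def by (rule poly_tensor_linear_forms) simp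
  have arith: "int a - 2 + 1 = int a - 1" "int a - 2 - 1 = int a - 3" "int a - 1 - 1 = int a - 2"
    "int a - 3 + 1 = int a - 2" by simp_all
  note irr = irreducible_harmonics_modules[OF assms(1)]
  have ker: "is_direct_sum (ker_L 1 \<alpha>) [x_part, proj_L ` y_part]"
    unfolding x y by (rule ker_L_direct_sum[OF m]) (simp add: assms(2))
  have xsum: "is_direct_sum x_part
      [simplicial_harmonics X (int a) 1, opS X ` harmonics (int a + 1), opC X ` harmonics (int a - 1)]"
    unfolding x by (rule linear_harmonics_direct_sum[OF XX m])
  have ysum: "is_direct_sum y_part
      [simplicial_harmonics Y (int a - 2) 1, opS Y ` harmonics (int a - 1), opC Y ` harmonics (int a - 3)]"
    unfolding y using linear_harmonics_direct_sum[OF YY m, of "int a - 2"] unfolding arith .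
  have SY: "opS Y ` harmonics (int a - 1) \<subseteq> y_part"
    unfolding y using opS_image_subset[OF YY, of "int a - 1"] unfolding arith .
  have CY: "opC Y ` harmonics (int a - 3) \<subseteq> y_part"
    unfolding y using opC_image_subset[OF YY m, of "int a - 3"] unfolding arith .
  have HY: "simplicial_harmonics Y (int a - 2) 1 \<subseteq> y_part"
    unfolding y by (rule simplicial_harmonics_subset[OF YY])
  have projsum: "is_direct_sum (proj_L ` y_part)
      [proj_L ` simplicial_harmonics Y (int a - 2) 1, proj_L ` opS Y ` harmonics (int a - 1),
       proj_L ` opC Y ` harmonics (int a - 3)]"
  proof (rule is_direct_sum_image[OF ysum _ _ HY SY CY])
    show "linear_on_set y_part proj_L" unfolding y using so_hom_on_proj_L[OF m] by (simp add: so_hom_on_def)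
    show "inj_on proj_L y_part" unfolding y by (rule inj_on_proj_L[OF m])
    show "cpoly.subspace y_part" unfolding y by (rule subspace_linear_harmonics)
  qed
  have X1: "so_irreducible (simplicial_harmonics X (int a) 1 :: 'n cpoly set)" if "a \<ge> 1"
    using irr(2)[OF XX] that by simp
  have X2: "so_irreducible (opS X ` harmonics (int a + 1) :: 'n cpoly set)
      \<and> so_isomorphism (opS X) (harmonics (int a + 1) :: 'n cpoly set) (opS X ` harmonics (int a + 1))"
    by (rule irreducible_isomorphic_image[OF irr(1) so_hom_on_opS[OF XX] inj_on_opS[OF XX]]) simp_all
  have X3: "so_irreducible (opC X ` harmonics (int a - 1) :: 'n cpoly set)
      \<and> so_isomorphism (opC X) (harmonics (int a - 1) :: 'n cpoly set) (opC X ` harmonics (int a - 1))" if "a \<ge> 1"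
    by (rule irreducible_isomorphic_image[OF irr(1) so_hom_on_opC[OF XX m] inj_on_opC[OF XX _ m]]) (use that in simp_all)
  have Y1: "so_irreducible (proj_L ` simplicial_harmonics Y (int a - 2) 1 :: 'n cpoly set)
      \<and> so_isomorphism proj_L (simplicial_harmonics Y (int a - 2) 1 :: 'n cpoly set)
          (proj_L ` simplicial_harmonics Y (int a - 2) 1)" if "a \<ge> 3"
    using that HY unfolding y
    by (intro irreducible_isomorphic_image[OF irr(2)[OF YY] so_hom_on_subset[OF so_hom_on_proj_L[OF m]]
          inj_on_subset[OF inj_on_proj_L[OF m]]]) auto
  have Y2: "so_irreducible (proj_L ` opS Y ` harmonics (int a - 1) :: 'n cpoly set)
      \<and> so_isomorphism (proj_L \<circ> opS Y) (harmonics (int a - 1) :: 'n cpoly set)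
          (proj_L ` opS Y ` harmonics (int a - 1))" if "a \<ge> 2"
    by (rule irreducible_isomorphic_image_proj_L[OF irr(1) so_hom_on_opS[OF YY] inj_on_opS[OF YY] SY[unfolded y] m])
      (use that in simp_all)
  have Y3: "so_irreducible (proj_L ` opC Y ` harmonics (int a - 3) :: 'n cpoly set)
      \<and> so_isomorphism (proj_L \<circ> opC Y) (harmonics (int a - 3) :: 'n cpoly set)
          (proj_L ` opC Y ` harmonics (int a - 3))" if "a \<ge> 3"
    by (rule irreducible_isomorphic_image_proj_L[OF irr(1) so_hom_on_opC[OF YY m] inj_on_opC[OF YY _ m] CY[unfolded y] m])
      (use that in simp_all)
  show ?thesis
    using ker xsum ysum projsum X1 X2 X3 Y1 Y2 Y3 by blast
qed

end
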